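(* Let $p$ be an odd prime, $k\in\mathbb{Z}_p^\times$, $R=\mathbb{Z}_p[x^{\pm1},y^{\pm1},z^{\pm1}]$, and write $\bar x=x^{-1}$ etc. Let $$P=\begin{pmatrix}0&\bar x\bar z-\bar x&\bar x\bar y-\bar x\\ \bar y-\bar y\bar z&0&\bar x\bar y-\bar y\\ \bar z-\bar y\bar z&\bar z-\bar x\bar z&0\end{pmatrix},\qquad N=\begin{pmatrix}0&\bar x&\bar xz\\-\bar y&0&z\\-1&-y&0\end{pmatrix},$$ $$\alpha^{(k)}_{\mathrm{TQFT}}=\begin{pmatrix}\mathbb 1_3-\tfrac12PN&\tfrac1{2k}P\\-\tfrac k2N^\dagger PN&\mathbb 1_3+\tfrac12N^\dagger P\end{pmatrix},$$ and let $$\mathcal M=\frac k2\begin{pmatrix}y-\bar y&\bar xy+\bar x+y-1\\-x\bar y-x-\bar y+1&\bar x-x\end{pmatrix},\qquad H=\begin{pmatrix}\mathbb 1_2&\mathbb 1_2\\ \mathcal M&-\mathcal M\end{pmatrix},\qquad \alpha^{(k)}_{\mathrm{ISA}}=H\begin{pmatrix}\bar x\bar y\bar z\,\mathbb 1_2&0\\0&\mathbb 1_2\end{pmatrix}H^{-1}.$$ Then the translation-invariant Clifford QCAs in three spatial dimensions given by $\alpha^{(k)}_{\mathrm{TQFT}}$ (three $\mathbb{Z}_p$ qudits per site) and $\alpha^{(k)}_{\mathrm{ISA}}$ (two $\mathbb{Z}_p$ qudits per site) are equivalent, i.e. after stabilization they differ by a composition of finite-depth Clifford circuits and shifts.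
   Context: $\mathbb 1_q$ is the $q\times q$ identity; $\dagger$ is transpose composed with the antipode $x\mapsto x^{-1}$, $y\mapsto y^{-1}$, $z\mapsto z^{-1}$. In the polynomial formalism, with $q$ qudits per site of $\mathbb{Z}^3$, a Pauli operator modulo phase is a vector in $R^{2q}$ (first $q$ entries: $X$ exponents, last $q$: $Z$ exponents; monomials record positions). A translation-invariant Clifford QCA modulo phases is a matrix $\alpha\in\mathrm{GL}(2q,R)$ with $\alpha^\dagger\Lambda\alpha=\Lambda$, $\Lambda=\begin{pmatrix}0&\mathbb 1_q\\-\mathbb 1_q&0\end{pmatrix}$; its columns are the images of the $X$'s (first $q$) and $Z$'s (last $q$) at the origin. Finite-depth Clifford circuits are finite products of Clifford QCAs that are block-diagonal with respect to a partition of the lattice into blocks of uniformly bounded diameter; shifts are bounded-range permutations of qudits; stabilization means extending a QCA by the identity on additional qudits per site. $\alpha^{(k)}_{\mathrm{TQFT}}$ is the QCA from the topological action $\frac kp\int B_2\cup B_2$; $\alpha^{(k)}_{\mathrm{ISA}}$ translates the invertible subalgebra generated by the first two columns of $H$ (the columns of $\begin{pmatrix}\mathbb 1_2\\ \mathcal M\end{pmatrix}$) by the vector $(-1,-1,-1)$ and fixes its commutant. *)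

theory Defs
  imports
    "Jordan_Normal_Form.Matrix"
    "Berlekamp_Zassenhaus.Finite_Field"
    "HOL-Library.Poly_Mapping"
    "HOL-Library.Product_Plus"
    "HOL-Library.Disjoint_Sets"
begin

section \<open>Laurent polynomials in three variables\<close>

text \<open>The ring $R$ is the group algebra of the lattice: finitely supported functions on triples of
  integers with the convolution product of \<^theory>\<open>HOL-Library.Poly_Mapping\<close>. The monomial
  $x^a y^b z^c$ is the indicator of the site $(a,b,c)$. The prime $p$ is the cardinality of the
  type \<^typ>\<open>'p\<close>.\<close>

type_synonym site = "int \<times> int \<times> int"
type_synonym 'p laurent = "site \<Rightarrow>\<^sub>0 'p mod_ring"

definition mon :: "int \<Rightarrow> int \<Rightarrow> int \<Rightarrow> ('p :: prime_card) laurent" where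
  "mon a b c = Poly_Mapping.single (a, b, c) 1"

definition const :: "'p mod_ring \<Rightarrow> ('p :: prime_card) laurent" where
  "const a = Poly_Mapping.single 0 a"

abbreviation varx :: "('p :: prime_card) laurent" where "varx \<equiv> mon 1 0 0"
abbreviation vary :: "('p :: prime_card) laurent" where "vary \<equiv> mon 0 1 0"
abbreviation varz :: "('p :: prime_card) laurent" where "varz \<equiv> mon 0 0 1"
abbreviation xbar :: "('p :: prime_card) laurent" where "xbar \<equiv> mon (-1) 0 0"
abbreviation ybar :: "('p :: prime_card) laurent" where "ybar \<equiv> mon 0 (-1) 0"
abbreviation zbar :: "('p :: prime_card) laurent" where "zbar \<equiv> mon 0 0 (-1)"

definition antipode :: "('p :: prime_card) laurent \<Rightarrow> 'p laurent" where
  "antipode = Poly_Mapping.map_key uminus"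

definition dagger :: "('p :: prime_card) laurent mat \<Rightarrow> 'p laurent mat" where
  "dagger A = map_mat antipode (transpose_mat A)"

definition mat_inv :: "'a :: semiring_1 mat \<Rightarrow> 'a mat" where
  "mat_inv A = (THE B. inverts_mat A B \<and> inverts_mat B A)"

definition Lambda :: "nat \<Rightarrow> ('p :: prime_card) laurent mat" where
  "Lambda q = four_block_mat (0\<^sub>m q q) (1\<^sub>m q) (- 1\<^sub>m q) (0\<^sub>m q q)"


section \<open>Pauli operators and Clifford QCAs modulo phases\<close>

text \<open>A Pauli operator modulo phase on $q$ qudits per site is an element of
  \<^term>\<open>carrier_vec (2 * q)\<close>: entry \<open>i < q\<close> at site \<open>s\<close> is the exponent of $X$ on qudit \<open>i\<close> at \<open>s\<close>,
  entry \<open>q + i\<close> that of $Z$.\<close>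

definition support :: "('p :: prime_card) laurent vec \<Rightarrow> site set" where
  "support v = {s. \<exists>i < dim_vec v. Poly_Mapping.lookup (v $ i) s \<noteq> 0}"

fun site_dist :: "site \<Rightarrow> site \<Rightarrow> int" where
  "site_dist (a, b, c) (a', b', c') = max \<bar>a - a'\<bar> (max \<bar>b - b'\<bar> \<bar>c - c'\<bar>)"

text \<open>Commutation phase of two Pauli operators: the coefficient of $1$ in $v^\dagger \Lambda w$.\<close>

definition comm_form :: "nat \<Rightarrow> ('p :: prime_card) laurent vec \<Rightarrow> 'p laurent vec \<Rightarrow> 'p mod_ring" where
  "comm_form q v w = Poly_Mapping.lookup (scalar_prod (map_vec antipode v) (Lambda q *\<^sub>v w)) 0"

text \<open>Clifford QCAs that need not be translation invariant: locality-preserving automorphisms of the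
  Pauli group modulo phases. Additivity is linearity over the prime field; additive maps commuting
  with all monomials are the ones given by matrices over $R$.\<close>

definition clifford_qca ::
  "nat \<Rightarrow> (('p :: prime_card) laurent vec \<Rightarrow> 'p laurent vec) \<Rightarrow> bool" where
  "clifford_qca q f \<longleftrightarrow>
     bij_betw f (carrier_vec (2 * q)) (carrier_vec (2 * q)) \<and>
     (\<forall>v \<in> carrier_vec (2 * q). \<forall>w \<in> carrier_vec (2 * q). f (v + w) = f v + f w) \<and>
     (\<forall>v \<in> carrier_vec (2 * q). \<forall>w \<in> carrier_vec (2 * q).
        comm_form q (f v) (f w) = comm_form q v w) \<and>
     (\<exists>r. \<forall>v \<in> carrier_vec (2 * q). \<forall>t \<in> support (f v). \<exists>s \<in> support v. site_dist s t \<le> r)"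

definition ti_clifford_qca :: "nat \<Rightarrow> ('p :: prime_card) laurent mat \<Rightarrow> bool" where
  "ti_clifford_qca q \<alpha> \<longleftrightarrow>
     \<alpha> \<in> carrier_mat (2 * q) (2 * q) \<and> invertible_mat \<alpha> \<and>
     dagger \<alpha> * Lambda q * \<alpha> = Lambda q"


section \<open>Circuits, shifts and stable equivalence\<close>

definition block_diagonal ::
  "nat \<Rightarrow> site set set \<Rightarrow> (('p :: prime_card) laurent vec \<Rightarrow> 'p laurent vec) \<Rightarrow> bool" where
  "block_diagonal q \<P> f \<longleftrightarrow>
     (\<forall>B \<in> \<P>. \<forall>v \<in> carrier_vec (2 * q). support v \<subseteq> B \<longrightarrow> support (f v) \<subseteq> B)"

definition circuit_layer ::
  "nat \<Rightarrow> (('p :: prime_card) laurent vec \<Rightarrow> 'p laurent vec) \<Rightarrow> bool" where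
  "circuit_layer q f \<longleftrightarrow> clifford_qca q f \<and>
     (\<exists>\<P> r. partition_on UNIV \<P> \<and> (\<forall>B \<in> \<P>. \<forall>s \<in> B. \<forall>t \<in> B. site_dist s t \<le> r) \<and>
        block_diagonal q \<P> f)"

text \<open>Maps on Pauli operators only matter on \<^term>\<open>carrier_vec (2 * q)\<close>.\<close>

definition composition_of ::
  "nat \<Rightarrow> (('a :: zero vec \<Rightarrow> 'a vec) \<Rightarrow> bool) \<Rightarrow> ('a vec \<Rightarrow> 'a vec) \<Rightarrow> bool" where
  "composition_of q S f \<longleftrightarrow>
     (\<exists>gs. (\<forall>g \<in> set gs. S g) \<and> (\<forall>v \<in> carrier_vec (2 * q). f v = foldr (\<circ>) gs id v))"

definition finite_depth_circuit ::
  "nat \<Rightarrow> (('p :: prime_card) laurent vec \<Rightarrow> 'p laurent vec) \<Rightarrow> bool" where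
  "finite_depth_circuit q = composition_of q (circuit_layer q)"

definition qudit_shift ::
  "nat \<Rightarrow> (('p :: prime_card) laurent vec \<Rightarrow> 'p laurent vec) \<Rightarrow> bool" where
  "qudit_shift q f \<longleftrightarrow>
     (\<exists>\<pi> r. bij_betw \<pi> (UNIV \<times> {..<q}) (UNIV \<times> {..<q}) \<and>
        (\<forall>s. \<forall>i < q. site_dist s (fst (\<pi> (s, i))) \<le> r) \<and>
        (\<forall>v \<in> carrier_vec (2 * q). f v \<in> carrier_vec (2 * q) \<and>
           (\<forall>s. \<forall>i < q. case \<pi> (s, i) of (t, j) \<Rightarrow>
              Poly_Mapping.lookup (f v $ j) t = Poly_Mapping.lookup (v $ i) s \<and>
              Poly_Mapping.lookup (f v $ (q + j)) t = Poly_Mapping.lookup (v $ (q + i)) s)))"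

definition direct_sum :: "'a :: zero mat \<Rightarrow> 'a mat \<Rightarrow> 'a mat" where
  "direct_sum A B = four_block_mat A (0\<^sub>m (dim_row A) (dim_col B)) (0\<^sub>m (dim_row B) (dim_col A)) B"

text \<open>Extension by the identity on \<open>a\<close> further qudits per site. The new qudits are numbered after
  the old ones, separately in the $X$ part and in the $Z$ part.\<close>

definition stabilize :: "nat \<Rightarrow> nat \<Rightarrow> ('p :: prime_card) laurent mat \<Rightarrow> 'p laurent mat" where
  "stabilize q a \<alpha> = (case split_block \<alpha> q q of (A, B, C, D) \<Rightarrow>
     four_block_mat (direct_sum A (1\<^sub>m a)) (direct_sum B (0\<^sub>m a a))
                    (direct_sum C (0\<^sub>m a a)) (direct_sum D (1\<^sub>m a)))"

definition qca_equivalent ::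
  "nat \<Rightarrow> ('p :: prime_card) laurent mat \<Rightarrow> nat \<Rightarrow> 'p laurent mat \<Rightarrow> bool" where
  "qca_equivalent q \<alpha> q' \<beta> \<longleftrightarrow>
     (\<exists>a b f. q + a = q' + b \<and>
        composition_of (q + a) (\<lambda>g. finite_depth_circuit (q + a) g \<or> qudit_shift (q + a) g) f \<and>
        (\<forall>v \<in> carrier_vec (2 * (q + a)). stabilize q a \<alpha> *\<^sub>v v = f (stabilize q' b \<beta> *\<^sub>v v)))"


section \<open>The two QCAs\<close>

definition P_mat :: "('p :: prime_card) laurent mat" where
  "P_mat = mat_of_rows_list 3
     [[0,                  xbar * zbar - xbar, xbar * ybar - xbar],
      [ybar - ybar * zbar, 0,                  xbar * ybar - ybar],
      [zbar - ybar * zbar, zbar - xbar * zbar, 0]]"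

definition N_mat :: "('p :: prime_card) laurent mat" where
  "N_mat = mat_of_rows_list 3
     [[0,      xbar,   xbar * varz],
      [- ybar, 0,      varz],
      [- 1,    - vary, 0]]"

definition alpha_TQFT :: "('p :: prime_card) mod_ring \<Rightarrow> 'p laurent mat" where
  "alpha_TQFT k = four_block_mat
     (1\<^sub>m 3 - const (1 / 2) \<cdot>\<^sub>m (P_mat * N_mat))
     (const (1 / (2 * k)) \<cdot>\<^sub>m P_mat)
     (- (const (k / 2) \<cdot>\<^sub>m (dagger N_mat * P_mat * N_mat)))
     (1\<^sub>m 3 + const (1 / 2) \<cdot>\<^sub>m (dagger N_mat * P_mat))"

definition M_mat :: "('p :: prime_card) mod_ring \<Rightarrow> 'p laurent mat" where
  "M_mat k = const (k / 2) \<cdot>\<^sub>m mat_of_rows_list 2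
     [[vary - ybar,                       xbar * vary + xbar + vary - 1],
      [- (varx * ybar) - varx - ybar + 1, xbar - varx]]"

definition H_mat :: "('p :: prime_card) mod_ring \<Rightarrow> 'p laurent mat" where
  "H_mat k = four_block_mat (1\<^sub>m 2) (1\<^sub>m 2) (M_mat k) (- M_mat k)"

definition alpha_ISA :: "('p :: prime_card) mod_ring \<Rightarrow> 'p laurent mat" where
  "alpha_ISA k =
     H_mat k *
     four_block_mat ((xbar * ybar * zbar) \<cdot>\<^sub>m 1\<^sub>m 2) (0\<^sub>m 2 2) (0\<^sub>m 2 2) (1\<^sub>m 2) *
     mat_inv (H_mat k)"

end

theory Submission
  imports Defs
begin

text \<open>Write \<open>\<langle>v, w\<rangle>\<close> for the sesquilinear symplectic form \<open>v\<^sup>\<dagger> \<Lambda> w\<close>, \<open>s = xyz\<close>, \<open>u = s\<^sup>-\<^sup>1\<close>, and \<open>\<alpha>\<close> for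
  \<open>\<alpha>\<^sub>I\<^sub>S\<^sub>A\<close> extended by one qudit. The theorem follows from a factorization
  \<open>\<alpha>\<^sub>T\<^sub>Q\<^sub>F\<^sub>T = L \<alpha> R\<close> in which \<open>L\<close> and \<open>R\<close> are products of elementary symplectic \<open>6 \<times> 6\<close> matrices: shears
  by hermitian matrices, and base changes of the \<open>X\<close> part by products of matrices \<open>1 + h E\<^sub>i\<^sub>j\<close>.

  Why elementary matrices are harmless. Each of them is a product of transvections
  \<open>T(a, b) v = v + \<langle>b, v\<rangle> a + \<langle>a, v\<rangle> b\<close> with \<open>a\<close>, \<open>b\<close> isotropic and orthogonal. A symplectic \<open>\<sigma>\<close>
  conjugates \<open>T(a, b)\<close> into \<open>T(\<sigma> a, \<sigma> b)\<close>, where nothing remains known about \<open>\<sigma> a\<close>, \<open>\<sigma> b\<close> except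
  that they are again isotropic and orthogonal. One ancilla with its Pauli pair \<open>e\<close>, \<open>f\<close> suffices to
  implement this: \<open>T(\<sigma> a, \<sigma> b)\<close> is the commutator of \<open>T(e, \<sigma> a)\<close> and \<open>T(f, \<sigma> b)\<close>
  (\<open>eichler_commutator\<close>), and maps of the form \<open>T(e, c)\<close> split along the coordinates and monomials of
  \<open>c\<close> into single-site gates conjugated by shifts of one qudit. Hence every conjugate of an elementary
  matrix is a composition of circuits and shifts once one ancilla is added (\<open>stably_realizable\<close>). In
  \<open>\<alpha>\<^sub>T\<^sub>Q\<^sub>F\<^sub>T = L (\<alpha> R \<alpha>\<^sup>-\<^sup>1) \<alpha>\<close> both factors in front of \<open>\<alpha>\<close> are therefore realizable on four qudits.

  Why the factorization exists. Put \<open>A = N\<^sup>\<dagger> - N\<close>, \<open>Q = P / 2k\<close>, \<open>T = (k/2) A\<close>. A lower shear conjugates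
  \<open>\<alpha>\<^sub>T\<^sub>Q\<^sub>F\<^sub>T\<close> into the Cayley form with blocks \<open>1 + QT\<close>, \<open>Q\<close>, \<open>TQT\<close>, \<open>1 + TQ\<close>, which is symplectic because
  \<open>P\<^sup>\<dagger> A P = 2 (P - P\<^sup>\<dagger>)\<close>. On the other side \<open>\<alpha>\<^sub>I\<^sub>S\<^sub>A\<close> has the blocks \<open>(1 + u)/2\<close>, \<open>(u - 1)/2 M\<^sup>-\<^sup>1\<close>,
  \<open>(u - 1)/2 M\<close>, \<open>(1 + u)/2\<close>. Two symplectic matrices with the same first block column differ only by an
  upper shear (\<open>same_first_block_column\<close>), so only the columns \<open>(1 + QT, TQT)\<close> and
  \<open>((1 + u)/2, (u - 1)/2 M)\<close> must be matched. A hermitian lower shear by \<open>K\<close> adds \<open>(1 + u)/2 K\<close> to the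
  lower block, so \<open>M\<close> matters only modulo \<open>1 + s\<close>. The \<open>3 \<times> 3\<close> form \<open>A\<close> is degenerate, and
  with a basis \<open>B\<^sub>0\<close> whose last vector spans its kernel the upper block becomes
  \<open>(1 + QT) G = B\<^sub>0 diag((1 + u)/2, (1 + u)/2, 1)\<close> for another basis \<open>G\<close> (\<open>G_top_block\<close>), and the lower
  block becomes, in the basis \<open>B\<^sub>0\<close> and up to a factor \<open>k/2\<close>, \<open>(u + 1)/2 K + (u - 1)/2 \<theta>\<close>
  (\<open>dagger_B0_A_PAB0\<close>). The form \<open>(k/2) \<theta>\<close> agrees with \<open>M\<close> after a last base change \<open>B\<^sub>1\<close>
  (\<open>B1_theta\<close>). All three base changes are products of elementary matrices.\<close>

section \<open>Laurent polynomials and the antipode\<close>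

text \<open>A Laurent polynomial is a sum of monomials, so that gates with Laurent polynomial coefficients
  reduce to gates with one monomial coefficient.\<close>

lemma laurent_induct [case_names single add]:
  fixes f :: "'p :: prime_card laurent"
  assumes single: "\<And>s c. P (Poly_Mapping.single s c)"
    and add: "\<And>f g. P f \<Longrightarrow> P g \<Longrightarrow> P (f + g)"
  shows "P f"
proof (induction f rule: Poly_Mapping.update_induct)
  case const
  show ?case using single[of 0 0] by simp
next
  case (update f a b)
  have "Poly_Mapping.update a b f = f + Poly_Mapping.single a b"
    using update(1)
    by (intro poly_mapping_eqI)
      (auto simp: lookup_update lookup_add lookup_single in_keys_iff when_def)
  then show ?case using update single add by simp
qed

lemma lookup_antipode: "Poly_Mapping.lookup (antipode f) s = Poly_Mapping.lookup f (- s)"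
  unfolding antipode_def by (subst map_key.rep_eq) (auto simp: inj_def)

lemma antipode_add [simp]: "antipode (f + g) = antipode f + antipode g"
  by (intro poly_mapping_eqI) (simp add: lookup_antipode lookup_add)

lemma antipode_zero [simp]: "antipode 0 = 0"
  by (intro poly_mapping_eqI) (simp add: lookup_antipode)

lemma antipode_uminus [simp]: "antipode (- f) = - antipode f"
  by (intro poly_mapping_eqI) (simp add: lookup_antipode)

lemma antipode_diff [simp]: "antipode (f - g) = antipode f - antipode g"
  by (intro poly_mapping_eqI) (simp add: lookup_antipode lookup_minus)

lemma antipode_antipode [simp]: "antipode (antipode f) = f"
  by (intro poly_mapping_eqI) (simp add: lookup_antipode)

lemma antipode_single [simp]:
  "antipode (Poly_Mapping.single s c) = Poly_Mapping.single (- s) c"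
proof (intro poly_mapping_eqI)
  fix t
  have "s = - t \<longleftrightarrow> - s = t" by auto
  then show "Poly_Mapping.lookup (antipode (Poly_Mapping.single s c)) t
      = Poly_Mapping.lookup (Poly_Mapping.single (- s) c) t"
    by (simp add: lookup_antipode lookup_single when_def)
qed

lemma antipode_mult [simp]: "antipode (f * g) = antipode f * antipode g"
proof (induction f rule: laurent_induct)
  case (single s c)
  show ?case
    by (induction g rule: laurent_induct) (simp_all add: mult_single distrib_left)
qed (simp add: distrib_right)

lemma antipode_const [simp]: "antipode (const c) = const c"
  by (simp add: const_def)

lemma antipode_mon [simp]: "antipode (mon a b c) = mon (- a) (- b) (- c)"
  by (simp add: mon_def)

lemma const_one [simp]: "const 1 = 1"
  unfolding const_def by (rule single_one)

lemma const_numeral [simp]: "const (numeral w) = numeral w"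
  unfolding const_def by (rule single_numeral)

lemma const_mult: "const (a * b) = const a * const b"
  by (simp add: const_def mult_single)

lemma const_add: "const (a + b) = const a + const b"
  by (simp add: const_def single_add)

lemma antipode_one [simp]: "antipode 1 = 1"
  using antipode_const[of 1] by simp

lemma antipode_numeral [simp]: "antipode (numeral w) = numeral w"
  using antipode_const[of "numeral w"] by simp

lemma antipode_sum: "antipode (sum f A) = (\<Sum>i\<in>A. antipode (f i))"
  by (induction A rule: infinite_finite_induct) simp_all

lemma lookup_single_mult:
  "Poly_Mapping.lookup (Poly_Mapping.single m c * f) (m + s)
    = c * Poly_Mapping.lookup (f :: 'p :: prime_card laurent) s"
  by (induction f rule: laurent_induct)
    (auto simp: mult_single lookup_single when_def lookup_add distrib_left)

lemma lookup_const_mult: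
  "Poly_Mapping.lookup (const c * f) s = c * Poly_Mapping.lookup f s"
  using lookup_single_mult[of 0 c f s] by (simp add: const_def)

section \<open>The symplectic form over the Laurent ring\<close>

text \<open>\<open>v\<^sup>\<dagger> \<Lambda> w\<close> with values in \<open>R\<close>. Its constant coefficient is the commutation phase; the other
  coefficients are the phases against translates, so an \<open>R\<close>-linear map preserves this form as soon as it
  preserves the phase. Being sesquilinear, it is what computations with matrices use.\<close>

definition form :: "nat \<Rightarrow> 'p :: prime_card laurent vec \<Rightarrow> 'p laurent vec \<Rightarrow> 'p laurent" where
  "form n v w = (\<Sum>i<n. antipode (v $ i) * w $ (n + i) - antipode (v $ (n + i)) * w $ i)"

lemma form_add_right:
  assumes "v \<in> carrier_vec (2 * n)" "w \<in> carrier_vec (2 * n)"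
  shows "form n u (v + w) = form n u v + form n u w"
proof -
  have "form n u (v + w) = (\<Sum>i<n. (antipode (u $ i) * v $ (n + i) - antipode (u $ (n + i)) * v $ i)
      + (antipode (u $ i) * w $ (n + i) - antipode (u $ (n + i)) * w $ i))"
    unfolding form_def using assms by (intro sum.cong) (auto simp: algebra_simps)
  then show ?thesis by (simp add: form_def sum.distrib)
qed

lemma form_smult_right:
  assumes "v \<in> carrier_vec (2 * n)"
  shows "form n u (c \<cdot>\<^sub>v v) = c * form n u v"
  unfolding form_def sum_distrib_left using assms
  by (intro sum.cong) (auto simp: algebra_simps)

lemma form_swap: "form n w v = - antipode (form n v w)"
  unfolding form_def antipode_sum sum_negf[symmetric]
  by (intro sum.cong) (auto simp: algebra_simps)

lemma form_add_left:
  assumes "v \<in> carrier_vec (2 * n)" "w \<in> carrier_vec (2 * n)"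
  shows "form n (v + w) u = form n v u + form n w u"
  using form_add_right[OF assms, of u] by (simp add: form_swap[of n _ u])

lemma form_smult_left:
  assumes "v \<in> carrier_vec (2 * n)"
  shows "form n (c \<cdot>\<^sub>v v) u = antipode c * form n v u"
  using form_smult_right[OF assms, of u c] by (simp add: form_swap[of n _ u])

lemma form_zero_left [simp]: "form n (0\<^sub>v (2 * n)) v = 0"
  unfolding form_def by (intro sum.neutral) auto

lemma form_uminus_right:
  assumes "v \<in> carrier_vec (2 * n)"
  shows "form n u (- v) = - form n u v"
  unfolding form_def sum_negf[symmetric] using assms
  by (intro sum.cong) (auto simp: algebra_simps)

lemma form_uminus_left:
  assumes "v \<in> carrier_vec (2 * n)"
  shows "form n (- v) u = - form n v u"
  using form_uminus_right[OF assms, of u] by (simp add: form_swap[of n _ u])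

lemma form_X:
  assumes "i < n"
  shows "form n (unit_vec (2 * n) i) w = w $ (n + i)"
proof -
  have "form n (unit_vec (2 * n) i) w = (\<Sum>j<n. if j = i then w $ (n + i) else 0)"
    unfolding form_def using assms by (intro sum.cong) (auto simp: unit_vec_def)
  then show ?thesis using assms by simp
qed

lemma form_Z:
  assumes "i < n"
  shows "form n (unit_vec (2 * n) (n + i)) w = - w $ i"
proof -
  have "form n (unit_vec (2 * n) (n + i)) w = (\<Sum>j<n. if j = i then - w $ i else 0)"
    unfolding form_def using assms by (intro sum.cong) (auto simp: unit_vec_def)
  then show ?thesis using assms by simp
qed

lemma sum_lessThan_add:
  fixes g :: "nat \<Rightarrow> 'a :: comm_monoid_add"
  shows "(\<Sum>i<n + m. g i) = (\<Sum>i<n. g i) + (\<Sum>i<m. g (n + i))"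
  by (induction m) (simp_all add: add.assoc)

lemma form_Lambda:
  assumes v: "v \<in> carrier_vec (2 * n)" and w: "w \<in> carrier_vec (2 * n)"
  shows "form n v w = scalar_prod (map_vec antipode v) (Lambda n *\<^sub>v w)"
proof -
  let ?L = "Lambda n :: 'a laurent mat"
  have L: "?L \<in> carrier_mat (2 * n) (2 * n)"
    by (auto simp: Lambda_def mult_2)
  have ind: "(?L *\<^sub>v w) $ i = (if i < n then w $ (n + i) else - w $ (i - n))" if i: "i < 2 * n" for i
  proof -
    have "(?L *\<^sub>v w) $ i = (\<Sum>j<2 * n. ?L $$ (i, j) * w $ j)"
      using i L w by (simp add: scalar_prod_def atLeast0LessThan)
    also have "\<dots> = (\<Sum>j<2 * n. if j = (if i < n then n + i else i - n)
        then (if i < n then w $ (n + i) else - w $ (i - n)) else 0)"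
      using i by (intro sum.cong) (auto simp: Lambda_def)
    also have "\<dots> = (if i < n then w $ (n + i) else - w $ (i - n))"
      using i by (auto simp: sum.delta)
    finally show ?thesis .
  qed
  have "scalar_prod (map_vec antipode v) (?L *\<^sub>v w)
      = (\<Sum>i<2 * n. antipode (v $ i) * (?L *\<^sub>v w) $ i)"
    using v L by (simp add: scalar_prod_def atLeast0LessThan)
  also have "\<dots> = (\<Sum>i<n + n. antipode (v $ i) * (?L *\<^sub>v w) $ i)"
    by (simp add: mult_2)
  also have "\<dots> = (\<Sum>i<n. antipode (v $ i) * (?L *\<^sub>v w) $ i)
      + (\<Sum>i<n. antipode (v $ (n + i)) * (?L *\<^sub>v w) $ (n + i))"
    by (rule sum_lessThan_add)
  also have "\<dots> = form n v w"
    unfolding form_def sum.distrib[symmetric]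
    by (intro sum.cong) (auto simp: ind)
  finally show ?thesis by simp
qed

lemma comm_form_eq:
  assumes "v \<in> carrier_vec (2 * n)" "w \<in> carrier_vec (2 * n)"
  shows "comm_form n v w = Poly_Mapping.lookup (form n v w) 0"
  using form_Lambda[OF assms] by (simp add: comm_form_def)

section \<open>Eichler transformations\<close>

text \<open>For isotropic \<open>e\<close>, \<open>a\<close> orthogonal to \<open>e\<close> and \<open>h - antipode h = \<langle>a, a\<rangle>\<close> these are isometries
  that fix \<open>e\<close> and act trivially on \<open>e\<^sup>\<bottom> / e\<close>. For \<open>h = 0\<close> and isotropic \<open>a\<close> this is, symmetrically in \<open>e\<close> and \<open>a\<close>,
  the transvection \<open>T(e, a)\<close>.\<close>

definition eichler ::
  "nat \<Rightarrow> 'p :: prime_card laurent vec \<Rightarrow> 'p laurent vec \<Rightarrow> 'p laurent \<Rightarrow> 'p laurent vec \<Rightarrow> 'p laurent vec"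
  where "eichler n e a h v =
    v + form n a v \<cdot>\<^sub>v e + form n e v \<cdot>\<^sub>v a + (h * form n e v) \<cdot>\<^sub>v e"

lemma eichler_closed:
  assumes "e \<in> carrier_vec (2 * n)" "a \<in> carrier_vec (2 * n)" "v \<in> carrier_vec (2 * n)"
  shows "eichler n e a h v \<in> carrier_vec (2 * n)"
  using assms by (simp add: eichler_def)

lemma eichler_index:
  assumes "e \<in> carrier_vec (2 * n)" "a \<in> carrier_vec (2 * n)" "v \<in> carrier_vec (2 * n)" "i < 2 * n"
  shows "eichler n e a h v $ i
    = v $ i + form n a v * e $ i + form n e v * a $ i + h * form n e v * e $ i"
  using assms by (simp add: eichler_def)

lemma form_eichler_right:
  assumes "e \<in> carrier_vec (2 * n)" "a \<in> carrier_vec (2 * n)" "v \<in> carrier_vec (2 * n)"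
  shows "form n w (eichler n e a h v)
    = form n w v + form n a v * form n w e + form n e v * form n w a + h * form n e v * form n w e"
  using assms by (simp add: eichler_def form_add_right form_smult_right)

lemma form_perp_swap: "form n e a = 0 \<Longrightarrow> form n a e = 0"
  by (simp add: form_swap[of n a e])

text \<open>For fixed \<open>e\<close> the maps form a Heisenberg group: translations by \<open>a\<close>, with the centre
  recorded by the parameter \<open>h\<close>.\<close>

lemma eichler_eichler:
  assumes carr: "e \<in> carrier_vec (2 * n)" "a \<in> carrier_vec (2 * n)" "b \<in> carrier_vec (2 * n)"
      "v \<in> carrier_vec (2 * n)"
    and perp: "form n e e = 0" "form n e a = 0" "form n e b = 0"
  shows "eichler n e a h (eichler n e b g v) = eichler n e (a + b) (h + g + form n a b) v"
proof (rule eq_vecI)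
  have c: "eichler n e b g v \<in> carrier_vec (2 * n)" "a + b \<in> carrier_vec (2 * n)"
    using carr by (auto intro: eichler_closed)
  show "dim_vec (eichler n e a h (eichler n e b g v))
      = dim_vec (eichler n e (a + b) (h + g + form n a b) v)"
    using carr c by (simp add: eichler_def)
  fix i assume "i < dim_vec (eichler n e (a + b) (h + g + form n a b) v)"
  then have i: "i < 2 * n" using carr by (simp add: eichler_def)
  show "eichler n e a h (eichler n e b g v) $ i
      = eichler n e (a + b) (h + g + form n a b) v $ i"
    using carr c i perp form_perp_swap[OF perp(2)]
    by (simp add: eichler_index form_eichler_right form_add_left algebra_simps)
qed

lemma eichler_zero:
  assumes "e \<in> carrier_vec (2 * n)" "v \<in> carrier_vec (2 * n)"
  shows "eichler n e (0\<^sub>v (2 * n)) 0 v = v"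
  using assms by (intro eq_vecI) (auto simp: eichler_def)

lemma eichler_inverse:
  assumes carr: "e \<in> carrier_vec (2 * n)" "a \<in> carrier_vec (2 * n)" "v \<in> carrier_vec (2 * n)"
    and perp: "form n e e = 0" "form n e a = 0" "form n a a = 0"
  shows "eichler n e a 0 (eichler n e (- a) 0 v) = v"
proof -
  have "a + (- a) = 0\<^sub>v (2 * n)"
    using carr(2) by auto
  then show ?thesis
    using carr perp
    by (subst eichler_eichler) (auto simp: form_uminus_right eichler_zero)
qed

lemma eichler_commute:
  assumes "e \<in> carrier_vec (2 * n)" "a \<in> carrier_vec (2 * n)" "v \<in> carrier_vec (2 * n)"
  shows "eichler n e a 0 v = eichler n a e 0 v"
  using assms by (intro eq_vecI) (auto simp: eichler_def algebra_simps)

lemma eichler_add: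
  assumes "e \<in> carrier_vec (2 * n)" "a \<in> carrier_vec (2 * n)" "v \<in> carrier_vec (2 * n)"
     "w \<in> carrier_vec (2 * n)"
  shows "eichler n e a h (v + w) = eichler n e a h v + eichler n e a h w"
  using assms by (intro eq_vecI) (auto simp: eichler_def form_add_right algebra_simps)

lemma eichler_smult:
  assumes "e \<in> carrier_vec (2 * n)" "a \<in> carrier_vec (2 * n)" "v \<in> carrier_vec (2 * n)"
  shows "eichler n e a h (c \<cdot>\<^sub>v v) = c \<cdot>\<^sub>v eichler n e a h v"
  using assms by (intro eq_vecI) (auto simp: eichler_def form_smult_right algebra_simps)

lemma form_eichler_eichler:
  assumes carr: "e \<in> carrier_vec (2 * n)" "a \<in> carrier_vec (2 * n)"
      "v \<in> carrier_vec (2 * n)" "w \<in> carrier_vec (2 * n)"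
    and perp: "form n e e = 0" "form n e a = 0" "h - antipode h = form n a a"
  shows "form n (eichler n e a h v) (eichler n e a h w) = form n v w"
proof -
  have s: "form n v e = - antipode (form n e v)" "form n v a = - antipode (form n a v)"
    by (rule form_swap)+
  have h: "h = antipode h + form n a a"
    using perp(3) by (simp add: algebra_simps)
  have "form n (eichler n e a h v) (eichler n e a h w)
      = form n v w + antipode (form n e v) * form n e w * (form n a a - h + antipode h)"
    using carr perp(1,2) form_perp_swap[OF perp(2)]
    by (simp add: form_eichler_right)
      (simp add: eichler_def form_add_left form_smult_left s algebra_simps)
  also have "form n a a - h + antipode h = 0"
    using h by (simp add: algebra_simps)
  finally show ?thesis by simp
qed

definition isometry_on :: "nat \<Rightarrow> ('p :: prime_card laurent vec \<Rightarrow> 'p laurent vec) \<Rightarrow> bool" where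
  "isometry_on n \<sigma> \<longleftrightarrow>
    (\<forall>v \<in> carrier_vec (2 * n). \<sigma> v \<in> carrier_vec (2 * n)) \<and>
    (\<forall>v \<in> carrier_vec (2 * n). \<forall>w \<in> carrier_vec (2 * n). \<sigma> (v + w) = \<sigma> v + \<sigma> w) \<and>
    (\<forall>v \<in> carrier_vec (2 * n). \<forall>c. \<sigma> (c \<cdot>\<^sub>v v) = c \<cdot>\<^sub>v \<sigma> v) \<and>
    (\<forall>v \<in> carrier_vec (2 * n). \<forall>w \<in> carrier_vec (2 * n). form n (\<sigma> v) (\<sigma> w) = form n v w)"

text \<open>The formula mentions \<open>e\<close> and \<open>a\<close> only through the form, so isometries transport it.\<close>

lemma eichler_conjugate:
  assumes "isometry_on n \<sigma>"
    and "e \<in> carrier_vec (2 * n)" "a \<in> carrier_vec (2 * n)" "v \<in> carrier_vec (2 * n)"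
  shows "\<sigma> (eichler n e a h v) = eichler n (\<sigma> e) (\<sigma> a) h (\<sigma> v)"
proof -
  note I = assms(1)[unfolded isometry_on_def]
  have c: "\<sigma> w \<in> carrier_vec (2 * n)" if "w \<in> carrier_vec (2 * n)" for w
    using I that by blast
  have add: "\<sigma> (w + w') = \<sigma> w + \<sigma> w'"
    if "w \<in> carrier_vec (2 * n)" "w' \<in> carrier_vec (2 * n)" for w w'
    using I that by blast
  have smult: "\<sigma> (r \<cdot>\<^sub>v w) = r \<cdot>\<^sub>v \<sigma> w" if "w \<in> carrier_vec (2 * n)" for r w
    using I that by blast
  have pres: "form n (\<sigma> w) (\<sigma> w') = form n w w'"
    if "w \<in> carrier_vec (2 * n)" "w' \<in> carrier_vec (2 * n)" for w w'
    using I that by blast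
  have "\<sigma> (eichler n e a h v)
      = \<sigma> v + form n a v \<cdot>\<^sub>v \<sigma> e + form n e v \<cdot>\<^sub>v \<sigma> a + (h * form n e v) \<cdot>\<^sub>v \<sigma> e"
    using assms(2-) by (simp add: eichler_def add smult del: assoc_add_vec)
  then show ?thesis
    using assms(2-) by (simp add: eichler_def pres)
qed

lemma isometry_on_eichler:
  assumes "e \<in> carrier_vec (2 * n)" "a \<in> carrier_vec (2 * n)"
    and "form n e e = 0" "form n e a = 0" "h - antipode h = form n a a"
  shows "isometry_on n (eichler n e a h)"
  unfolding isometry_on_def using assms
  by (auto intro: eichler_closed simp: eichler_add eichler_smult form_eichler_eichler)

text \<open>The reason why one ancilla suffices. With \<open>e\<close>, \<open>f\<close> a hyperbolic pair orthogonal to \<open>a\<close> and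
  \<open>b\<close>, conjugation by \<open>T(e, a)\<close> fixes \<open>b\<close> and moves \<open>f\<close> to \<open>f + a\<close>; hence the commutator is
  \<open>T(f + a, b) T(f, - b) = T(a, b)\<close>. On the left every transvection involves \<open>e\<close> or \<open>f\<close>.\<close>

lemma eichler_commutator:
  assumes carr: "e \<in> carrier_vec (2 * n)" "f \<in> carrier_vec (2 * n)" "a \<in> carrier_vec (2 * n)"
      "b \<in> carrier_vec (2 * n)" "v \<in> carrier_vec (2 * n)"
    and plane: "form n e e = 0" "form n f f = 0" "form n e f = 1"
    and perp: "form n e a = 0" "form n f a = 0" "form n e b = 0" "form n f b = 0"
    and iso: "form n a a = 0" "form n b b = 0" "form n a b = 0"
  shows "eichler n e a 0 (eichler n f b 0 (eichler n e (- a) 0 (eichler n f (- b) 0 v)))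
    = eichler n a b 0 v"
proof -
  let ?\<sigma> = "eichler n e a 0"
  let ?w = "eichler n f (- b) 0 v"
  have w: "?w \<in> carrier_vec (2 * n)" and m: "eichler n e (- a) 0 ?w \<in> carrier_vec (2 * n)"
    using carr by (auto intro!: eichler_closed)
  have w_eq: "?w = eichler n b (- f) 0 v"
    using carr by (intro eq_vecI) (auto simp: eichler_def form_uminus_left algebra_simps)
  have iso\<sigma>: "isometry_on n ?\<sigma>"
    using carr plane perp iso by (intro isometry_on_eichler) auto
  have f: "?\<sigma> f = f + a"
    using carr plane perp form_perp_swap[OF perp(2)]
    by (intro eq_vecI) (auto simp: eichler_def)
  have b: "?\<sigma> b = b"
    using carr perp iso by (intro eq_vecI) (auto simp: eichler_def)
  have "?\<sigma> (eichler n f b 0 (eichler n e (- a) 0 ?w)) = eichler n (f + a) b 0 (?\<sigma> (eichler n e (- a) 0 ?w))"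
    using eichler_conjugate[OF iso\<sigma> carr(2,4) m] by (simp add: f b)
  also have "?\<sigma> (eichler n e (- a) 0 ?w) = ?w"
    using carr w plane perp iso by (intro eichler_inverse) auto
  also have "eichler n (f + a) b 0 ?w = eichler n b (f + a) 0 ?w"
    using carr w by (intro eichler_commute) auto
  also have "\<dots> = eichler n b (f + a) 0 (eichler n b (- f) 0 v)"
    by (simp only: w_eq)
  also have "\<dots> = eichler n b (f + a + (- f)) (0 + 0 + form n (f + a) (- f)) v"
    using carr perp iso form_perp_swap[OF perp(4)] form_perp_swap[OF iso(3)]
    by (intro eichler_eichler) (auto simp: form_add_right form_uminus_right)
  also have "f + a + (- f) = a"
    using carr by (intro eq_vecI) auto
  also have "0 + 0 + form n (f + a) (- f) = 0"
    using carr plane form_perp_swap[OF perp(2)]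
    by (auto simp: form_add_left form_uminus_right)
  also have "eichler n b a 0 v = eichler n a b 0 v"
    using carr by (intro eichler_commute) auto
  finally show ?thesis .
qed

section \<open>Circuits and shifts\<close>

definition realizable :: "nat \<Rightarrow> ('p :: prime_card laurent vec \<Rightarrow> 'p laurent vec) \<Rightarrow> bool" where
  "realizable n f \<longleftrightarrow>
    composition_of n (\<lambda>g. finite_depth_circuit n g \<or> qudit_shift n g) f \<and>
    (\<forall>v \<in> carrier_vec (2 * n). f v \<in> carrier_vec (2 * n))"

lemma realizable_cong:
  assumes "realizable n f" "\<And>v. v \<in> carrier_vec (2 * n) \<Longrightarrow> g v = f v"
  shows "realizable n g"
  using assms unfolding realizable_def composition_of_def by metis

lemma foldr_comp_append: "foldr (\<circ>) (fs @ gs) id = foldr (\<circ>) fs id \<circ> foldr (\<circ>) gs id"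
  by (induction fs) (simp_all add: comp_assoc)

lemma realizable_comp:
  assumes f: "realizable n f" and g: "realizable n g"
  shows "realizable n (\<lambda>v. f (g v))"
proof -
  obtain fs where fs: "\<forall>h\<in>set fs. finite_depth_circuit n h \<or> qudit_shift n h"
      "\<forall>v\<in>carrier_vec (2 * n). f v = foldr (\<circ>) fs id v"
    using f unfolding realizable_def composition_of_def by blast
  obtain gs where gs: "\<forall>h\<in>set gs. finite_depth_circuit n h \<or> qudit_shift n h"
      "\<forall>v\<in>carrier_vec (2 * n). g v = foldr (\<circ>) gs id v"
    using g unfolding realizable_def composition_of_def by blast
  have c: "g v \<in> carrier_vec (2 * n)" "f (g v) \<in> carrier_vec (2 * n)" if "v \<in> carrier_vec (2 * n)" for v
    using that f g unfolding realizable_def by auto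
  have "\<forall>v\<in>carrier_vec (2 * n). f (g v) = foldr (\<circ>) (fs @ gs) id v"
  proof
    fix v :: "'a laurent vec" assume v: "v \<in> carrier_vec (2 * n)"
    have "f (g v) = foldr (\<circ>) fs id (g v)" using fs(2) c(1)[OF v] by blast
    also have "\<dots> = foldr (\<circ>) fs id (foldr (\<circ>) gs id v)"
      using gs(2) v by metis
    also have "foldr (\<circ>) fs id (foldr (\<circ>) gs id v) = (foldr (\<circ>) fs id \<circ> foldr (\<circ>) gs id) v"
      by (rule o_apply[symmetric])
    also have "\<dots> = foldr (\<circ>) (fs @ gs) id v"
      by (rule fun_cong[OF foldr_comp_append[symmetric]])
    finally show "f (g v) = foldr (\<circ>) (fs @ gs) id v" .
  qed
  moreover have "\<forall>h\<in>set (fs @ gs). finite_depth_circuit n h \<or> qudit_shift n h"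
    using fs(1) gs(1) by auto
  ultimately have "composition_of n (\<lambda>h. finite_depth_circuit n h \<or> qudit_shift n h) (\<lambda>v. f (g v))"
    unfolding composition_of_def by (intro exI[of _ "fs @ gs"] conjI)
  then show ?thesis
    using c(2) unfolding realizable_def by simp
qed

lemma composition_of_single: "S f \<Longrightarrow> composition_of n S f"
  unfolding composition_of_def by (rule exI[of _ "[f]"]) simp

lemma realizable_gate:
  assumes "finite_depth_circuit n f \<or> qudit_shift n f"
    and "\<And>v. v \<in> carrier_vec (2 * n) \<Longrightarrow> f v \<in> carrier_vec (2 * n)"
  shows "realizable n f"
  unfolding realizable_def using assms by (simp add: composition_of_single)

lemma realizable_layer:
  assumes "circuit_layer n f"
  shows "realizable n f"
proof -
  have "finite_depth_circuit n f"
    unfolding finite_depth_circuit_def using assms by (rule composition_of_single[where S = "circuit_layer n"])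
  moreover have "f v \<in> carrier_vec (2 * n)" if "v \<in> carrier_vec (2 * n)" for v
    using assms that bij_betw_apply unfolding circuit_layer_def clifford_qca_def by metis
  ultimately show ?thesis
    by (simp add: realizable_gate)
qed

lemma realizable_shift: "qudit_shift n f \<Longrightarrow> realizable n f"
  by (rule realizable_gate) (auto simp: qudit_shift_def)

lemma site_dist_self: "site_dist s s = 0"
  by (cases s) simp

lemma site_dist_translate: "site_dist s (m + s) = site_dist 0 m"
  by (cases s; cases m) (simp add: zero_prod_def)

text \<open>A map that does not enlarge supports is block diagonal for the partition into single sites.\<close>

lemma onsite_layer:
  assumes bij: "bij_betw f (carrier_vec (2 * n)) (carrier_vec (2 * n))"
    and iso: "isometry_on n f"
    and supp: "\<And>v. v \<in> carrier_vec (2 * n) \<Longrightarrow> support (f v) \<subseteq> support v"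
  shows "circuit_layer n f"
proof -
  have "clifford_qca n f"
    unfolding clifford_qca_def
  proof (intro conjI ballI exI[of _ 0])
    fix v w :: "'a laurent vec"
    assume v: "v \<in> carrier_vec (2 * n)" and w: "w \<in> carrier_vec (2 * n)"
    show "f (v + w) = f v + f w"
      using v w iso unfolding isometry_on_def by blast
    have "f v \<in> carrier_vec (2 * n)" "f w \<in> carrier_vec (2 * n)"
      using v w iso unfolding isometry_on_def by blast+
    then show "comm_form n (f v) (f w) = comm_form n v w"
      using v w iso unfolding isometry_on_def by (simp add: comm_form_eq)
  next
    fix v t assume "v \<in> carrier_vec (2 * n)" "t \<in> support (f v)"
    then show "\<exists>s\<in>support v. site_dist s t \<le> 0"
      using supp[of v] site_dist_self[of t] by (intro bexI[of _ t]) auto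
  qed (rule bij)
  moreover have "partition_on UNIV (range (\<lambda>s :: site. {s}))"
    by (auto simp: partition_on_def disjoint_def)
  moreover have "\<forall>B\<in>range (\<lambda>s :: site. {s}). \<forall>s\<in>B. \<forall>t\<in>B. site_dist s t \<le> 0"
    by (auto simp: site_dist_self)
  moreover have "block_diagonal n (range (\<lambda>s :: site. {s})) f"
    unfolding block_diagonal_def using supp by blast
  ultimately show ?thesis
    unfolding circuit_layer_def by blast
qed

text \<open>Entries \<open>i\<close> and \<open>n + i\<close> are the two Pauli coordinates of the same qudit.\<close>

definition qudit_of :: "nat \<Rightarrow> nat \<Rightarrow> nat" where
  "qudit_of n i = (if i < n then i else i - n)"

lemma form_unit:
  assumes "i < 2 * n"
  shows "form n (unit_vec (2 * n) i) w = (if i < n then w $ (n + i) else - w $ (i - n))"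
proof (cases "i < n")
  case True
  then show ?thesis by (simp add: form_X)
next
  case False
  then have "i = n + (i - n)" by simp
  then show ?thesis
    using assms False form_Z[of "i - n" n w] by simp
qed

lemma form_unit_perp:
  assumes "i < 2 * n" "j < 2 * n" "i = j \<or> qudit_of n i \<noteq> qudit_of n j"
  shows "form n (unit_vec (2 * n) i) (unit_vec (2 * n) j) = 0"
  using assms by (auto simp: form_unit qudit_of_def split: if_splits)

definition shift_qudit :: "nat \<Rightarrow> nat \<Rightarrow> site \<Rightarrow> 'p :: prime_card laurent vec \<Rightarrow> 'p laurent vec" where
  "shift_qudit n r m v = vec (2 * n) (\<lambda>i.
     if qudit_of n i = r then Poly_Mapping.single m 1 * v $ i else v $ i)"

lemma shift_qudit_realizable:
  assumes r: "r < n"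
  shows "realizable n (shift_qudit n r m)"
proof (rule realizable_shift, unfold qudit_shift_def, intro exI conjI)
  let ?\<pi> = "\<lambda>(s, i). (if i = r then m + s else s, i)"
  let ?\<rho> = "\<lambda>(s, i). (if i = r then - m + s else s, i)"
  show "bij_betw ?\<pi> (UNIV \<times> {..<n}) (UNIV \<times> {..<n})"
    by (rule bij_betw_byWitness[of _ ?\<rho>]) auto
  show "\<forall>s. \<forall>i<n. site_dist s (fst (?\<pi> (s, i))) \<le> max 0 (site_dist 0 m)"
    by (auto simp: site_dist_translate site_dist_self)
  show "\<forall>v\<in>carrier_vec (2 * n). shift_qudit n r m v \<in> carrier_vec (2 * n) \<and>
      (\<forall>s. \<forall>i<n. case ?\<pi> (s, i) of (t, j) \<Rightarrow>
         Poly_Mapping.lookup (shift_qudit n r m v $ j) t = Poly_Mapping.lookup (v $ i) s \<and>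
         Poly_Mapping.lookup (shift_qudit n r m v $ (n + j)) t = Poly_Mapping.lookup (v $ (n + i)) s)"
    by (auto simp: shift_qudit_def qudit_of_def lookup_single_mult)
qed

lemma isometry_on_shift_qudit: "isometry_on n (shift_qudit n r m)"
  unfolding isometry_on_def
proof (intro conjI ballI allI)
  fix v w :: "'a laurent vec" and c
  assume v: "v \<in> carrier_vec (2 * n)" 
  show "shift_qudit n r m v \<in> carrier_vec (2 * n)"
    by (simp add: shift_qudit_def)
  show "shift_qudit n r m (c \<cdot>\<^sub>v v) = c \<cdot>\<^sub>v shift_qudit n r m v"
    using v by (intro eq_vecI) (auto simp: shift_qudit_def algebra_simps)
  assume w: "w \<in> carrier_vec (2 * n)"
  show "shift_qudit n r m (v + w) = shift_qudit n r m v + shift_qudit n r m w"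
    using v w by (intro eq_vecI) (auto simp: shift_qudit_def algebra_simps)
  have u: "Poly_Mapping.single (- m) 1 * (Poly_Mapping.single m 1 * f) = f" for f :: "'a laurent"
    by (simp add: mult.assoc[symmetric] mult_single)
  have u': "Poly_Mapping.single (- m) 1 * a * (Poly_Mapping.single m 1 * b) = a * b" for a b :: "'a laurent"
    using u[of "a * b"] by (simp add: algebra_simps)
  show "form n (shift_qudit n r m v) (shift_qudit n r m w) = form n v w"
    unfolding form_def
    by (intro sum.cong) (auto simp: shift_qudit_def qudit_of_def u')
qed

lemma shift_qudit_inverse:
  assumes "v \<in> carrier_vec (2 * n)"
  shows "shift_qudit n r m (shift_qudit n r (- m) v) = v"
proof -
  have "Poly_Mapping.single m 1 * (Poly_Mapping.single (- m) 1 * f) = f" for f :: "'a laurent"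
    by (simp add: mult.assoc[symmetric] mult_single)
  then show ?thesis
    using assms by (intro eq_vecI) (auto simp: shift_qudit_def)
qed

lemma onsite_eichler_realizable:
  assumes i: "i < 2 * n" and j: "j < 2 * n" and ij: "qudit_of n i \<noteq> qudit_of n j"
  shows "realizable n (eichler n (unit_vec (2 * n) i) (const c \<cdot>\<^sub>v unit_vec (2 * n) j) 0)"
proof (intro realizable_layer onsite_layer)
  let ?e = "unit_vec (2 * n) i :: 'a laurent vec" and ?u = "unit_vec (2 * n) j :: 'a laurent vec"
  let ?a = "const c \<cdot>\<^sub>v ?u"
  let ?f = "eichler n ?e ?a 0"
  have carr: "?e \<in> carrier_vec (2 * n)" "?a \<in> carrier_vec (2 * n)" "?u \<in> carrier_vec (2 * n)" by auto
  have perp: "form n ?e ?e = 0" "form n ?e ?a = 0" "form n ?a ?a = 0"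
    using i j ij carr by (auto simp: form_unit_perp form_smult_left form_smult_right)
  show "isometry_on n ?f"
    using carr perp by (intro isometry_on_eichler) auto
  have inv: "?f (eichler n ?e (- ?a) 0 v) = v" "eichler n ?e (- ?a) 0 (?f v) = v"
    if "v \<in> carrier_vec (2 * n)" for v
    using eichler_inverse[of ?e n ?a v] eichler_inverse[of ?e n "- ?a" v] that carr perp
    by (auto simp: form_uminus_left form_uminus_right)
  show "bij_betw ?f (carrier_vec (2 * n)) (carrier_vec (2 * n))"
  proof (rule bij_betw_byWitness[of _ "eichler n ?e (- ?a) 0"])
    have ma: "- ?a \<in> carrier_vec (2 * n)" by simp
    show "\<forall>v\<in>carrier_vec (2 * n). eichler n ?e (- ?a) 0 (?f v) = v"
      using inv(2) by blast
    show "\<forall>v\<in>carrier_vec (2 * n). ?f (eichler n ?e (- ?a) 0 v) = v"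
      using inv(1) by blast
    show "?f ` carrier_vec (2 * n) \<subseteq> carrier_vec (2 * n)"
      using eichler_closed[OF carr(1,2)] by blast
    show "eichler n ?e (- ?a) 0 ` carrier_vec (2 * n) \<subseteq> carrier_vec (2 * n)"
      using eichler_closed[OF carr(1) ma] by blast
  qed
  fix v :: "'a laurent vec" assume v: "v \<in> carrier_vec (2 * n)"
  show "support (?f v) \<subseteq> support v"
  proof
    fix s assume s: "s \<in> support (?f v)"
    show "s \<in> support v"
    proof (rule ccontr)
      assume "s \<notin> support v"
      then have z: "Poly_Mapping.lookup (v $ t) s = 0" if "t < 2 * n" for t
        using v that unfolding support_def by auto
      have fe: "Poly_Mapping.lookup (form n ?e v) s = 0"
        using i z by (auto simp: form_unit)
      have fa: "Poly_Mapping.lookup (form n ?a v) s = 0"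
        using j z by (auto simp: form_unit form_smult_left lookup_const_mult)
      have "Poly_Mapping.lookup (?f v $ t) s = 0" if t: "t < 2 * n" for t
      proof -
        have "?f v $ t = v $ t + (if t = i then form n ?a v else 0)
            + (if t = j then const c * form n ?e v else 0)"
          using t i j v carr by (auto simp: eichler_def)
        then show ?thesis
          using z[OF t] fe fa by (auto simp: lookup_add lookup_const_mult)
      qed
      moreover have "dim_vec (?f v) = 2 * n"
        using v by (simp add: eichler_def)
      ultimately show False
        using s unfolding support_def by auto
    qed
  qed
qed

text \<open>For a monomial coefficient a shift of qudit \<open>j\<close> alone brings the two coupled sites together, and
  the coupling becomes a gate on single sites. Sums of monomials are products of such maps.\<close>

lemma unit_eichler_realizable:
  assumes i: "i < 2 * n" and j: "j < 2 * n" and ij: "qudit_of n i \<noteq> qudit_of n j"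
  shows "realizable n (eichler n (unit_vec (2 * n) i) (g \<cdot>\<^sub>v unit_vec (2 * n) j) 0)"
proof (induction g rule: laurent_induct)
  case (single m c)
  let ?e = "unit_vec (2 * n) i :: 'a laurent vec" and ?u = "unit_vec (2 * n) j :: 'a laurent vec"
  let ?\<sigma> = "shift_qudit n (qudit_of n j) m" and ?\<tau> = "shift_qudit n (qudit_of n j) (- m)"
  have qj: "qudit_of n j < n" using j by (auto simp: qudit_of_def)
  have "realizable n (\<lambda>v. ?\<sigma> (eichler n ?e (const c \<cdot>\<^sub>v ?u) 0 (?\<tau> v)))"
    by (rule realizable_comp[OF shift_qudit_realizable[OF qj]
        realizable_comp[OF onsite_eichler_realizable[OF i j ij] shift_qudit_realizable[OF qj]]])
  moreover have "eichler n ?e (Poly_Mapping.single m c \<cdot>\<^sub>v ?u) 0 v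
      = ?\<sigma> (eichler n ?e (const c \<cdot>\<^sub>v ?u) 0 (?\<tau> v))" if v: "v \<in> carrier_vec (2 * n)" for v
  proof -
    have e: "?\<sigma> ?e = ?e"
      using i j ij by (intro eq_vecI) (auto simp: shift_qudit_def)
    have a: "?\<sigma> (const c \<cdot>\<^sub>v ?u) = Poly_Mapping.single m c \<cdot>\<^sub>v ?u"
      using j by (intro eq_vecI) (auto simp: shift_qudit_def const_def mult_single)
    have t: "?\<tau> v \<in> carrier_vec (2 * n)"
      by (simp add: shift_qudit_def)
    have "?\<sigma> (eichler n ?e (const c \<cdot>\<^sub>v ?u) 0 (?\<tau> v))
        = eichler n ?e (Poly_Mapping.single m c \<cdot>\<^sub>v ?u) 0 (?\<sigma> (?\<tau> v))"
      using eichler_conjugate[OF isometry_on_shift_qudit _ _ t] by (simp add: e a)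
    then show ?thesis using v by (simp add: shift_qudit_inverse)
  qed
  ultimately show ?case by (rule realizable_cong)
next
  case (add f g)
  let ?e = "unit_vec (2 * n) i :: 'a laurent vec" and ?u = "unit_vec (2 * n) j :: 'a laurent vec"
  have "realizable n (\<lambda>v. eichler n ?e (f \<cdot>\<^sub>v ?u) 0 (eichler n ?e (g \<cdot>\<^sub>v ?u) 0 v))"
    by (rule realizable_comp[OF add])
  moreover have "eichler n ?e ((f + g) \<cdot>\<^sub>v ?u) 0 v
      = eichler n ?e (f \<cdot>\<^sub>v ?u) 0 (eichler n ?e (g \<cdot>\<^sub>v ?u) 0 v)"
    if v: "v \<in> carrier_vec (2 * n)" for v
  proof -
    have perp: "form n ?e ?e = 0" "form n ?e (f \<cdot>\<^sub>v ?u) = 0" "form n ?e (g \<cdot>\<^sub>v ?u) = 0"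
        "form n (f \<cdot>\<^sub>v ?u) (g \<cdot>\<^sub>v ?u) = 0"
      using i j ij by (simp_all add: form_unit_perp form_smult_left form_smult_right)
    have "f \<cdot>\<^sub>v ?u + g \<cdot>\<^sub>v ?u = (f + g) \<cdot>\<^sub>v ?u"
      by (simp add: add_smult_distrib_vec)
    then show ?thesis
      using eichler_eichler[of ?e n "f \<cdot>\<^sub>v ?u" "g \<cdot>\<^sub>v ?u" v 0 0] v perp by simp
  qed
  ultimately show ?case by (rule realizable_cong)
qed

section \<open>Transvections as circuits\<close>

abbreviation half :: "'p :: prime_card laurent" where "half \<equiv> const (1 / 2)"

lemma two_nonzero:
  assumes "odd CARD('p :: prime_card)"
  shows "(2 :: 'p mod_ring) \<noteq> 0"
proof
  assume "(2 :: 'p mod_ring) = 0"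
  then have "of_nat 2 = (0 :: 'p mod_ring)" by simp
  then have "CARD('p) dvd 2"
    by (metis of_nat_0_mod_ring_dvd)
  then show False
    using assms prime_card[where ?'a = 'p] by (auto dest!: dvd_imp_le simp: prime_nat_iff le_Suc_eq numeral_2_eq_2)
qed

lemma half_add_half:
  assumes "(2 :: 'p :: prime_card mod_ring) \<noteq> 0"
  shows "half + half = (1 :: 'p laurent)"
proof -
  have "1 / 2 + 1 / 2 = (1 :: 'p mod_ring)" using assms by (simp add: field_simps)
  then show ?thesis using const_add[of "1 / 2" "1 / 2 :: 'p mod_ring"] by simp
qed

lemma half_mult_two:
  assumes "(2 :: 'p :: prime_card mod_ring) \<noteq> 0"
  shows "half * f + half * f = (f :: 'p laurent)"
  using half_add_half[OF assms] by (simp add: distrib_right[symmetric])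

text \<open>The centre of the Heisenberg group is reached through commutators: for \<open>b\<close>, \<open>c\<close> supported on
  another qudit with \<open>\<langle>b, c\<rangle> = h / 2\<close>, the commutator of the translations by \<open>b\<close> and \<open>c\<close> is the
  central element \<open>2 \<langle>b, c\<rangle> = h\<close>.\<close>

lemma center_realizable:
  fixes h :: "'p :: prime_card laurent"
  assumes two: "(2 :: 'p mod_ring) \<noteq> 0"
    and i: "i < 2 * n" and n: "n \<ge> 2" and h: "antipode h = h"
  shows "realizable n (eichler n (unit_vec (2 * n) i) (0\<^sub>v (2 * n)) h)"
proof -
  obtain r where r: "r < n" "qudit_of n i \<noteq> r"
  proof (cases "qudit_of n i = 0")
    case True then show ?thesis using n that[of 1] by auto
  next
    case False then show ?thesis using n that[of 0] by auto
  qed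
  let ?e = "unit_vec (2 * n) i :: 'p laurent vec"
  let ?X = "unit_vec (2 * n) r :: 'p laurent vec"
  let ?Z = "unit_vec (2 * n) (n + r) :: 'p laurent vec"
  define b where "b = 1 \<cdot>\<^sub>v ?X"
  define c where "c = (half * h) \<cdot>\<^sub>v ?Z"
  have mb: "- b = (- 1) \<cdot>\<^sub>v ?X" and mc: "- c = (- (half * h)) \<cdot>\<^sub>v ?Z"
    unfolding b_def c_def by (intro eq_vecI; simp)+
  have q: "qudit_of n r = r" "qudit_of n (n + r) = r"
    using r by (auto simp: qudit_of_def)
  have rx: "r < 2 * n" and rz: "n + r < 2 * n" using r by auto
  have carr: "?e \<in> carrier_vec (2 * n)" "b \<in> carrier_vec (2 * n)" "c \<in> carrier_vec (2 * n)"
    by (auto simp: b_def c_def)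
  have perp: "form n ?e ?e = 0" "form n ?e b = 0" "form n ?e c = 0"
      "form n b b = 0" "form n c c = 0"
    unfolding b_def c_def using i r q
    by (simp_all add: form_smult_left form_smult_right form_unit_perp)
  have bc: "form n b c = half * h" "form n c b = - (half * h)"
    using r h form_swap[of n c b]
    by (simp_all add: b_def c_def form_smult_left form_smult_right form_X)
  have "realizable n (\<lambda>v. eichler n ?e b 0 (eichler n ?e c 0 (eichler n ?e (- b) 0 (eichler n ?e (- c) 0 v))))"
    unfolding mb mc unfolding b_def c_def
    by (rule realizable_comp[OF unit_eichler_realizable[OF i rx] realizable_comp[OF
        unit_eichler_realizable[OF i rz] realizable_comp[OF
        unit_eichler_realizable[OF i rx] unit_eichler_realizable[OF i rz]]]])
      (use q r in auto)
  moreover have "eichler n ?e (0\<^sub>v (2 * n)) h v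
      = eichler n ?e b 0 (eichler n ?e c 0 (eichler n ?e (- b) 0 (eichler n ?e (- c) 0 v)))"
    if v: "v \<in> carrier_vec (2 * n)" for v
  proof -
    have 1: "eichler n ?e (- b) 0 (eichler n ?e (- c) 0 v) = eichler n ?e (- b + - c) (half * h) v"
      using eichler_eichler[of ?e n "- b" "- c" v 0 0] carr perp v bc
      by (simp add: form_uminus_left form_uminus_right)
    have w: "eichler n ?e (- b + - c) (half * h) v \<in> carrier_vec (2 * n)"
      using carr v by (auto intro!: eichler_closed)
    have 2: "eichler n ?e b 0 (eichler n ?e c 0 w) = eichler n ?e (b + c) (half * h) w"
      if "w \<in> carrier_vec (2 * n)" for w
      using eichler_eichler[of ?e n b c w 0 0] carr perp that bc by simp
    have z: "b + c + (- b + - c) = 0\<^sub>v (2 * n)"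
      using carr by (intro eq_vecI) auto
    have f: "form n (b + c) (- b + - c) = 0"
      using carr perp bc by (simp add: form_add_left form_add_right form_uminus_right)
    have "eichler n ?e (b + c) (half * h) (eichler n ?e (- b + - c) (half * h) v)
        = eichler n ?e (0\<^sub>v (2 * n)) (half * h + half * h) v"
      using eichler_eichler[of ?e n "b + c" "- b + - c" v "half * h" "half * h"] carr perp v
      by (simp add: z f form_add_right form_uminus_right)
    then show ?thesis
      using 1 2[OF w] half_mult_two[OF two, of h] by simp
  qed
  ultimately show ?thesis by (rule realizable_cong)
qed

text \<open>Splitting off one coordinate of \<open>a\<close> at a time leaves a central element, whose parameter is
  hermitian because \<open>h - antipode h = \<langle>a, a\<rangle>\<close> is preserved along the way.\<close>

lemma eichler_realizable:
  fixes a :: "'p :: prime_card laurent vec"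
  assumes two: "(2 :: 'p mod_ring) \<noteq> 0" and n: "n \<ge> 2" and i: "i < 2 * n"
    and a: "a \<in> carrier_vec (2 * n)"
    and perp: "\<And>j. j < 2 * n \<Longrightarrow> qudit_of n j = qudit_of n i \<Longrightarrow> a $ j = 0"
    and h: "h - antipode h = form n a a"
  shows "realizable n (eichler n (unit_vec (2 * n) i) a h)"
proof -
  let ?e = "unit_vec (2 * n) i :: 'p laurent vec"
  have main: "realizable n (eichler n ?e a h)"
    if "t \<le> 2 * n" "a \<in> carrier_vec (2 * n)" "\<forall>j. t \<le> j \<and> j < 2 * n \<longrightarrow> a $ j = 0"
      "\<forall>j < 2 * n. qudit_of n j = qudit_of n i \<longrightarrow> a $ j = 0" "h - antipode h = form n a a" for t a h
    using that
  proof (induction t arbitrary: a h)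
    case 0
    then have "a = 0\<^sub>v (2 * n)" by (intro eq_vecI) auto
    then show ?case using 0 two i n center_realizable[of i n h] by simp
  next
    case (Suc t)
    show ?case
    proof (cases "a $ t = 0")
      case True
      then have "\<forall>j. t \<le> j \<and> j < 2 * n \<longrightarrow> a $ j = 0"
        using Suc.prems(3) by (metis Suc_leI le_neq_implies_less)
      then show ?thesis using Suc by auto
    next
      case False
      then have t: "t < 2 * n" and q: "qudit_of n i \<noteq> qudit_of n t"
        using Suc.prems by auto
      \<comment> \<open>\<open>T(e, a) = T(e, a') T(e, b)\<close> up to the central correction \<open>\<langle>a', b\<rangle>\<close> kept in \<open>h'\<close>.\<close>
      define b where "b = a $ t \<cdot>\<^sub>v unit_vec (2 * n) t"
      define a' where "a' = vec (2 * n) (\<lambda>j. if j = t then 0 else a $ j)"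
      define h' where "h' = h - form n a' b"
      have carr: "a' \<in> carrier_vec (2 * n)" "b \<in> carrier_vec (2 * n)" "?e \<in> carrier_vec (2 * n)"
        by (auto simp: a'_def b_def)
      have ab: "a = a' + b"
        using Suc.prems t by (intro eq_vecI) (auto simp: a'_def b_def)
      have bb: "form n b b = 0"
        using t unfolding b_def by (simp add: form_smult_left form_smult_right form_unit_perp)
      have eb: "form n ?e b = 0"
        using t i q unfolding b_def by (simp add: form_smult_right form_unit_perp)
      have ea': "form n ?e a' = 0"
        using Suc.prems(4) i by (auto simp: form_unit a'_def qudit_of_def)
      have ee: "form n ?e ?e = 0"
        using i by (simp add: form_unit_perp)
      have "h' - antipode h' = form n a' a'"
        using Suc.prems(5) carr bb form_swap[of n b a']
        unfolding ab h'_def by (simp add: form_add_left form_add_right algebra_simps)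
      then have "realizable n (eichler n ?e a' h')"
        using Suc.prems t by (intro Suc.IH) (auto simp: a'_def)
      moreover have "realizable n (eichler n ?e b 0)"
        unfolding b_def using i t q by (intro unit_eichler_realizable)
      ultimately have "realizable n (\<lambda>v. eichler n ?e a' h' (eichler n ?e b 0 v))"
        by (rule realizable_comp)
      moreover have "eichler n ?e a h v = eichler n ?e a' h' (eichler n ?e b 0 v)"
        if "v \<in> carrier_vec (2 * n)" for v
        using eichler_eichler[OF carr(3,1,2) that ee ea' eb, of h' 0] by (simp add: ab h'_def)
      ultimately show ?thesis by (rule realizable_cong)
    qed
  qed
  show ?thesis
    by (rule main[OF order.refl a _ _ h]) (use perp in auto)
qed

text \<open>The qudit \<open>l\<close>, on which \<open>a\<close> and \<open>b\<close> vanish, is the ancilla; its \<open>X\<close> and \<open>Z\<close> are the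
  hyperbolic pair of the commutator.\<close>

lemma transvection_realizable:
  fixes a b :: "'p :: prime_card laurent vec"
  assumes two: "(2 :: 'p mod_ring) \<noteq> 0" and n: "n \<ge> 2" and l: "l < n"
    and carr: "a \<in> carrier_vec (2 * n)" "b \<in> carrier_vec (2 * n)"
    and perp: "a $ l = 0" "a $ (n + l) = 0" "b $ l = 0" "b $ (n + l) = 0"
    and iso: "form n a a = 0" "form n b b = 0" "form n a b = 0"
  shows "realizable n (eichler n a b 0)"
proof -
  let ?e = "unit_vec (2 * n) l :: 'p laurent vec"
  let ?f = "unit_vec (2 * n) (n + l) :: 'p laurent vec"
  have q: "j = l \<or> j = n + l" if "qudit_of n j = qudit_of n l \<or> qudit_of n j = qudit_of n (n + l)" for j
    using that l by (auto simp: qudit_of_def split: if_splits)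
  have z: "a $ j = 0" "b $ j = 0" if "qudit_of n j = qudit_of n l \<or> qudit_of n j = qudit_of n (n + l)" for j
    using q[OF that] perp by auto
  have m: "- a \<in> carrier_vec (2 * n)" "- b \<in> carrier_vec (2 * n)"
    using carr by auto
  have "realizable n (\<lambda>v. eichler n ?e a 0 (eichler n ?f b 0 (eichler n ?e (- a) 0 (eichler n ?f (- b) 0 v))))"
    by (rule realizable_comp[OF eichler_realizable[OF two n] realizable_comp[OF
        eichler_realizable[OF two n] realizable_comp[OF
        eichler_realizable[OF two n] eichler_realizable[OF two n]]]])
      (use l carr m perp iso in \<open>auto simp: z form_uminus_left form_uminus_right\<close>)
  moreover have "eichler n a b 0 v
      = eichler n ?e a 0 (eichler n ?f b 0 (eichler n ?e (- a) 0 (eichler n ?f (- b) 0 v)))"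
    if "v \<in> carrier_vec (2 * n)" for v
    using l carr perp iso that
    by (intro eichler_commutator[symmetric]) (auto simp: form_X form_Z)
  ultimately show ?thesis by (rule realizable_cong)
qed

section \<open>Symplectic matrices\<close>

lemma dagger_carrier [simp]: "A \<in> carrier_mat m n \<Longrightarrow> dagger A \<in> carrier_mat n m"
  by (simp add: dagger_def)

lemma dagger_index [simp]:
  "i < dim_col A \<Longrightarrow> j < dim_row A \<Longrightarrow> dagger A $$ (i, j) = antipode (A $$ (j, i))"
  "dim_row (dagger A) = dim_col A" "dim_col (dagger A) = dim_row A"
  by (simp_all add: dagger_def)

lemma dagger_dagger [simp]: "dagger (dagger A) = A"
  by (intro eq_matI) auto

lemma dagger_mult:
  assumes "A \<in> carrier_mat l m" "B \<in> carrier_mat m n"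
  shows "dagger (A * B) = dagger B * dagger A"
  using assms
  by (intro eq_matI) (auto simp: scalar_prod_def antipode_sum intro!: sum.cong)

lemma dagger_one [simp]: "dagger (1\<^sub>m n) = 1\<^sub>m n"
  by (intro eq_matI) auto

lemma dagger_zero [simp]: "dagger (0\<^sub>m m n) = 0\<^sub>m n m"
  by (intro eq_matI) auto

lemma dagger_uminus [simp]: "dagger (- A) = - dagger A"
  by (intro eq_matI) auto

lemma dagger_add:
  assumes "A \<in> carrier_mat m n" "B \<in> carrier_mat m n"
  shows "dagger (A + B) = dagger A + dagger B"
  using assms by (intro eq_matI) auto

lemma dagger_smult: "dagger (c \<cdot>\<^sub>m A) = antipode c \<cdot>\<^sub>m dagger A"
  by (intro eq_matI) auto

lemma dagger_four_block:
  assumes "A \<in> carrier_mat m n" "B \<in> carrier_mat m k" "C \<in> carrier_mat l n" "D \<in> carrier_mat l k"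
  shows "dagger (four_block_mat A B C D) = four_block_mat (dagger A) (dagger C) (dagger B) (dagger D)"
  using assms by (intro eq_matI) auto

lemma Lambda_carrier [simp]: "Lambda n \<in> carrier_mat (2 * n) (2 * n)"
  by (auto simp: Lambda_def mult_2)

lemma Lambda_dims [simp]: "dim_row (Lambda n) = 2 * n" "dim_col (Lambda n) = 2 * n"
  using Lambda_carrier[of n] by blast+

lemma Lambda_Lambda: "Lambda n * Lambda n = - 1\<^sub>m (2 * n)"
proof -
  have "Lambda n * Lambda n = four_block_mat (- 1\<^sub>m n) (0\<^sub>m n n) (0\<^sub>m n n) (- 1\<^sub>m n)"
    unfolding Lambda_def by (subst mult_four_block_mat[of _ n n _ n _ n _ _ n _ n]) auto
  also have "\<dots> = - 1\<^sub>m (2 * n)"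
    by (intro eq_matI) auto
  finally show ?thesis .
qed

lemma square_mult_closed:
  "A \<in> carrier_mat N N \<Longrightarrow> B \<in> carrier_mat N N \<Longrightarrow> A * B \<in> carrier_mat N N"
  by (rule mult_carrier_mat)

lemma square_mult_assoc:
  "A \<in> carrier_mat N N \<Longrightarrow> B \<in> carrier_mat N N \<Longrightarrow> C \<in> carrier_mat N N \<Longrightarrow>
    A * B * C = A * (B * (C :: 'a :: semiring_0 mat))"
  by (rule assoc_mult_mat)

text \<open>Both one-sided conditions are included, so that the inverse \<open>symp_inv\<close> is two-sided without an
  appeal to determinants.\<close>

definition symplectic :: "nat \<Rightarrow> 'p :: prime_card laurent mat \<Rightarrow> bool" where
  "symplectic n A \<longleftrightarrow> A \<in> carrier_mat (2 * n) (2 * n) \<and>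
     dagger A * Lambda n * A = Lambda n \<and> A * Lambda n * dagger A = Lambda n"

definition symp_inv :: "nat \<Rightarrow> 'p :: prime_card laurent mat \<Rightarrow> 'p laurent mat" where
  "symp_inv n A = - (Lambda n * dagger A * Lambda n)"

lemma symp_inv_carrier [simp]:
  "A \<in> carrier_mat (2 * n) (2 * n) \<Longrightarrow> symp_inv n A \<in> carrier_mat (2 * n) (2 * n)"
  unfolding symp_inv_def by (intro uminus_carrier_mat mult_carrier_mat[of _ _ "2 * n"]) auto

lemma symp_inv_left_of:
  assumes A: "A \<in> carrier_mat (2 * n) (2 * n)" and s: "dagger A * Lambda n * A = Lambda n"
  shows "symp_inv n A * A = 1\<^sub>m (2 * n)"
proof -
  let ?N = "2 * n"
  have c: "Lambda n \<in> carrier_mat ?N ?N" "dagger A \<in> carrier_mat ?N ?N" using A by auto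
  have "symp_inv n A * A = - (Lambda n * dagger A * Lambda n * A)"
    unfolding symp_inv_def using A c by (intro uminus_mult_left_mat) auto
  also have "Lambda n * dagger A * Lambda n * A = Lambda n * (dagger A * Lambda n * A)"
    using A c by (simp add: square_mult_assoc[of _ ?N] square_mult_closed del: assoc_mult_mat)
  finally show ?thesis by (simp add: s Lambda_Lambda)
qed

lemma symp_inv_left: "symplectic n A \<Longrightarrow> symp_inv n A * A = 1\<^sub>m (2 * n)"
  unfolding symplectic_def by (rule symp_inv_left_of) auto

lemma symp_inv_right:
  assumes "symplectic n A"
  shows "A * symp_inv n A = 1\<^sub>m (2 * n)"
proof -
  let ?N = "2 * n"
  have c: "Lambda n \<in> carrier_mat ?N ?N" "A \<in> carrier_mat ?N ?N" "dagger A \<in> carrier_mat ?N ?N"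
    and s: "A * Lambda n * dagger A = Lambda n"
    using assms by (auto simp: symplectic_def)
  have "A * symp_inv n A = - (A * (Lambda n * dagger A * Lambda n))"
    unfolding symp_inv_def using c by (intro uminus_mult_right_mat) auto
  also have "A * (Lambda n * dagger A * Lambda n) = A * Lambda n * dagger A * Lambda n"
    using c by (simp add: square_mult_assoc[of _ ?N] square_mult_closed del: assoc_mult_mat)
  finally show ?thesis by (simp add: s Lambda_Lambda)
qed

lemma symplectic_one: "symplectic n (1\<^sub>m (2 * n))"
  unfolding symplectic_def by (auto simp: left_mult_one_mat[of _ "2 * n" "2 * n"] right_mult_one_mat[of _ "2 * n" "2 * n"])

lemma symplectic_mult:
  assumes A: "symplectic n A" and B: "symplectic n B"
  shows "symplectic n (A * B)"
proof -
  let ?N = "2 * n"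
  have c: "Lambda n \<in> carrier_mat ?N ?N" "A \<in> carrier_mat ?N ?N" "dagger A \<in> carrier_mat ?N ?N"
     "B \<in> carrier_mat ?N ?N" "dagger B \<in> carrier_mat ?N ?N"
    and s: "dagger A * Lambda n * A = Lambda n" "dagger B * Lambda n * B = Lambda n"
      "A * Lambda n * dagger A = Lambda n" "B * Lambda n * dagger B = Lambda n"
    using A B by (auto simp: symplectic_def)
  have d: "dagger (A * B) = dagger B * dagger A"
    using c by (intro dagger_mult) auto
  have "dagger B * dagger A * Lambda n * (A * B) = dagger B * (dagger A * Lambda n * A) * B"
    using c by (simp add: square_mult_assoc[of _ ?N] square_mult_closed del: assoc_mult_mat)
  moreover have "A * B * Lambda n * (dagger B * dagger A) = A * (B * Lambda n * dagger B) * dagger A"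
    using c by (simp add: square_mult_assoc[of _ ?N] square_mult_closed del: assoc_mult_mat)
  ultimately show ?thesis
    using c unfolding symplectic_def d s by (auto simp: s)
qed

lemma symplectic_isometry:
  assumes A: "A \<in> carrier_mat (2 * n) (2 * n)" and s: "dagger A * Lambda n * A = Lambda n"
  shows "isometry_on n (\<lambda>v. A *\<^sub>v v)"
  unfolding isometry_on_def
proof (intro conjI ballI allI)
  let ?N = "2 * n"
  fix v w :: "'a laurent vec" and c
  assume v: "v \<in> carrier_vec ?N"
  show Av: "A *\<^sub>v v \<in> carrier_vec ?N" using A v by auto
  show "A *\<^sub>v (c \<cdot>\<^sub>v v) = c \<cdot>\<^sub>v (A *\<^sub>v v)" using A v by (intro eq_vecI) auto
  assume w: "w \<in> carrier_vec ?N"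
  show "A *\<^sub>v (v + w) = A *\<^sub>v v + A *\<^sub>v w"
    using A v w by (simp add: mult_add_distrib_mat_vec[of _ ?N ?N])
  have Aw: "A *\<^sub>v w \<in> carrier_vec ?N" using A w by auto
  have m: "map_vec antipode (A *\<^sub>v v) = transpose_mat (dagger A) *\<^sub>v map_vec antipode v"
    using A v by (intro eq_vecI) (auto simp: scalar_prod_def antipode_sum intro!: sum.cong)
  have L: "Lambda n *\<^sub>v (A *\<^sub>v w) \<in> carrier_vec ?N"
    by (intro carrier_vecI) simp
  have "form n (A *\<^sub>v v) (A *\<^sub>v w)
      = scalar_prod (map_vec antipode v) (dagger A *\<^sub>v (Lambda n *\<^sub>v (A *\<^sub>v w)))"
    unfolding form_Lambda[OF Av Aw] m using A v L
    by (intro transpose_vec_mult_scalar[of _ ?N ?N]) auto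
  also have "dagger A *\<^sub>v (Lambda n *\<^sub>v (A *\<^sub>v w)) = (dagger A * Lambda n) *\<^sub>v (A *\<^sub>v w)"
    using A Aw by (intro assoc_mult_mat_vec[symmetric, of _ ?N ?N _ ?N]) auto
  also have "\<dots> = (dagger A * Lambda n * A) *\<^sub>v w"
    using A w by (intro assoc_mult_mat_vec[symmetric, of _ ?N ?N _ ?N] square_mult_closed) auto
  also have "\<dots> = Lambda n *\<^sub>v w" by (simp add: s)
  finally show "form n (A *\<^sub>v v) (A *\<^sub>v w) = form n v w"
    unfolding form_Lambda[OF v w] .
qed

lemma symp_inv_mult_vec:
  assumes "symplectic n A" "v \<in> carrier_vec (2 * n)"
  shows "A *\<^sub>v (symp_inv n A *\<^sub>v v) = v"
proof -
  have c: "A \<in> carrier_mat (2 * n) (2 * n)" using assms by (simp add: symplectic_def)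
  then have "A *\<^sub>v (symp_inv n A *\<^sub>v v) = (A * symp_inv n A) *\<^sub>v v"
    using assms(2) by (intro assoc_mult_mat_vec[symmetric]) auto
  then show ?thesis using assms by (simp add: symp_inv_right)
qed

section \<open>Stabilization\<close>

text \<open>The additional qudit has coordinates \<open>q\<close> (its \<open>X\<close>) and \<open>2q + 1\<close> (its \<open>Z\<close>), so the \<open>Z\<close>
  part of the old qudits moves up by one. A vector is its restriction to the old qudits, extended by
  zero, plus its ancilla part.\<close>

definition extend_vec :: "nat \<Rightarrow> 'p :: prime_card laurent vec \<Rightarrow> 'p laurent vec" where
  "extend_vec q v = vec (2 * (q + 1)) (\<lambda>i.
     if i < q then v $ i else if q < i \<and> i < 2 * q + 1 then v $ (i - 1) else 0)"

definition restrict_vec :: "nat \<Rightarrow> 'p :: prime_card laurent vec \<Rightarrow> 'p laurent vec" where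
  "restrict_vec q w = vec (2 * q) (\<lambda>i. if i < q then w $ i else w $ (i + 1))"

definition ancilla_part :: "nat \<Rightarrow> 'p :: prime_card laurent vec \<Rightarrow> 'p laurent vec" where
  "ancilla_part q w = vec (2 * (q + 1)) (\<lambda>i. if i = q \<or> i = 2 * q + 1 then w $ i else 0)"

lemma vec_part_carrier [simp]:
  "extend_vec q v \<in> carrier_vec (2 * (q + 1))" "restrict_vec q w \<in> carrier_vec (2 * q)"
  "ancilla_part q w \<in> carrier_vec (2 * (q + 1))"
  by (simp_all add: extend_vec_def restrict_vec_def ancilla_part_def)

lemma restrict_extend:
  "v \<in> carrier_vec (2 * q) \<Longrightarrow> restrict_vec q (extend_vec q v) = v"
  by (intro eq_vecI) (auto simp: extend_vec_def restrict_vec_def)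

lemma restrict_parts:
  assumes "v \<in> carrier_vec (2 * q)"
  shows "restrict_vec q (extend_vec q v + ancilla_part q w) = v"
    "ancilla_part q (extend_vec q v + ancilla_part q w) = ancilla_part q w"
  using assms
  by (intro eq_vecI; auto simp: extend_vec_def restrict_vec_def ancilla_part_def)+

lemma form_extend_vec:
  assumes "a \<in> carrier_vec (2 * q)"
  shows "form (q + 1) (extend_vec q a) w = form q a (restrict_vec q w)"
  unfolding form_def using assms
  by (auto simp: extend_vec_def restrict_vec_def intro!: sum.cong)

lemma direct_sum_carrier [simp]:
  "A \<in> carrier_mat m n \<Longrightarrow> B \<in> carrier_mat k l \<Longrightarrow> direct_sum A B \<in> carrier_mat (m + k) (n + l)"
  by (simp add: direct_sum_def)

lemma direct_sum_assoc:
  "direct_sum (direct_sum A B) C = direct_sum A (direct_sum B C)"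
  unfolding direct_sum_def by (rule assoc_four_block_mat[symmetric])

lemma direct_sum_one: "direct_sum (1\<^sub>m a) (1\<^sub>m b) = 1\<^sub>m (a + b)"
  by (simp add: direct_sum_def)

lemma direct_sum_zero: "direct_sum (0\<^sub>m a b) (0\<^sub>m c d) = 0\<^sub>m (a + c) (b + d)"
  by (simp add: direct_sum_def)

lemma split_four_block:
  assumes "A \<in> carrier_mat q q" "B \<in> carrier_mat q q" "C \<in> carrier_mat q q" "D \<in> carrier_mat q q"
  shows "split_block (four_block_mat A B C D) q q = (A, B, C, D)"
proof -
  let ?F = "four_block_mat A B C D"
  have "mat q q (\<lambda>ij. ?F $$ ij) = A" "mat q q (\<lambda>(i, j). ?F $$ (i, j + q)) = B"
    "mat q q (\<lambda>(i, j). ?F $$ (i + q, j)) = C" "mat q q (\<lambda>(i, j). ?F $$ (i + q, j + q)) = D"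
    using assms by (intro eq_matI; auto)+
  moreover have "dim_row ?F - q = q" "dim_col ?F - q = q"
    using assms by auto
  ultimately show ?thesis
    unfolding split_block_def Let_def by (simp only:)
qed

lemma stabilize_four_block:
  assumes "A \<in> carrier_mat q q" "B \<in> carrier_mat q q" "C \<in> carrier_mat q q" "D \<in> carrier_mat q q"
  shows "stabilize q a (four_block_mat A B C D) = four_block_mat
      (direct_sum A (1\<^sub>m a)) (direct_sum B (0\<^sub>m a a))
      (direct_sum C (0\<^sub>m a a)) (direct_sum D (1\<^sub>m a))"
  using split_four_block[OF assms] assms unfolding stabilize_def by simp

lemma four_block_cases:
  assumes "M \<in> carrier_mat (2 * q) (2 * q)"
  obtains A B C D where "A \<in> carrier_mat q q" "B \<in> carrier_mat q q" "C \<in> carrier_mat q q"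
    "D \<in> carrier_mat q q" "M = four_block_mat A B C D"
proof -
  obtain A B C D where "split_block M q q = (A, B, C, D)"
    by (metis prod_cases4)
  from split_block[OF this, of q q] show thesis
    using assms that by (auto simp: mult_2)
qed

lemma stabilize_index:
  assumes A: "M \<in> carrier_mat (2 * q) (2 * q)" and ij: "i < 2 * (q + 1)" "j < 2 * (q + 1)"
  shows "stabilize q (Suc 0) M $$ (i, j) =
    (if i = q \<or> i = 2 * q + 1 \<or> j = q \<or> j = 2 * q + 1 then (if i = j then 1 else 0)
     else M $$ (if i < q then i else i - 1, if j < q then j else j - 1))"
proof -
  obtain A B C D where M: "A \<in> carrier_mat q q" "B \<in> carrier_mat q q" "C \<in> carrier_mat q q"
    "D \<in> carrier_mat q q" "M = four_block_mat A B C D"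
    using A by (rule four_block_cases)
  then have c: "dim_row A = q" "dim_col A = q" "dim_row B = q" "dim_col B = q"
    "dim_row C = q" "dim_col C = q" "dim_row D = q" "dim_col D = q" by auto
  have split: "t < q \<or> t = q \<or> (\<exists>k<q. t = q + Suc k) \<or> t = q + Suc q" if "t < 2 * (q + 1)" for t
  proof -
    have "t = q + Suc (t - q - 1)" if "\<not> t < q" "t \<noteq> q" using that by simp
    moreover have "t - q - 1 < q \<or> t - q - 1 = q" using that by auto
    ultimately show ?thesis by metis
  qed
  show ?thesis
    unfolding M(5) stabilize_four_block[OF M(1-4)] direct_sum_def
    by (insert split[OF ij(1)] split[OF ij(2)], (elim disjE exE conjE; simp add: c))
qed

lemma stabilize_carrier:
  assumes "M \<in> carrier_mat (2 * q) (2 * q)"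
  shows "stabilize q a M \<in> carrier_mat (2 * (q + a)) (2 * (q + a))"
proof -
  obtain A B C D where M: "A \<in> carrier_mat q q" "B \<in> carrier_mat q q" "C \<in> carrier_mat q q"
    "D \<in> carrier_mat q q" "M = four_block_mat A B C D"
    using assms by (rule four_block_cases)
  show ?thesis
    unfolding M(5) stabilize_four_block[OF M(1-4)] mult_2
    using M(1-4) by (intro four_block_carrier_mat direct_sum_carrier) auto
qed

lemma sum_extend_vec:
  fixes g :: "nat \<Rightarrow> 'b :: comm_monoid_add"
  shows "(\<Sum>j<2 * (q + 1). g j)
    = (\<Sum>j<2 * q. g (if j < q then j else j + 1)) + (g q + g (2 * q + 1))"
proof -
  have "(\<Sum>j<2 * (q + 1). g j) = (\<Sum>j<(q + 1) + (q + 1). g j)"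
    by (simp add: mult_2)
  also have "\<dots> = (\<Sum>j<q. g j) + g q + ((\<Sum>j<q. g (q + 1 + j)) + g (2 * q + 1))"
    unfolding sum_lessThan_add by (simp add: mult_2 add_ac)
  also have "\<dots> = (\<Sum>j<q + q. g (if j < q then j else j + 1)) + (g q + g (2 * q + 1))"
    unfolding sum_lessThan_add by (simp add: add_ac)
  finally show ?thesis by (simp add: mult_2)
qed

lemma stabilize_mult_vec:
  assumes A: "A \<in> carrier_mat (2 * q) (2 * q)" and w: "w \<in> carrier_vec (2 * (q + 1))"
  shows "stabilize q (Suc 0) A *\<^sub>v w
    = extend_vec q (A *\<^sub>v restrict_vec q w) + ancilla_part q w"
proof (rule eq_vecI)
  have S: "stabilize q (Suc 0) A \<in> carrier_mat (2 * (q + 1)) (2 * (q + 1))"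
    using stabilize_carrier[OF A, of 1] by simp
  then show "dim_vec (stabilize q (Suc 0) A *\<^sub>v w)
      = dim_vec (extend_vec q (A *\<^sub>v restrict_vec q w) + ancilla_part q w)"
    by (simp add: ancilla_part_def)
  fix i assume "i < dim_vec (extend_vec q (A *\<^sub>v restrict_vec q w) + ancilla_part q w)"
  then have i: "i < 2 * (q + 1)" by (simp add: ancilla_part_def)
  have "(stabilize q (Suc 0) A *\<^sub>v w) $ i = (\<Sum>j<2 * (q + 1). stabilize q (Suc 0) A $$ (i, j) * w $ j)"
    using S w i by (simp add: scalar_prod_def atLeast0LessThan)
  also have "\<dots> = (\<Sum>j<2 * q. stabilize q (Suc 0) A $$ (i, if j < q then j else j + 1) * w $ (if j < q then j else j + 1))
      + (stabilize q (Suc 0) A $$ (i, q) * w $ q + stabilize q (Suc 0) A $$ (i, 2 * q + 1) * w $ (2 * q + 1))"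
    by (rule sum_extend_vec)
  also have "\<dots> = (extend_vec q (A *\<^sub>v restrict_vec q w) + ancilla_part q w) $ i"
  proof (cases "i = q \<or> i = 2 * q + 1")
    case True
    then have "(\<Sum>j<2 * q. stabilize q (Suc 0) A $$ (i, if j < q then j else j + 1) * w $ (if j < q then j else j + 1)) = 0"
      using i by (intro sum.neutral) (auto simp: stabilize_index[OF A])
    then show ?thesis
      using True i by (auto simp: stabilize_index[OF A] extend_vec_def ancilla_part_def)
  next
    case False
    let ?p = "if i < q then i else i - 1"
    have p: "?p < 2 * q" using i False by auto
    have "(\<Sum>j<2 * q. stabilize q (Suc 0) A $$ (i, if j < q then j else j + 1) * w $ (if j < q then j else j + 1))
        = (\<Sum>j<2 * q. A $$ (?p, j) * restrict_vec q w $ j)"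
      using i False by (intro sum.cong) (auto simp: stabilize_index[OF A] restrict_vec_def)
    also have "\<dots> = (A *\<^sub>v restrict_vec q w) $ ?p"
      using A p by (simp add: scalar_prod_def atLeast0LessThan restrict_vec_def)
    finally show ?thesis
      using False i p by (auto simp: stabilize_index[OF A] extend_vec_def ancilla_part_def)
  qed
  finally show "(stabilize q (Suc 0) A *\<^sub>v w) $ i
      = (extend_vec q (A *\<^sub>v restrict_vec q w) + ancilla_part q w) $ i" .
qed

lemma stabilize_mult:
  assumes A: "A \<in> carrier_mat (2 * q) (2 * q)" and B: "B \<in> carrier_mat (2 * q) (2 * q)"
    and w: "w \<in> carrier_vec (2 * (q + 1))"
  shows "stabilize q (Suc 0) (A * B) *\<^sub>v w = stabilize q (Suc 0) A *\<^sub>v (stabilize q (Suc 0) B *\<^sub>v w)"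
proof -
  have Bw: "B *\<^sub>v restrict_vec q w \<in> carrier_vec (2 * q)"
    using B by auto
  have "stabilize q (Suc 0) (A * B) *\<^sub>v w = extend_vec q (A *\<^sub>v (B *\<^sub>v restrict_vec q w)) + ancilla_part q w"
    using A B w by (subst stabilize_mult_vec) (auto simp: assoc_mult_mat_vec[of _ "2 * q" "2 * q" _ "2 * q"])
  moreover have "extend_vec q (B *\<^sub>v restrict_vec q w) + ancilla_part q w \<in> carrier_vec (2 * (q + 1))"
    by (intro add_carrier_vec vec_part_carrier)
  ultimately show ?thesis
    using stabilize_mult_vec[OF A] stabilize_mult_vec[OF B w] restrict_parts[OF Bw] by simp
qed

lemma stabilize_stabilize:
  assumes "M \<in> carrier_mat (2 * q) (2 * q)"
  shows "stabilize (q + a) b (stabilize q a M) = stabilize q (a + b) M"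
proof -
  obtain A B C D where M: "A \<in> carrier_mat q q" "B \<in> carrier_mat q q" "C \<in> carrier_mat q q"
    "D \<in> carrier_mat q q" "M = four_block_mat A B C D"
    using assms by (rule four_block_cases)
  then show ?thesis
    by (simp add: stabilize_four_block direct_sum_assoc direct_sum_one direct_sum_zero)
qed

section \<open>Elementary symplectic matrices\<close>

lemma mult_four_block_square:
  assumes "A1 \<in> carrier_mat n n" "B1 \<in> carrier_mat n n" "C1 \<in> carrier_mat n n" "D1 \<in> carrier_mat n n"
    "A2 \<in> carrier_mat n n" "B2 \<in> carrier_mat n n" "C2 \<in> carrier_mat n n" "D2 \<in> carrier_mat n n"
  shows "four_block_mat A1 B1 C1 D1 * four_block_mat A2 B2 C2 D2
    = four_block_mat (A1 * A2 + B1 * C2) (A1 * B2 + B1 * D2) (C1 * A2 + D1 * C2) (C1 * B2 + D1 * D2)"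
  by (rule mult_four_block_mat[OF assms])

lemma four_block_square_carrier:
  "A \<in> carrier_mat n n \<Longrightarrow> D \<in> carrier_mat n n \<Longrightarrow> four_block_mat A B C D \<in> carrier_mat (2 * n) (2 * n)"
  unfolding mult_2 by (rule four_block_carrier_mat)

text \<open>The fourth block identity is the \<open>\<dagger>\<close> of the middle one.\<close>

lemma four_block_preserves_Lambda:
  assumes c: "A \<in> carrier_mat n n" "B \<in> carrier_mat n n" "C \<in> carrier_mat n n" "D \<in> carrier_mat n n"
    and s: "dagger A * C = dagger C * A" "dagger A * D - dagger C * B = 1\<^sub>m n" "dagger B * D = dagger D * B"
  shows "dagger (four_block_mat A B C D) * Lambda n * four_block_mat A B C D = Lambda n"
proof -
  have d: "dagger A \<in> carrier_mat n n" "dagger B \<in> carrier_mat n n" "dagger C \<in> carrier_mat n n"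
    "dagger D \<in> carrier_mat n n" using c by auto
  have m: "X * - 1\<^sub>m n = - X" "X * 0\<^sub>m n n = 0\<^sub>m n n" "X * 1\<^sub>m n = X" "X + 0\<^sub>m n n = X"
    "0\<^sub>m n n + - X = - X" if "X \<in> carrier_mat n n" for X :: "'a laurent mat"
    using that by (auto intro!: eq_matI simp: uminus_mult_right_mat)
  have 1: "dagger (four_block_mat A B C D) * Lambda n
      = four_block_mat (- dagger C) (dagger A) (- dagger D) (dagger B)"
    unfolding dagger_four_block[OF c] Lambda_def using d
    by (subst mult_four_block_square[of _ n]) (auto simp: m)
  have e: "- dagger C * A + dagger A * C = 0\<^sub>m n n" "- dagger D * B + dagger B * D = 0\<^sub>m n n"
    "- dagger C * B + dagger A * D = 1\<^sub>m n"
  proof -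
    show "- dagger C * A + dagger A * C = 0\<^sub>m n n"
      unfolding s(1) using c d by (subst uminus_mult_left_mat) (auto intro!: uminus_l_inv_mat square_mult_closed)
    show "- dagger D * B + dagger B * D = 0\<^sub>m n n"
      unfolding s(3) using c d by (subst uminus_mult_left_mat) (auto intro!: uminus_l_inv_mat square_mult_closed)
    have X: "dagger A * D \<in> carrier_mat n n" "dagger C * B \<in> carrier_mat n n"
      using c d by (auto intro!: square_mult_closed)
    have "- dagger C * B + dagger A * D = dagger A * D - dagger C * B"
      using c d X by (subst uminus_mult_left_mat) (auto intro!: eq_matI)
    then show "- dagger C * B + dagger A * D = 1\<^sub>m n" using s(2) by simp
  qed
  have f: "- dagger D * A + dagger B * C = - 1\<^sub>m n"
  proof -
    have "dagger (- dagger C * B + dagger A * D) = dagger (1\<^sub>m n)" by (simp only: e)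
    moreover have "dagger (- dagger C * B + dagger A * D) = dagger B * (- C) + dagger D * A"
      using c d by (subst dagger_add[of _ n n]) (auto simp: dagger_mult[of _ n n _ n] intro!: square_mult_closed)
    ultimately have g: "dagger B * (- C) + dagger D * A = 1\<^sub>m n" by simp
    have X: "dagger D * A \<in> carrier_mat n n" "dagger B * C \<in> carrier_mat n n"
      using c d by (auto intro!: square_mult_closed)
    have "- dagger D * A + dagger B * C = - (dagger B * (- C) + dagger D * A)"
      using c d X by (subst uminus_mult_left_mat, simp, subst uminus_mult_right_mat, simp) (auto intro!: eq_matI)
    then show ?thesis using g by simp
  qed
  have mc: "- dagger C \<in> carrier_mat n n" "- dagger D \<in> carrier_mat n n" using d by auto
  show ?thesis
    unfolding 1 mult_four_block_square[OF mc(1) d(1) mc(2) d(2) c] e f by (simp add: Lambda_def)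
qed

lemma symplectic_four_block:
  assumes c: "A \<in> carrier_mat n n" "B \<in> carrier_mat n n" "C \<in> carrier_mat n n" "D \<in> carrier_mat n n"
    and s: "dagger A * C = dagger C * A" "dagger A * D - dagger C * B = 1\<^sub>m n" "dagger B * D = dagger D * B"
    and t: "A * dagger B = B * dagger A" "A * dagger D - B * dagger C = 1\<^sub>m n" "C * dagger D = D * dagger C"
  shows "symplectic n (four_block_mat A B C D)"
proof -
  have d: "dagger A \<in> carrier_mat n n" "dagger B \<in> carrier_mat n n" "dagger C \<in> carrier_mat n n"
    "dagger D \<in> carrier_mat n n" using c by auto
  have "dagger (four_block_mat (dagger A) (dagger C) (dagger B) (dagger D)) * Lambda n
      * four_block_mat (dagger A) (dagger C) (dagger B) (dagger D) = Lambda n"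
    by (rule four_block_preserves_Lambda[OF d(1,3,2,4)]) (use t in auto)
  then show ?thesis
    unfolding symplectic_def
    using four_block_preserves_Lambda[OF c s] four_block_square_carrier[OF c(1,4)]
    by (simp add: dagger_four_block[OF c] dagger_four_block[OF d(1,3,2,4)])
qed

definition upper_mat :: "nat \<Rightarrow> 'p :: prime_card laurent mat \<Rightarrow> 'p laurent mat" where
  "upper_mat n S = four_block_mat (1\<^sub>m n) S (0\<^sub>m n n) (1\<^sub>m n)"

definition lower_mat :: "nat \<Rightarrow> 'p :: prime_card laurent mat \<Rightarrow> 'p laurent mat" where
  "lower_mat n S = four_block_mat (1\<^sub>m n) (0\<^sub>m n n) S (1\<^sub>m n)"

text \<open>The change of basis \<open>B\<close> of the \<open>X\<close> part together with the action \<open>B\<^sup>-\<^sup>\<dagger>\<close> that it forces on the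
  \<open>Z\<close> part; \<open>B'\<close> stands for the inverse of \<open>B\<close>.\<close>

definition levi_mat :: "nat \<Rightarrow> 'p :: prime_card laurent mat \<Rightarrow> 'p laurent mat \<Rightarrow> 'p laurent mat" where
  "levi_mat n B B' = four_block_mat B (0\<^sub>m n n) (0\<^sub>m n n) (dagger B')"

lemma symplectic_upper_mat:
  assumes "S \<in> carrier_mat n n" "dagger S = S"
  shows "symplectic n (upper_mat n S)"
  unfolding upper_mat_def using assms by (intro symplectic_four_block) auto

lemma symplectic_lower_mat:
  assumes "S \<in> carrier_mat n n" "dagger S = S"
  shows "symplectic n (lower_mat n S)"
  unfolding lower_mat_def using assms by (intro symplectic_four_block) auto

lemma symplectic_levi_mat:
  assumes c: "B \<in> carrier_mat n n" "B' \<in> carrier_mat n n" and i: "B * B' = 1\<^sub>m n" "B' * B = 1\<^sub>m n"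
  shows "symplectic n (levi_mat n B B')"
proof -
  have "dagger B * dagger B' = 1\<^sub>m n" "dagger B' * dagger B = 1\<^sub>m n"
    unfolding dagger_mult[OF c(2,1), symmetric] dagger_mult[OF c(1,2), symmetric] i
    by (rule dagger_one)+
  then show ?thesis
    unfolding levi_mat_def using c i by (intro symplectic_four_block) auto
qed

section \<open>Matrices whose conjugates are circuits\<close>

text \<open>The quantifier over \<open>\<sigma>\<close> closes this class under conjugation as well as products, which lets circuits be
  moved across an arbitrary automaton.\<close>

definition stably_realizable :: "nat \<Rightarrow> 'p :: prime_card laurent mat \<Rightarrow> bool" where
  "stably_realizable q A \<longleftrightarrow> A \<in> carrier_mat (2 * q) (2 * q) \<and>
    (\<forall>\<sigma>. symplectic q \<sigma> \<longrightarrow>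
      realizable (q + 1) (\<lambda>v. stabilize q (Suc 0) (\<sigma> * A * symp_inv q \<sigma>) *\<^sub>v v))"

lemma stably_realizable_mult:
  assumes A: "stably_realizable q A" and B: "stably_realizable q B"
  shows "stably_realizable q (A * B)"
  unfolding stably_realizable_def
proof (intro conjI allI impI)
  let ?N = "2 * q"
  have c: "A \<in> carrier_mat ?N ?N" "B \<in> carrier_mat ?N ?N"
    using A B by (auto simp: stably_realizable_def)
  then show "A * B \<in> carrier_mat ?N ?N" by (rule square_mult_closed)
  fix \<sigma> :: "'a laurent mat" assume s: "symplectic q \<sigma>"
  then have d: "\<sigma> \<in> carrier_mat ?N ?N" "symp_inv q \<sigma> \<in> carrier_mat ?N ?N"
    by (auto simp: symplectic_def)
  let ?\<tau> = "symp_inv q \<sigma>"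
  have "\<sigma> * (A * B) * ?\<tau> = \<sigma> * A * (?\<tau> * \<sigma>) * (B * ?\<tau>)"
    using c d by (simp add: symp_inv_left[OF s] square_mult_assoc[of _ ?N] square_mult_closed
        right_mult_one_mat[of _ ?N ?N] del: assoc_mult_mat)
  also have "\<dots> = \<sigma> * A * ?\<tau> * (\<sigma> * B * ?\<tau>)"
    using c d by (simp add: square_mult_assoc[of _ ?N] square_mult_closed del: assoc_mult_mat)
  finally have e: "\<sigma> * (A * B) * ?\<tau> = \<sigma> * A * ?\<tau> * (\<sigma> * B * ?\<tau>)" .
  have f: "\<sigma> * A * ?\<tau> \<in> carrier_mat ?N ?N" "\<sigma> * B * ?\<tau> \<in> carrier_mat ?N ?N"
    using c d by (auto intro!: square_mult_closed)
  have "realizable (q + 1) (\<lambda>v. stabilize q (Suc 0) (\<sigma> * A * ?\<tau>) *\<^sub>v (stabilize q (Suc 0) (\<sigma> * B * ?\<tau>) *\<^sub>v v))"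
    using A B s unfolding stably_realizable_def
    by (intro realizable_comp[of "q + 1" "\<lambda>v. stabilize q (Suc 0) (\<sigma> * A * ?\<tau>) *\<^sub>v v"
        "\<lambda>v. stabilize q (Suc 0) (\<sigma> * B * ?\<tau>) *\<^sub>v v"]) blast+
  then show "realizable (q + 1) (\<lambda>v. stabilize q (Suc 0) (\<sigma> * (A * B) * ?\<tau>) *\<^sub>v v)"
    by (rule realizable_cong) (simp only: e stabilize_mult[OF f])
qed

lemma form_unit_sum:
  "form q u v = (\<Sum>j<2 * q. form q u (unit_vec (2 * q) j) * v $ j)"
proof -
  have X: "form q u (unit_vec (2 * q) j) = - antipode (u $ (q + j))" if "j < q" for j
    using that form_X[of j q u] by (simp add: form_swap[of q u])
  have Z: "form q u (unit_vec (2 * q) (q + j)) = antipode (u $ j)" if "j < q" for j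
    using that form_Z[of j q u] by (simp add: form_swap[of q u])
  let ?F = "\<lambda>j. form q u (unit_vec (2 * q) j) * v $ j"
  have "(\<Sum>j<2 * q. ?F j) = (\<Sum>j<q. ?F j) + (\<Sum>j<q. ?F (q + j))"
    using sum_lessThan_add[of ?F q q] by (simp add: mult_2)
  also have "\<dots> = (\<Sum>j<q. - antipode (u $ (q + j)) * v $ j) + (\<Sum>j<q. antipode (u $ j) * v $ (q + j))"
    by (simp add: X Z)
  also have "\<dots> = form q u v"
    unfolding form_def sum.distrib[symmetric] by (intro sum.cong) auto
  finally show ?thesis by simp
qed

lemma eichler_matrix:
  assumes M: "M \<in> carrier_mat (2 * q) (2 * q)"
    and a: "a \<in> carrier_vec (2 * q)" and b: "b \<in> carrier_vec (2 * q)"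
    and e: "\<And>i j. i < 2 * q \<Longrightarrow> j < 2 * q \<Longrightarrow> M $$ (i, j) = (if i = j then 1 else 0)
      + form q b (unit_vec (2 * q) j) * a $ i + form q a (unit_vec (2 * q) j) * b $ i"
    and v: "v \<in> carrier_vec (2 * q)"
  shows "M *\<^sub>v v = eichler q a b 0 v"
proof (rule eq_vecI)
  show "dim_vec (M *\<^sub>v v) = dim_vec (eichler q a b 0 v)"
    using M a by (simp add: eichler_def)
  fix i assume "i < dim_vec (eichler q a b 0 v)"
  then have i: "i < 2 * q" using a by (simp add: eichler_def)
  have "(M *\<^sub>v v) $ i = (\<Sum>j<2 * q. M $$ (i, j) * v $ j)"
    using M v i by (simp add: scalar_prod_def atLeast0LessThan)
  also have "\<dots> = (\<Sum>j<2 * q. (if j = i then v $ i else 0)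
      + form q b (unit_vec (2 * q) j) * v $ j * a $ i + form q a (unit_vec (2 * q) j) * v $ j * b $ i)"
    using i by (intro sum.cong) (auto simp: e algebra_simps)
  also have "\<dots> = v $ i + form q b v * a $ i + form q a v * b $ i"
    using i unfolding form_unit_sum[of q b v] form_unit_sum[of q a v]
    by (simp add: sum.distrib sum_distrib_right sum.delta)
  also have "\<dots> = eichler q a b 0 v $ i"
    using a b v i by (simp add: eichler_index)
  finally show "(M *\<^sub>v v) $ i = eichler q a b 0 v $ i" .
qed

text \<open>A conjugate of \<open>T(a, b)\<close> is \<open>T(\<sigma> a, \<sigma> b)\<close>, and on the extended space both vectors avoid
  the ancilla.\<close>

lemma stably_realizable_eichler:
  fixes a b :: "'p :: prime_card laurent vec"
  assumes two: "(2 :: 'p mod_ring) \<noteq> 0" and q: "q \<ge> 1"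
    and A: "A \<in> carrier_mat (2 * q) (2 * q)"
    and a: "a \<in> carrier_vec (2 * q)" and b: "b \<in> carrier_vec (2 * q)"
    and act: "\<And>v. v \<in> carrier_vec (2 * q) \<Longrightarrow> A *\<^sub>v v = eichler q a b 0 v"
    and iso: "form q a a = 0" "form q b b = 0" "form q a b = 0"
  shows "stably_realizable q A"
  unfolding stably_realizable_def
proof (intro conjI allI impI)
  let ?N = "2 * q"
  show "A \<in> carrier_mat ?N ?N" by (rule A)
  fix \<sigma> :: "'p laurent mat" assume s: "symplectic q \<sigma>"
  let ?\<tau> = "symp_inv q \<sigma>"
  have c: "\<sigma> \<in> carrier_mat ?N ?N" "?\<tau> \<in> carrier_mat ?N ?N" and pres: "dagger \<sigma> * Lambda q * \<sigma> = Lambda q"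
    using s by (auto simp: symplectic_def)
  have isom: "isometry_on q (\<lambda>v. \<sigma> *\<^sub>v v)"
    by (rule symplectic_isometry[OF c(1) pres])
  let ?a = "\<sigma> *\<^sub>v a" and ?b = "\<sigma> *\<^sub>v b"
  have ab: "?a \<in> carrier_vec ?N" "?b \<in> carrier_vec ?N" using c a b by auto
  have iso': "form q ?a ?a = 0" "form q ?b ?b = 0" "form q ?a ?b = 0"
    using isom a b iso unfolding isometry_on_def by auto
  have conj: "(\<sigma> * A * ?\<tau>) *\<^sub>v v = eichler q ?a ?b 0 v" if v: "v \<in> carrier_vec ?N" for v
  proof -
    have t: "?\<tau> *\<^sub>v v \<in> carrier_vec ?N" by (rule mult_mat_vec_carrier[OF c(2) v])
    have "(\<sigma> * A * ?\<tau>) *\<^sub>v v = (\<sigma> * A) *\<^sub>v (?\<tau> *\<^sub>v v)"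
      using c A v by (intro assoc_mult_mat_vec[of _ ?N ?N _ ?N] square_mult_closed) auto
    also have "\<dots> = \<sigma> *\<^sub>v (A *\<^sub>v (?\<tau> *\<^sub>v v))"
      using c A t by (intro assoc_mult_mat_vec[of _ ?N ?N _ ?N]) auto
    also have "\<dots> = eichler q ?a ?b 0 (\<sigma> *\<^sub>v (?\<tau> *\<^sub>v v))"
      unfolding act[OF t] using eichler_conjugate[OF isom a b t] .
    also have "\<sigma> *\<^sub>v (?\<tau> *\<^sub>v v) = v" by (rule symp_inv_mult_vec[OF s v])
    finally show ?thesis .
  qed
  have C: "\<sigma> * A * ?\<tau> \<in> carrier_mat ?N ?N"
    using c A by (intro square_mult_closed)
  have ext: "stabilize q (Suc 0) (\<sigma> * A * ?\<tau>) *\<^sub>v w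
      = eichler (q + 1) (extend_vec q ?a) (extend_vec q ?b) 0 w"
    if w: "w \<in> carrier_vec (2 * (q + 1))" for w
  proof (rule eq_vecI)
    show "dim_vec (stabilize q (Suc 0) (\<sigma> * A * ?\<tau>) *\<^sub>v w)
        = dim_vec (eichler (q + 1) (extend_vec q ?a) (extend_vec q ?b) 0 w)"
      unfolding stabilize_mult_vec[OF C w] by (simp add: eichler_def ancilla_part_def extend_vec_def)
    fix i assume "i < dim_vec (eichler (q + 1) (extend_vec q ?a) (extend_vec q ?b) 0 w)"
    then have i: "i < 2 * (q + 1)" by (simp add: eichler_def extend_vec_def)
    have r: "restrict_vec q w \<in> carrier_vec ?N" by simp
    show "(stabilize q (Suc 0) (\<sigma> * A * ?\<tau>) *\<^sub>v w) $ i
        = eichler (q + 1) (extend_vec q ?a) (extend_vec q ?b) 0 w $ i"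
      unfolding stabilize_mult_vec[OF C w] conj[OF r]
        eichler_index[OF vec_part_carrier(1) vec_part_carrier(1) w i]
        form_extend_vec[OF ab(1)] form_extend_vec[OF ab(2)]
      using i eichler_index[OF ab r]
      by (auto simp: extend_vec_def ancilla_part_def restrict_vec_def)
  qed
  have "realizable (q + 1) (eichler (q + 1) (extend_vec q ?a) (extend_vec q ?b) 0)"
    using q iso' ab
    by (intro transvection_realizable[OF two, of "q + 1" q] vec_part_carrier)
      (simp_all only: form_extend_vec restrict_extend, auto simp: extend_vec_def)
  then show "realizable (q + 1) (\<lambda>v. stabilize q (Suc 0) (\<sigma> * A * ?\<tau>) *\<^sub>v v)"
    by (rule realizable_cong) (rule ext)
qed

section \<open>Shears and base changes are products of transvections\<close>

lemma upper_mat_add: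
  assumes "S \<in> carrier_mat n n" "T \<in> carrier_mat n n"
  shows "upper_mat n S * upper_mat n T = upper_mat n (S + T)"
  unfolding upper_mat_def using assms comm_add_mat[OF assms]
  by (subst mult_four_block_square[of _ n]) auto

lemma lower_mat_add:
  assumes "S \<in> carrier_mat n n" "T \<in> carrier_mat n n"
  shows "lower_mat n S * lower_mat n T = lower_mat n (S + T)"
  unfolding lower_mat_def using assms
  by (subst mult_four_block_square[of _ n]) auto

lemma levi_mat_mult:
  assumes "A \<in> carrier_mat n n" "A' \<in> carrier_mat n n" "B \<in> carrier_mat n n" "B' \<in> carrier_mat n n"
  shows "levi_mat n A A' * levi_mat n B B' = levi_mat n (A * B) (B' * A')"
proof -
  have d: "dagger A' \<in> carrier_mat n n" "dagger B' \<in> carrier_mat n n" using assms by auto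
  have p: "A * B \<in> carrier_mat n n" "dagger A' * dagger B' \<in> carrier_mat n n"
    using assms d by (auto intro!: square_mult_closed)
  show ?thesis
    unfolding levi_mat_def dagger_mult[OF assms(4,2)] using assms d p
    by (subst mult_four_block_square[of _ n]) auto
qed

definition hermitian_part :: "nat \<Rightarrow> (nat \<Rightarrow> nat \<Rightarrow> 'p :: prime_card laurent) \<Rightarrow> 'p laurent mat" where
  "hermitian_part q K = mat q q (\<lambda>(i, j). K i j + antipode (K j i))"

lemma hermitian_part_carrier [simp]: "hermitian_part q K \<in> carrier_mat q q"
  by (simp add: hermitian_part_def)

text \<open>Since \<open>2\<close> is invertible, a hermitian matrix is \<open>K + K\<^sup>\<dagger>\<close> with \<open>K = S / 2\<close>, hence a sum of the
  parts that belong to single entries of \<open>K\<close>. The shears by these parts are transvections, also for a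
  diagonal entry.\<close>

lemma hermitian_induct [consumes 4, case_names single add]:
  fixes S :: "'p :: prime_card laurent mat"
  assumes two: "(2 :: 'p mod_ring) \<noteq> 0" and q: "q \<ge> 1"
    and S: "S \<in> carrier_mat q q" "dagger S = S"
    and single: "\<And>a b h. a < q \<Longrightarrow> b < q \<Longrightarrow>
      P (hermitian_part q (\<lambda>i j. if i = a \<and> j = b then h else 0))"
    and add: "\<And>S T. S \<in> carrier_mat q q \<Longrightarrow> T \<in> carrier_mat q q \<Longrightarrow> P S \<Longrightarrow> P T \<Longrightarrow> P (S + T)"
  shows "P S"
proof -
  define K where "K = (\<lambda>i j. half * S $$ (i, j))"
  have "finite I \<Longrightarrow> I \<subseteq> {..<q} \<times> {..<q} \<Longrightarrow>
      P (hermitian_part q (\<lambda>i j. if (i, j) \<in> I then K i j else 0))" for I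
  proof (induction I rule: finite_induct)
    case empty
    have "(\<lambda>i j. if (i, j) \<in> {} then K i j else 0) = (\<lambda>i j. if i = 0 \<and> j = 0 then 0 else 0)"
      by (intro ext) simp
    moreover have "P (hermitian_part q (\<lambda>i j. if i = 0 \<and> j = 0 then 0 else 0))"
      by (rule single) (use q in auto)
    ultimately show ?case by (simp only:)
  next
    case (insert x I)
    obtain a b where x: "x = (a, b)" by (cases x)
    let ?K = "\<lambda>i j. if (i, j) \<in> I then K i j else 0"
    have ab: "a < q" "b < q" and I: "I \<subseteq> {..<q} \<times> {..<q}"
      using insert.prems x by auto
    have e: "hermitian_part q (\<lambda>i j. if (i, j) \<in> insert x I then K i j else 0)
      = hermitian_part q (\<lambda>i j. if (i, j) \<in> I then K i j else 0)
        + hermitian_part q (\<lambda>i j. if i = a \<and> j = b then K a b else 0)"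
    proof -
      have "(if (i, j) \<in> insert x I then K i j else 0)
          = ?K i j + (if i = a \<and> j = b then K a b else 0)" for i j
        using insert.hyps(2) x by auto
      then show ?thesis
        by (intro eq_matI) (simp_all add: hermitian_part_def add_ac)
    qed
    show ?case
      unfolding e
      by (rule add[OF hermitian_part_carrier hermitian_part_carrier insert.IH[OF I] single[OF ab]])
  qed
  from this[of "{..<q} \<times> {..<q}"]
  have "P (hermitian_part q (\<lambda>i j. if (i, j) \<in> {..<q} \<times> {..<q} then K i j else 0))"
    by simp
  moreover have "hermitian_part q (\<lambda>i j. if (i, j) \<in> {..<q} \<times> {..<q} then K i j else 0) = S"
  proof (rule eq_matI)
    fix i j assume "i < dim_row S" "j < dim_col S"
    then have ij: "i < q" "j < q" using S by auto
    have "antipode (S $$ (j, i)) = S $$ (i, j)"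
      using arg_cong[OF S(2), of "\<lambda>M. M $$ (i, j)"] S(1) ij by simp
    then show "hermitian_part q (\<lambda>i j. if (i, j) \<in> {..<q} \<times> {..<q} then K i j else 0) $$ (i, j)
        = S $$ (i, j)"
      using ij half_mult_two[OF two] by (simp add: hermitian_part_def K_def)
  qed (use S in \<open>auto simp: hermitian_part_def\<close>)
  ultimately show ?thesis by simp
qed

lemma less_double_cases:
  fixes i :: nat
  assumes "i < 2 * q"
  obtains "i < q" | k where "k < q" "i = q + k"
  using assms that(2)[of "i - q"] that(1) by (cases "i < q") auto

text \<open>A named Kronecker delta keeps the entrywise comparisons below free of case distinctions until
  the products are collected.\<close>

definition kdelta :: "nat \<Rightarrow> nat \<Rightarrow> 'p :: prime_card laurent" where
  "kdelta i j = (if i = j then 1 else 0)"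

lemma kdelta_commute: "kdelta i j = kdelta j i"
  by (simp add: kdelta_def)

lemma kdelta_pair: "(if i = a \<and> j = b then h else 0) = kdelta i a * kdelta j b * h"
  by (simp add: kdelta_def)

lemma unit_vec_kdelta: "j < n \<Longrightarrow> unit_vec n i $ j = kdelta i j"
  by (simp add: kdelta_def unit_vec_def)

lemma one_mat_kdelta: "i < n \<Longrightarrow> j < n \<Longrightarrow> 1\<^sub>m n $$ (i, j) = kdelta i j"
  by (simp add: kdelta_def)

lemma unit_smult_carrier: "g \<cdot>\<^sub>v unit_vec n i \<in> carrier_vec n" by simp

lemma stably_realizable_upper:
  fixes S :: "'p :: prime_card laurent mat"
  assumes two: "(2 :: 'p mod_ring) \<noteq> 0" and q: "q \<ge> 1"
    and S: "S \<in> carrier_mat q q" "dagger S = S"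
  shows "stably_realizable q (upper_mat q S)"
  using two q S
proof (induction rule: hermitian_induct)
  case (single a b h)
  let ?X = "unit_vec (2 * q) b :: 'p laurent vec" and ?Y = "h \<cdot>\<^sub>v unit_vec (2 * q) a :: 'p laurent vec"
  let ?M = "upper_mat q (hermitian_part q (\<lambda>i j. if i = a \<and> j = b then h else 0))"
  have c: "?M \<in> carrier_mat (2 * q) (2 * q)"
    unfolding upper_mat_def by (intro four_block_square_carrier) auto
  have "?M *\<^sub>v v = eichler q ?X ?Y 0 v" if "v \<in> carrier_vec (2 * q)" for v
  proof (rule eichler_matrix[OF c unit_vec_carrier unit_smult_carrier _ that])
    fix i j assume ij: "i < 2 * q" "j < 2 * q"
    show "?M $$ (i, j) = (if i = j then 1 else 0)
      + form q ?Y (unit_vec (2 * q) j) * ?X $ i + form q ?X (unit_vec (2 * q) j) * ?Y $ i"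
      unfolding kdelta_pair kdelta_def[of i j, symmetric] using single
      by (cases rule: less_double_cases[OF ij(1)]; cases rule: less_double_cases[OF ij(2)];
          simp add: upper_mat_def hermitian_part_def form_smult_left form_X unit_vec_kdelta one_mat_kdelta del: index_unit_vec index_one_mat;
          simp add: kdelta_commute mult_ac add_ac; auto simp: kdelta_def)
  qed
  then show ?case
    using single
    by (intro stably_realizable_eichler[OF two q c unit_vec_carrier unit_smult_carrier])
      (auto simp: form_smult_left form_smult_right form_X)
next
  case (add S T)
  then show ?case
    using stably_realizable_mult[of q "upper_mat q S" "upper_mat q T"] by (simp add: upper_mat_add)
qed

lemma stably_realizable_lower:
  fixes S :: "'p :: prime_card laurent mat"
  assumes two: "(2 :: 'p mod_ring) \<noteq> 0" and q: "q \<ge> 1"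
    and S: "S \<in> carrier_mat q q" "dagger S = S"
  shows "stably_realizable q (lower_mat q S)"
  using two q S
proof (induction rule: hermitian_induct)
  case (single a b h)
  let ?X = "unit_vec (2 * q) (q + b) :: 'p laurent vec"
    and ?Y = "(- h) \<cdot>\<^sub>v unit_vec (2 * q) (q + a) :: 'p laurent vec"
  let ?M = "lower_mat q (hermitian_part q (\<lambda>i j. if i = a \<and> j = b then h else 0))"
  have c: "?M \<in> carrier_mat (2 * q) (2 * q)"
    unfolding lower_mat_def by (intro four_block_square_carrier) auto
  have "?M *\<^sub>v v = eichler q ?X ?Y 0 v" if "v \<in> carrier_vec (2 * q)" for v
  proof (rule eichler_matrix[OF c unit_vec_carrier unit_smult_carrier _ that])
    fix i j assume ij: "i < 2 * q" "j < 2 * q"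
    show "?M $$ (i, j) = (if i = j then 1 else 0)
      + form q ?Y (unit_vec (2 * q) j) * ?X $ i + form q ?X (unit_vec (2 * q) j) * ?Y $ i"
      unfolding kdelta_pair kdelta_def[of i j, symmetric] using single
      by (cases rule: less_double_cases[OF ij(1)]; cases rule: less_double_cases[OF ij(2)];
          simp add: lower_mat_def hermitian_part_def form_smult_left form_Z unit_vec_kdelta one_mat_kdelta del: index_unit_vec index_one_mat;
          simp add: kdelta_commute mult_ac add_ac; auto simp: kdelta_def)
  qed
  then show ?case
    using single
    by (intro stably_realizable_eichler[OF two q c unit_vec_carrier unit_smult_carrier])
      (auto simp: form_smult_left form_smult_right form_Z)
next
  case (add S T)
  then show ?case
    using stably_realizable_mult[of q "lower_mat q S" "lower_mat q T"] by (simp add: lower_mat_add)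
qed

definition elem_mat :: "nat \<Rightarrow> nat \<Rightarrow> nat \<Rightarrow> 'p :: prime_card laurent \<Rightarrow> 'p laurent mat" where
  "elem_mat n i j h = mat n n (\<lambda>(r, c). (if r = c then 1 else 0) + (if r = i \<and> c = j then h else 0))"

lemma elem_mat_carrier [simp]: "elem_mat n i j h \<in> carrier_mat n n"
  by (simp add: elem_mat_def)

lemma elem_mat_dims [simp]: "dim_row (elem_mat n i j h) = n" "dim_col (elem_mat n i j h) = n"
  by (simp_all add: elem_mat_def)

lemma elem_mat_kdelta:
  "r < n \<Longrightarrow> c < n \<Longrightarrow> elem_mat n i j h $$ (r, c) = kdelta r c + kdelta r i * kdelta c j * h"
  by (simp add: elem_mat_def kdelta_def)

lemma elem_mat_inverse:
  assumes "i < n" "j < n" "i \<noteq> j"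
  shows "elem_mat n i j h * elem_mat n i j (- h) = 1\<^sub>m n"
proof (rule eq_matI)
  fix r c assume "r < dim_row (1\<^sub>m n :: 'a laurent mat)" "c < dim_col (1\<^sub>m n :: 'a laurent mat)"
  then have rc: "r < n" "c < n" by auto
  have "(elem_mat n i j h * elem_mat n i j (- h)) $$ (r, c)
      = (\<Sum>k<n. elem_mat n i j h $$ (r, k) * elem_mat n i j (- h) $$ (k, c))"
    using rc by (simp add: elem_mat_def scalar_prod_def atLeast0LessThan)
  also have "\<dots> = (\<Sum>k<n. (if k = r then (if r = c then 1 else 0) + (if r = i \<and> c = j then - h else 0) else 0)
      + (if k = j then (if r = i \<and> c = j then h else 0) else 0))"
    using rc assms by (intro sum.cong) (auto simp: elem_mat_def)
  also have "\<dots> = (1\<^sub>m n :: 'a laurent mat) $$ (r, c)"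
    using rc assms by (simp add: sum.distrib)
  finally show "(elem_mat n i j h * elem_mat n i j (- h)) $$ (r, c) = (1\<^sub>m n :: 'a laurent mat) $$ (r, c)" .
qed (auto simp: elem_mat_def)

text \<open>Products of elementary matrices together with their inverses. Carrying the inverse along avoids
  any theory of inverse matrices over \<open>R\<close>.\<close>

inductive elementary_pair :: "nat \<Rightarrow> 'p :: prime_card laurent mat \<Rightarrow> 'p laurent mat \<Rightarrow> bool" for n where
  elem: "i < n \<Longrightarrow> j < n \<Longrightarrow> i \<noteq> j \<Longrightarrow> elementary_pair n (elem_mat n i j h) (elem_mat n i j (- h))"
| mult: "elementary_pair n A A' \<Longrightarrow> elementary_pair n B B' \<Longrightarrow> elementary_pair n (A * B) (B' * A')"

lemma elementary_pair_carrier: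
  assumes "elementary_pair n A A'"
  shows "A \<in> carrier_mat n n" "A' \<in> carrier_mat n n"
  using assms by (induction; auto intro: square_mult_closed)+

lemma elementary_pair_swap:
  assumes "elementary_pair n A A'"
  shows "elementary_pair n A' A"
  using assms
proof induction
  case (elem i j h)
  then show ?case using elementary_pair.elem[of i n j "- h"] by simp
next
  case (mult A A' B B')
  then show ?case by (intro elementary_pair.mult)
qed

lemma elementary_pair_inverse:
  assumes "elementary_pair n A A'"
  shows "A * A' = 1\<^sub>m n"
  using assms
proof induction
  case (elem i j h)
  then show ?case by (simp add: elem_mat_inverse)
next
  case (mult A A' B B')
  note c = elementary_pair_carrier[OF mult(1)] elementary_pair_carrier[OF mult(2)]
  have "A * B * (B' * A') = A * (B * B') * A'"
    using c by (simp add: square_mult_assoc[of _ n] square_mult_closed del: assoc_mult_mat)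
  then show ?case using mult c by simp
qed

lemma stably_realizable_levi:
  fixes A :: "'p :: prime_card laurent mat"
  assumes two: "(2 :: 'p mod_ring) \<noteq> 0" and q: "q \<ge> 1"
    and "elementary_pair q A A'"
  shows "stably_realizable q (levi_mat q A A')"
  using assms(3)
proof induction
  case (elem a b h)
  let ?X = "unit_vec (2 * q) a :: 'p laurent vec"
    and ?Y = "(- antipode h) \<cdot>\<^sub>v unit_vec (2 * q) (q + b) :: 'p laurent vec"
  let ?M = "levi_mat q (elem_mat q a b h) (elem_mat q a b (- h))"
  have c: "?M \<in> carrier_mat (2 * q) (2 * q)"
    unfolding levi_mat_def by (intro four_block_square_carrier) auto
  have "?M *\<^sub>v v = eichler q ?X ?Y 0 v" if "v \<in> carrier_vec (2 * q)" for v
  proof (rule eichler_matrix[OF c unit_vec_carrier unit_smult_carrier _ that])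
    fix i j assume ij: "i < 2 * q" "j < 2 * q"
    show "?M $$ (i, j) = (if i = j then 1 else 0)
      + form q ?Y (unit_vec (2 * q) j) * ?X $ i + form q ?X (unit_vec (2 * q) j) * ?Y $ i"
      unfolding kdelta_def[of i j, symmetric] using elem
      by (cases rule: less_double_cases[OF ij(1)]; cases rule: less_double_cases[OF ij(2)];
          simp add: levi_mat_def elem_mat_kdelta form_smult_left form_X form_Z unit_vec_kdelta one_mat_kdelta del: index_unit_vec index_one_mat;
          simp add: kdelta_commute mult_ac add_ac; auto simp: kdelta_def)
  qed
  then show ?case
    using elem
    by (intro stably_realizable_eichler[OF two q c unit_vec_carrier unit_smult_carrier])
      (auto simp: form_smult_left form_smult_right form_X form_Z)
next
  case (mult A A' B B')
  then show ?case
    using stably_realizable_mult[of q "levi_mat q A A'" "levi_mat q B B'"]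
      elementary_pair_carrier[OF mult(1)] elementary_pair_carrier[OF mult(2)]
    by (simp add: levi_mat_mult)
qed

section \<open>Comparing symplectic matrices by their first block column\<close>

lemma four_block_inject:
  assumes "A \<in> carrier_mat q q" "B \<in> carrier_mat q q" "C \<in> carrier_mat q q" "D \<in> carrier_mat q q"
    "A' \<in> carrier_mat q q" "B' \<in> carrier_mat q q" "C' \<in> carrier_mat q q" "D' \<in> carrier_mat q q"
    and "four_block_mat A B C D = four_block_mat A' B' C' D'"
  shows "A = A'" "B = B'" "C = C'" "D = D'"
proof -
  have "(A, B, C, D) = split_block (four_block_mat A B C D) q q"
    by (rule split_four_block[OF assms(1-4), symmetric])
  also have "\<dots> = (A', B', C', D')"
    unfolding assms(9) by (rule split_four_block[OF assms(5-8)])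
  finally show "A = A'" "B = B'" "C = C'" "D = D'" by simp_all
qed

lemma preserves_Lambda_mult:
  assumes A: "A \<in> carrier_mat (2 * n) (2 * n)" "dagger A * Lambda n * A = Lambda n"
    and B: "B \<in> carrier_mat (2 * n) (2 * n)" "dagger B * Lambda n * B = Lambda n"
  shows "dagger (A * B) * Lambda n * (A * B) = Lambda n"
proof -
  let ?N = "2 * n"
  have c: "Lambda n \<in> carrier_mat ?N ?N" "A \<in> carrier_mat ?N ?N" "dagger A \<in> carrier_mat ?N ?N"
     "B \<in> carrier_mat ?N ?N" "dagger B \<in> carrier_mat ?N ?N"
    using A B by auto
  have "dagger B * dagger A * Lambda n * (A * B) = dagger B * (dagger A * Lambda n * A) * B"
    using c by (simp add: square_mult_assoc[of _ ?N] square_mult_closed del: assoc_mult_mat)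
  then show ?thesis
    by (simp only: dagger_mult[OF c(2,4)] A B)
qed

lemma symp_inv_preserves_Lambda:
  assumes B: "symplectic n B"
  shows "dagger (symp_inv n B) * Lambda n * symp_inv n B = Lambda n"
proof -
  let ?N = "2 * n" and ?I = "symp_inv n B"
  have c: "Lambda n \<in> carrier_mat ?N ?N" "B \<in> carrier_mat ?N ?N" "dagger B \<in> carrier_mat ?N ?N"
     "?I \<in> carrier_mat ?N ?N" "dagger ?I \<in> carrier_mat ?N ?N" and s: "dagger B * Lambda n * B = Lambda n"
    using B by (auto simp: symplectic_def)
  have "dagger ?I * Lambda n * ?I = dagger ?I * (dagger B * Lambda n * B) * ?I"
    by (simp only: s)
  also have "\<dots> = (dagger ?I * dagger B) * Lambda n * (B * ?I)"
    using c by (simp add: square_mult_assoc[of _ ?N] square_mult_closed del: assoc_mult_mat)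
  also have "dagger ?I * dagger B = dagger (B * ?I)"
    by (rule dagger_mult[OF c(2,4), symmetric])
  also have "B * ?I = 1\<^sub>m ?N" by (rule symp_inv_right[OF B])
  finally show ?thesis using c by simp
qed

text \<open>The quotient \<open>W = B\<^sup>-\<^sup>1 A\<close> fixes the first block column of the identity, so it is upper
  triangular, and preservation of \<open>\<Lambda>\<close> turns its second block column into \<open>(S, 1)\<close> with \<open>S\<close>
  hermitian.\<close>

lemma same_first_block_column:
  assumes c: "a \<in> carrier_mat n n" "b \<in> carrier_mat n n" "c \<in> carrier_mat n n" "d \<in> carrier_mat n n"
      "b' \<in> carrier_mat n n" "d' \<in> carrier_mat n n"
    and A: "dagger (four_block_mat a b c d) * Lambda n * four_block_mat a b c d = Lambda n"
    and B: "symplectic n (four_block_mat a b' c d')"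
  obtains S where "S \<in> carrier_mat n n" "dagger S = S"
    "four_block_mat a b c d = four_block_mat a b' c d' * upper_mat n S"
proof -
  let ?N = "2 * n" and ?A = "four_block_mat a b c d" and ?B = "four_block_mat a b' c d'"
  let ?pi = "four_block_mat (1\<^sub>m n) (0\<^sub>m n n) (0\<^sub>m n n) (0\<^sub>m n n) :: 'a laurent mat"
  let ?I = "symp_inv n ?B"
  define W where "W = ?I * ?A"
  have cA: "?A \<in> carrier_mat ?N ?N" "?B \<in> carrier_mat ?N ?N" "?pi \<in> carrier_mat ?N ?N"
    using c by (auto intro!: four_block_square_carrier)
  have cI: "?I \<in> carrier_mat ?N ?N" using cA by simp
  have cW: "W \<in> carrier_mat ?N ?N" unfolding W_def using cA cI by (intro square_mult_closed)
  have BW: "?A = ?B * W"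
  proof -
    have "?B * W = (?B * ?I) * ?A"
      unfolding W_def using cA cI by (simp add: square_mult_assoc[of _ ?N] square_mult_closed del: assoc_mult_mat)
    then show ?thesis by (simp only: symp_inv_right[OF B] left_mult_one_mat[OF cA(1)])
  qed
  have "W * ?pi = ?I * (?A * ?pi)"
    unfolding W_def using cA cI by (simp add: square_mult_assoc[of _ ?N] square_mult_closed del: assoc_mult_mat)
  also have "?A * ?pi = ?B * ?pi"
    using c by (subst (1 2) mult_four_block_square[of _ n]) auto
  also have "?I * (?B * ?pi) = (?I * ?B) * ?pi"
    using cA cI by (simp add: square_mult_assoc[of _ ?N] square_mult_closed del: assoc_mult_mat)
  finally have Wpi: "W * ?pi = ?pi"
    by (simp only: symp_inv_left[OF B] left_mult_one_mat[OF cA(3)])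
  obtain w1 S w3 D where w: "w1 \<in> carrier_mat n n" "S \<in> carrier_mat n n" "w3 \<in> carrier_mat n n"
    "D \<in> carrier_mat n n" "W = four_block_mat w1 S w3 D"
    using cW by (rule four_block_cases)
  have "W * ?pi = four_block_mat w1 (0\<^sub>m n n) w3 (0\<^sub>m n n)"
    unfolding w(5) using w(1-4) by (subst mult_four_block_square[of _ n]) auto
  then have "w1 = 1\<^sub>m n" "w3 = 0\<^sub>m n n"
    using four_block_inject[of w1 n "0\<^sub>m n n" w3 "0\<^sub>m n n" "1\<^sub>m n" "0\<^sub>m n n" "0\<^sub>m n n" "0\<^sub>m n n"] w Wpi
    by auto
  then have W: "W = four_block_mat (1\<^sub>m n) S (0\<^sub>m n n) D" using w by simp
  have d: "dagger S \<in> carrier_mat n n" "dagger D \<in> carrier_mat n n" using w by auto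
  have cL: "- 1\<^sub>m n \<in> carrier_mat n n" "0\<^sub>m n n \<in> carrier_mat n n" "1\<^sub>m n \<in> carrier_mat n n" by auto
  have m: "X * - 1\<^sub>m n = - X" "X * 0\<^sub>m n n = 0\<^sub>m n n" "X * 1\<^sub>m n = X" "X + 0\<^sub>m n n = X"
    "0\<^sub>m n n + - X = - X" "0\<^sub>m n n + X = X" if "X \<in> carrier_mat n n" for X :: "'a laurent mat"
    using that by (auto intro!: eq_matI simp: uminus_mult_right_mat)
  have 1: "dagger W * Lambda n = four_block_mat (0\<^sub>m n n) (1\<^sub>m n) (- dagger D) (dagger S)"
    unfolding W dagger_four_block[OF cL(3) w(2) cL(2) w(4)] Lambda_def using d
    by (subst mult_four_block_square[of _ n]) (auto simp: m)
  have mD: "- dagger D \<in> carrier_mat n n" using d by auto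
  have "dagger W * Lambda n * W
      = four_block_mat (0\<^sub>m n n) D (- dagger D) (- dagger D * S + dagger S * D)"
    unfolding 1 unfolding W mult_four_block_square[OF cL(2,3) mD d(1) cL(3) w(2) cL(2) w(4)]
    using w d mD by (auto simp: m)
  moreover have "dagger W * Lambda n * W = Lambda n"
    unfolding W_def by (rule preserves_Lambda_mult[OF cI symp_inv_preserves_Lambda[OF B] cA(1) A])
  ultimately have e: "four_block_mat (0\<^sub>m n n) D (- dagger D) (- dagger D * S + dagger S * D)
      = four_block_mat (0\<^sub>m n n) (1\<^sub>m n) (- 1\<^sub>m n) (0\<^sub>m n n)"
    by (simp add: Lambda_def)
  have cX: "- dagger D * S + dagger S * D \<in> carrier_mat n n"
    using w d mD by (intro add_carrier_mat square_mult_closed)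
  note inj = four_block_inject[OF cL(2) w(4) mD cX cL(2,3,1,2) e]
  have D: "D = 1\<^sub>m n" by (rule inj(2))
  have "- S + dagger S = 0\<^sub>m n n"
    using inj(4) w(2) d(1) unfolding D by simp
  then have S: "dagger S = S"
  proof -
    assume z: "- S + dagger S = 0\<^sub>m n n"
    have "dagger S $$ (i, j) = S $$ (i, j)" if "i < n" "j < n" for i j
      using arg_cong[OF z, of "\<lambda>M. M $$ (i, j)"] w(2) that by simp
    then show "dagger S = S" using w(2) by (intro eq_matI) auto
  qed
  have "W = upper_mat n S" unfolding W D upper_mat_def ..
  then show thesis using that[OF w(2) S] BW by simp
qed

section \<open>The Cayley form of a symplectic matrix\<close>

lemma square_distrib_left:
  "A \<in> carrier_mat n n \<Longrightarrow> B \<in> carrier_mat n n \<Longrightarrow> C \<in> carrier_mat n n \<Longrightarrow>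
    A * (B + C) = A * B + A * (C :: 'a :: ring mat)"
  by (rule mult_add_distrib_mat)

lemma square_distrib_right:
  "A \<in> carrier_mat n n \<Longrightarrow> B \<in> carrier_mat n n \<Longrightarrow> C \<in> carrier_mat n n \<Longrightarrow>
    (A + B) * C = A * C + B * (C :: 'a :: ring mat)"
  by (rule add_mult_distrib_mat)

lemma square_uminus:
  fixes A :: "'a :: ring mat"
  assumes "A \<in> carrier_mat n n" "B \<in> carrier_mat n n"
  shows "- A * B = - (A * B)" "A * - B = - (A * B)" "- A \<in> carrier_mat n n" "A + B \<in> carrier_mat n n"
  using assms by auto

lemma square_minus:
  fixes A :: "'a :: ring mat"
  assumes "A \<in> carrier_mat n n" "B \<in> carrier_mat n n"
  shows "A - B = A + - B"
  using assms by (intro eq_matI) auto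

text \<open>For antihermitian \<open>T\<close> the hypothesis reads \<open>Q - Q\<^sup>\<dagger> = 2 Q\<^sup>\<dagger> T Q\<close>. The matrix is
  \<open>1 + (1, T)\<^sup>t Q (T, 1)\<close>, an identity plus a map through the subspace spanned by the columns of
  \<open>(1, T)\<close>.\<close>

lemma cayley_form_preserves_Lambda:
  fixes Q T :: "'p :: prime_card laurent mat"
  assumes c: "Q \<in> carrier_mat n n" "T \<in> carrier_mat n n"
    and T: "dagger T = - T"
    and Q: "Q = dagger Q + (dagger Q * T * Q + dagger Q * T * Q)"
  shows "dagger (four_block_mat (1\<^sub>m n + Q * T) Q (T * Q * T) (1\<^sub>m n + T * Q)) * Lambda n
    * four_block_mat (1\<^sub>m n + Q * T) Q (T * Q * T) (1\<^sub>m n + T * Q) = Lambda n"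
proof (rule four_block_preserves_Lambda)
  let ?Q = "dagger Q"
  define F where "F = ?Q * T * Q"
  have d: "?Q \<in> carrier_mat n n" "F \<in> carrier_mat n n" using c by (auto simp: F_def intro!: square_mult_closed)
  \<comment> \<open>Only the combination \<open>F = Q\<^sup>\<dagger> T Q\<close> occurs, so every identity reduces to replacing \<open>Q\<close> by
    \<open>Q\<^sup>\<dagger> + 2 F\<close> once.\<close>
  have QF: "Q = ?Q + (F + F)" using Q by (simp add: F_def)
  show "1\<^sub>m n + Q * T \<in> carrier_mat n n" "Q \<in> carrier_mat n n" "T * Q * T \<in> carrier_mat n n"
    "1\<^sub>m n + T * Q \<in> carrier_mat n n"
    using c by (auto intro!: square_mult_closed)
  note cl = square_mult_closed[of _ n] square_uminus[of _ n] square_distrib_left[of _ n]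
    square_distrib_right[of _ n] square_mult_assoc[of _ n]
  have dQT: "dagger (1\<^sub>m n + Q * T) = 1\<^sub>m n + - (T * ?Q)"
    using c d by (subst dagger_add[of _ n n])
      (auto simp: dagger_mult[of _ n n _ n] T cl simp del: assoc_mult_mat)
  have dTQ: "dagger (1\<^sub>m n + T * Q) = 1\<^sub>m n + - (?Q * T)"
    using c d by (subst dagger_add[of _ n n])
      (auto simp: dagger_mult[of _ n n _ n] T cl simp del: assoc_mult_mat)
  have dTQT: "dagger (T * Q * T) = T * (?Q * T)"
    using c d by (auto simp: dagger_mult[of _ n n _ n] T cl simp del: assoc_mult_mat)
  have TFT: "T * (F * T) = T * (?Q * (T * (Q * T)))" "T * F = T * (?Q * (T * Q))" "F = ?Q * (T * Q)"
    unfolding F_def using c d by (simp_all add: cl del: assoc_mult_mat)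
  have TQ: "T * Q = T * ?Q + (T * F + T * F)"
    using c d by (subst QF) (simp add: cl del: assoc_mult_mat)
  have TQT: "T * (Q * T) = T * (?Q * T) + (T * (F * T) + T * (F * T))"
    using c d by (subst QF) (simp add: cl del: assoc_mult_mat)
  have 1: "dagger (1\<^sub>m n + Q * T) * (T * Q * T) = T * (Q * T) + - (T * (F * T))"
    unfolding dQT TFT using c d by (simp add: cl del: assoc_mult_mat)
  have 2: "dagger (T * Q * T) * (1\<^sub>m n + Q * T) = T * (?Q * T) + T * (F * T)"
    unfolding dTQT TFT using c d by (simp add: cl del: assoc_mult_mat)
  have p: "T * (?Q * T) \<in> carrier_mat n n" "T * (F * T) \<in> carrier_mat n n"
     "T * ?Q \<in> carrier_mat n n" "T * F \<in> carrier_mat n n"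
    using c d by (auto intro!: square_mult_closed)
  show "dagger (1\<^sub>m n + Q * T) * (T * Q * T) = dagger (T * Q * T) * (1\<^sub>m n + Q * T)"
    unfolding 1 2 TQT using p by (intro eq_matI) (auto simp del: index_mult_mat(1))
  have 3: "dagger Q * (1\<^sub>m n + T * Q) = ?Q + F" "dagger (1\<^sub>m n + T * Q) * Q = Q + - F"
    unfolding dTQ TFT(3) using c d by (simp_all add: cl del: assoc_mult_mat)
  show "dagger Q * (1\<^sub>m n + T * Q) = dagger (1\<^sub>m n + T * Q) * Q"
    unfolding 3 by (subst (2) QF) (use d in \<open>intro eq_matI; auto\<close>)
  have 4: "dagger (1\<^sub>m n + Q * T) * (1\<^sub>m n + T * Q) = 1\<^sub>m n + - (T * ?Q) + (T * Q + - (T * F))"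
    unfolding dQT TFT using c d by (simp add: cl del: assoc_mult_mat)
  have 5: "dagger (T * Q * T) * Q = T * F"
    unfolding dTQT TFT using c d by (simp add: cl del: assoc_mult_mat)
  show "dagger (1\<^sub>m n + Q * T) * (1\<^sub>m n + T * Q) - dagger (T * Q * T) * Q = 1\<^sub>m n"
    unfolding 4 5 unfolding TQ using p c d by (intro eq_matI) (auto simp del: index_mult_mat(1))
qed

text \<open>Conjugation by the lower shear moves the subspace \<open>(1, T)\<close> of the Cayley form to
  \<open>(1, S + T)\<close>; for the TQFT automaton the latter is \<open>(1, k N\<^sup>\<dagger>)\<close>.\<close>

lemma shear_cayley_form:
  fixes Q T S :: "'p :: prime_card laurent mat"
  assumes c: "Q \<in> carrier_mat n n" "T \<in> carrier_mat n n" "S \<in> carrier_mat n n"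
  shows "four_block_mat (1\<^sub>m n + - (Q * (S + - T))) Q (- ((S + T) * Q * (S + - T))) (1\<^sub>m n + (S + T) * Q)
      * lower_mat n S
    = lower_mat n S * four_block_mat (1\<^sub>m n + Q * T) Q (T * Q * T) (1\<^sub>m n + T * Q)"
proof -
  note cl = square_mult_closed[of _ n] square_uminus[of _ n] square_distrib_left[of _ n]
    square_distrib_right[of _ n] square_mult_assoc[of _ n]
  have p: "Q * S \<in> carrier_mat n n" "Q * T \<in> carrier_mat n n" "S * Q \<in> carrier_mat n n"
     "T * Q \<in> carrier_mat n n" "S * (Q * S) \<in> carrier_mat n n" "S * (Q * T) \<in> carrier_mat n n"
     "T * (Q * S) \<in> carrier_mat n n" "T * (Q * T) \<in> carrier_mat n n"
    using c by (auto intro!: square_mult_closed)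
  have 1: "(1\<^sub>m n + - (Q * (S + - T))) * 1\<^sub>m n + Q * S = 1\<^sub>m n * (1\<^sub>m n + Q * T) + 0\<^sub>m n n * (T * Q * T)"
    using c by (simp add: cl del: assoc_mult_mat)
      (use p in \<open>intro eq_matI; auto simp del: index_mult_mat(1)\<close>)
  have 2: "(1\<^sub>m n + - (Q * (S + - T))) * 0\<^sub>m n n + Q * 1\<^sub>m n = 1\<^sub>m n * Q + 0\<^sub>m n n * (1\<^sub>m n + T * Q)"
    using c by (simp add: cl del: assoc_mult_mat)
  have 3: "- ((S + T) * Q * (S + - T)) * 1\<^sub>m n + (1\<^sub>m n + (S + T) * Q) * S
      = S * (1\<^sub>m n + Q * T) + 1\<^sub>m n * (T * Q * T)"
    using c by (simp add: cl del: assoc_mult_mat)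
      (use p c in \<open>intro eq_matI; auto simp del: index_mult_mat(1)\<close>)
  have 4: "- ((S + T) * Q * (S + - T)) * 0\<^sub>m n n + (1\<^sub>m n + (S + T) * Q) * 1\<^sub>m n
      = S * Q + 1\<^sub>m n * (1\<^sub>m n + T * Q)"
    using c by (simp add: cl del: assoc_mult_mat)
      (use p c in \<open>intro eq_matI; auto simp del: index_mult_mat(1)\<close>)
  have k: "1\<^sub>m n + - (Q * (S + - T)) \<in> carrier_mat n n"
    "- ((S + T) * Q * (S + - T)) \<in> carrier_mat n n" "1\<^sub>m n + (S + T) * Q \<in> carrier_mat n n"
    "1\<^sub>m n + Q * T \<in> carrier_mat n n" "T * Q * T \<in> carrier_mat n n" "1\<^sub>m n + T * Q \<in> carrier_mat n n"
    "(1\<^sub>m n :: 'p laurent mat) \<in> carrier_mat n n" "(0\<^sub>m n n :: 'p laurent mat) \<in> carrier_mat n n"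
    using c by (auto intro!: square_mult_closed)
  show ?thesis
    unfolding lower_mat_def
    by (simp only: mult_four_block_square[OF k(1) c(1) k(2,3,7,8) c(3) k(7)]
        mult_four_block_square[OF k(7,8) c(3) k(7,4) c(1) k(5,6)] 1 2 3 4)
qed

section \<open>Three-by-three matrices of Laurent polynomials\<close>

definition mat3 :: "'a \<Rightarrow> 'a \<Rightarrow> 'a \<Rightarrow> 'a \<Rightarrow> 'a \<Rightarrow> 'a \<Rightarrow> 'a \<Rightarrow> 'a \<Rightarrow> 'a \<Rightarrow> 'a mat" where
  "mat3 a b c d e f g h i = mat_of_rows_list 3 [[a, b, c], [d, e, f], [g, h, i]]"

lemma less_3_iff: "i < (3 :: nat) \<longleftrightarrow> i = 0 \<or> i = 1 \<or> i = 2"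
  by auto

lemma mat3_carrier [simp]: "mat3 a b c d e f g h i \<in> carrier_mat 3 3"
  by (rule carrier_matI) (simp_all add: mat3_def mat_of_rows_list_def)

lemma mat3_dims [simp]:
  "dim_row (mat3 a b c d e f g h i) = 3" "dim_col (mat3 a b c d e f g h i) = 3"
  by (simp_all add: mat3_def mat_of_rows_list_def)

lemma mat3_index [simp]:
  "mat3 a b c d e f g h i $$ (0, 0) = a" "mat3 a b c d e f g h i $$ (0, 1) = b"
  "mat3 a b c d e f g h i $$ (0, 2) = c" "mat3 a b c d e f g h i $$ (1, 0) = d"
  "mat3 a b c d e f g h i $$ (1, 1) = e" "mat3 a b c d e f g h i $$ (1, 2) = f"
  "mat3 a b c d e f g h i $$ (2, 0) = g" "mat3 a b c d e f g h i $$ (2, 1) = h"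
  "mat3 a b c d e f g h i $$ (2, 2) = i"
  "mat3 a b c d e f g h i $$ (0, Suc 0) = b" "mat3 a b c d e f g h i $$ (Suc 0, 0) = d"
  "mat3 a b c d e f g h i $$ (Suc 0, Suc 0) = e" "mat3 a b c d e f g h i $$ (Suc 0, 2) = f"
  "mat3 a b c d e f g h i $$ (2, Suc 0) = h"
  by (simp_all add: mat3_def mat_of_rows_list_def)

lemma mat3_eqI:
  assumes "M \<in> carrier_mat 3 3"
    and "M $$ (0, 0) = a" "M $$ (0, 1) = b" "M $$ (0, 2) = c"
      "M $$ (1, 0) = d" "M $$ (1, 1) = e" "M $$ (1, 2) = f"
      "M $$ (2, 0) = g" "M $$ (2, 1) = h" "M $$ (2, 2) = i"
  shows "M = mat3 a b c d e f g h i"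
  using assms by (intro eq_matI) (auto simp: less_3_iff)

lemma mult_mat3:
  "mat3 a b c d e f g h i * mat3 a' b' c' d' e' f' g' h' i' =
   mat3 (a * a' + b * d' + c * g') (a * b' + b * e' + c * h') (a * c' + b * f' + c * i')
        (d * a' + e * d' + f * g') (d * b' + e * e' + f * h') (d * c' + e * f' + f * i')
        (g * a' + h * d' + i * g') (g * b' + h * e' + i * h') (g * c' + h * f' + i * i')"
  for a :: "'a :: comm_semiring_1"
  by (rule mat3_eqI)
    (auto simp: scalar_prod_def numeral_3_eq_3 numeral_2_eq_2 mat3_index[unfolded numeral_2_eq_2] add.assoc
      intro!: square_mult_closed)

lemma add_mat3:
  "mat3 a b c d e f g h i + mat3 a' b' c' d' e' f' g' h' i' =
   mat3 (a + a') (b + b') (c + c') (d + d') (e + e') (f + f') (g + g') (h + h') (i + i')"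
  by (rule mat3_eqI) auto

lemma minus_mat3:
  "mat3 a b c d e f g h i - mat3 a' b' c' d' e' f' g' h' i' =
   mat3 (a - a') (b - b') (c - c') (d - d') (e - e') (f - f') (g - g') (h - h') (i - i')"
  by (rule mat3_eqI) auto

lemma uminus_mat3:
  "- mat3 a b c d e f g h i = mat3 (- a) (- b) (- c) (- d) (- e) (- f) (- g) (- h) (- i)"
  by (rule mat3_eqI) auto

lemma smult_mat3:
  "r \<cdot>\<^sub>m mat3 a b c d e f g h i =
   mat3 (r * a) (r * b) (r * c) (r * d) (r * e) (r * f) (r * g) (r * h) (r * i)"
  by (rule mat3_eqI) auto

lemma dagger_mat3:
  "dagger (mat3 a b c d e f g h i) =
   mat3 (antipode a) (antipode d) (antipode g) (antipode b) (antipode e) (antipode h)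
     (antipode c) (antipode f) (antipode i)"
  by (rule mat3_eqI) auto

lemma one_mat3: "1\<^sub>m 3 = mat3 1 0 0 0 1 0 0 0 1"
  by (rule mat3_eqI) auto

lemma elem_mat3:
  "elem_mat 3 0 1 h = mat3 1 h 0 0 1 0 0 0 1" "elem_mat 3 0 2 h = mat3 1 0 h 0 1 0 0 0 1"
  "elem_mat 3 1 0 h = mat3 1 0 0 h 1 0 0 0 1" "elem_mat 3 1 2 h = mat3 1 0 0 0 1 h 0 0 1"
  "elem_mat 3 2 0 h = mat3 1 0 0 0 1 0 h 0 1" "elem_mat 3 2 1 h = mat3 1 0 0 0 1 0 0 h 1"
  by (rule mat3_eqI; simp add: elem_mat_def)+

lemma mat3_cong:
  assumes "a = a'" "b = b'" "c = c'" "d = d'" "e = e'" "f = f'" "g = g'" "h = h'" "i = i'"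
  shows "mat3 a b c d e f g h i = mat3 a' b' c' d' e' f' g' h' i'"
  using assms by simp

lemmas mat3_simps = mult_mat3 add_mat3 minus_mat3 uminus_mat3 smult_mat3 dagger_mat3

lemma mon_mult: "mon a b c * mon a' b' c' = mon (a + a') (b + b') (c + c')"
  by (simp add: mon_def mult_single)

lemma mon_mult_left: "mon a b c * (mon a' b' c' * f) = mon (a + a') (b + b') (c + c') * f"
  by (simp add: mon_mult mult.assoc[symmetric])

lemma mon_zero: "mon 0 0 0 = 1"
  unfolding mon_def using single_one[where ?'a = site and ?'b = "'a mod_ring"] by (simp add: zero_prod_def)

lemmas laurent_simps = algebra_simps mon_mult mon_mult_left mon_zero

section \<open>The form behind the TQFT automaton\<close>

text \<open>The antihermitian part of \<open>2 N\<^sup>\<dagger>\<close>, and up to \<open>k\<close> the restriction of the symplectic form to the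
  subspace \<open>(1, k N\<^sup>\<dagger>)\<close> through which \<open>\<alpha>\<^sub>T\<^sub>Q\<^sub>F\<^sub>T\<close> differs from the identity.\<close>

definition A_mat :: "'p :: prime_card laurent mat" where
  "A_mat = dagger N_mat - N_mat"

lemma P_mat3: "P_mat = mat3
   0 (mon (-1) 0 (-1) - mon (-1) 0 0) (mon (-1) (-1) 0 - mon (-1) 0 0)
   (mon 0 (-1) 0 - mon 0 (-1) (-1)) 0 (mon (-1) (-1) 0 - mon 0 (-1) 0)
   (mon 0 0 (-1) - mon 0 (-1) (-1)) (mon 0 0 (-1) - mon (-1) 0 (-1)) 0"
  unfolding P_mat_def mat3_def by (simp add: mon_mult)

lemma N_mat3: "N_mat = mat3
   0 (mon (-1) 0 0) (mon (-1) 0 1)  (- mon 0 (-1) 0) 0 (mon 0 0 1)  (- 1) (- mon 0 1 0) 0"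
  unfolding N_mat_def mat3_def by (simp add: mon_mult)

lemma A_mat3: "A_mat = mat3
   0 (- mon (-1) 0 0 - mon 0 1 0) (- mon (-1) 0 1 - 1)
   (mon 0 (-1) 0 + mon 1 0 0) 0 (- mon 0 (-1) 0 - mon 0 0 1)
   (1 + mon 1 0 (-1)) (mon 0 0 (-1) + mon 0 1 0) 0"
  unfolding A_mat_def N_mat3 mat3_simps by (rule mat3_cong) (simp_all add: algebra_simps)

lemma dagger_A_mat: "dagger A_mat = - A_mat"
  unfolding A_mat3 mat3_simps by (rule mat3_cong) (simp_all add: algebra_simps)

lemma P_A_P: "dagger P_mat * A_mat * P_mat = (2 :: 'p :: prime_card laurent) \<cdot>\<^sub>m (P_mat - dagger P_mat)"
  unfolding A_mat3 P_mat3 mat3_simps by (rule mat3_cong) (simp_all add: laurent_simps)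

text \<open>The product of \<open>A\<close> with the basis \<open>B0_mat\<close>. The third column vanishes since the third basis vector
  spans the kernel of \<open>A\<close>.\<close>

definition AB0_mat :: "'p :: prime_card laurent mat" where
  "AB0_mat = mat3
    (1 + mon 1 1 0) (- 2 * mon (-1) 0 1 - 1 - mon 0 1 1) 0
    (mon 0 (-1) 0 + mon 1 0 0) (- mon 0 (-1) 0 - mon 0 0 1) 0
    (1 - mon 1 1 0) (1 + mon 0 1 1) 0"

definition PAB0_mat :: "'p :: prime_card laurent mat" where
  "PAB0_mat = mat3
    (mon (-1) (-1) (-1) - mon (-1) 0 0 + mon 0 0 (-1) - 2 + mon 0 1 0)
    (- mon (-1) (-1) (-1) + 2 * mon (-1) (-1) 0 - 2 * mon (-1) 0 0 + 2 * mon (-1) 0 1 - mon (-1) 1 1) 0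
    (mon (-1) (-1) 0 - mon 0 (-1) (-1) - 1 - mon 1 0 (-1) + 2 * mon 1 0 0)
    (3 * mon (-1) (-1) 0 - 2 * mon (-1) (-1) 1 + mon (-1) 0 1 + mon 0 (-1) (-1) - 2 * mon 0 (-1) 0 + 1 - 2 * mon 0 0 1) 0
    (- mon (-1) (-1) (-1) + mon 1 1 (-1))
    (mon (-1) (-1) (-1) + 2 * mon (-1) (-1) 0 - mon (-1) 0 0 - mon 0 0 (-1) - mon 0 1 0) 0"

lemma P_AB0: "P_mat * AB0_mat = PAB0_mat"
  unfolding P_mat3 AB0_mat_def PAB0_mat_def mat3_simps by (rule mat3_cong) (simp_all add: laurent_simps)

text \<open>The form \<open>B\<^sub>0\<^sup>\<dagger> A P A B\<^sub>0\<close> splits as \<open>2 ((u + 1) K + (u - 1) \<theta>)\<close> with \<open>K\<close> hermitian. The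
  splitting is unique only up to moving \<open>(u - 1) H\<close> into \<open>K\<close> and \<open>(u + 1) H\<close> out of \<open>\<theta>\<close>;
  this choice makes \<open>\<theta>\<close> isometric to the form of the invertible subalgebra.\<close>

definition K_mat :: "'p :: prime_card laurent mat" where
  "K_mat = mat3 0 (- mon (-2) (-1) 0 - mon (-1) 0 0 + mon (-1) 0 1 + mon 0 1 1) 0
   (mon 0 (-1) (-1) + mon 1 0 (-1) - mon 1 0 0 - mon 2 1 0)
   (mon (-1) 0 0 - mon 0 (-1) (-1) - mon 0 1 1 + mon 1 0 0) 0  0 0 0"

definition theta_mat :: "'p :: prime_card laurent mat" where
  "theta_mat = mat3 (- mon (-1) (-1) 0 + mon 1 1 0)
    (mon (-2) (-1) 0 + mon (-1) (-1) 0 + mon (-1) 0 0 - 1) 0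
    (1 - mon 1 0 0 - mon 1 1 0 - mon 2 1 0)
    (- mon (-1) 0 0 + mon 1 0 0) 0  0 0 0"

lemma dagger_K: "dagger K_mat = K_mat"
  unfolding K_mat_def mat3_simps by (rule mat3_cong) (simp_all add: laurent_simps)

lemma dagger_AB0_PAB0: "- (dagger AB0_mat * PAB0_mat) = (2 :: 'p :: prime_card laurent) \<cdot>\<^sub>m ((mon (-1) (-1) (-1) + 1) \<cdot>\<^sub>m K_mat
    + (mon (-1) (-1) (-1) - 1) \<cdot>\<^sub>m theta_mat)"
  unfolding AB0_mat_def PAB0_mat_def K_mat_def theta_mat_def mat3_simps by (rule mat3_cong) (simp_all add: laurent_simps)

section \<open>The translation of the invertible subalgebra\<close>

definition mat2 :: "'a \<Rightarrow> 'a \<Rightarrow> 'a \<Rightarrow> 'a \<Rightarrow> 'a mat" where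
  "mat2 a b c d = mat_of_rows_list 2 [[a, b], [c, d]]"

lemma mat2_dims [simp]:
  "dim_row (mat2 a b c d) = 2" "dim_col (mat2 a b c d) = 2"
  by (simp_all add: mat2_def mat_of_rows_list_def)

lemma mat2_carrier [simp]: "mat2 a b c d \<in> carrier_mat 2 2"
  by (rule carrier_matI) simp_all

lemma mat2_index [simp]:
  "mat2 a b c d $$ (0, 0) = a" "mat2 a b c d $$ (0, Suc 0) = b"
  "mat2 a b c d $$ (Suc 0, 0) = c" "mat2 a b c d $$ (Suc 0, Suc 0) = d"
  by (simp_all add: mat2_def mat_of_rows_list_def)

lemma mat2_eqI:
  assumes "M \<in> carrier_mat 2 2"
    and "M $$ (0, 0) = a" "M $$ (0, Suc 0) = b" "M $$ (Suc 0, 0) = c" "M $$ (Suc 0, Suc 0) = d"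
  shows "M = mat2 a b c d"
  using assms by (intro eq_matI) (auto simp: less_2_cases_iff)

lemma mult_mat2:
  "mat2 a b c d * mat2 a' b' c' d' =
    mat2 (a * a' + b * c') (a * b' + b * d') (c * a' + d * c') (c * b' + d * d')"
  for a :: "'a :: comm_semiring_1"
  by (rule mat2_eqI) (auto simp: scalar_prod_def numeral_2_eq_2 intro!: square_mult_closed)

lemma uminus_mat2: "- mat2 a b c d = mat2 (- a) (- b) (- c) (- d)"
  by (rule mat2_eqI) auto

lemma smult_mat2: "r \<cdot>\<^sub>m mat2 a b c d = mat2 (r * a) (r * b) (r * c) (r * d)"
  by (rule mat2_eqI) auto

lemma dagger_mat2:
  "dagger (mat2 a b c d) = mat2 (antipode a) (antipode c) (antipode b) (antipode d)"
  by (rule mat2_eqI) auto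

lemma one_mat2: "1\<^sub>m 2 = mat2 1 0 0 1"
  by (rule mat2_eqI) auto

lemma mat2_cong:
  assumes "a = a'" "b = b'" "c = c'" "d = d'"
  shows "mat2 a b c d = mat2 a' b' c' d'"
  using assms by simp

lemmas mat2_simps = mult_mat2 uminus_mat2 smult_mat2 dagger_mat2 one_mat2

text \<open>\<open>M = (k/2) M\<^sub>0\<close>. The determinant of \<open>M\<^sub>0\<close> is \<open>4\<close>, so \<open>M\<close> is unimodular up to a unit of
  \<open>\<int>\<^sub>p\<close> and the columns of \<open>(1, M)\<close> generate an invertible subalgebra.\<close>

definition M0_mat :: "'p :: prime_card laurent mat" where
  "M0_mat = mat2 (mon 0 1 0 - mon 0 (-1) 0) (mon (-1) 1 0 + mon (-1) 0 0 + mon 0 1 0 - 1)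
    (- mon 1 (-1) 0 - mon 1 0 0 - mon 0 (-1) 0 + 1) (mon (-1) 0 0 - mon 1 0 0)"

definition M0_adj :: "'p :: prime_card laurent mat" where
  "M0_adj = mat2 (mon (-1) 0 0 - mon 1 0 0) (- (mon (-1) 1 0 + mon (-1) 0 0 + mon 0 1 0 - 1))
    (mon 1 (-1) 0 + mon 1 0 0 + mon 0 (-1) 0 - 1) (mon 0 1 0 - mon 0 (-1) 0)"

lemma M_mat_eq: "M_mat k = const (k / 2) \<cdot>\<^sub>m M0_mat"
  unfolding M_mat_def M0_mat_def mat2_def by (simp add: mon_mult)

lemma M0_adj_mult:
  "M0_mat * M0_adj = (4 :: 'p :: prime_card laurent) \<cdot>\<^sub>m 1\<^sub>m 2"
  "M0_adj * M0_mat = (4 :: 'p :: prime_card laurent) \<cdot>\<^sub>m 1\<^sub>m 2"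
  unfolding M0_mat_def M0_adj_def mat2_simps by (rule mat2_cong; simp add: laurent_simps)+

lemma dagger_M0: "dagger M0_mat = - M0_mat" "dagger M0_adj = - M0_adj"
  unfolding M0_mat_def M0_adj_def mat2_simps by (rule mat2_cong; simp add: laurent_simps)+

lemma M0_carrier [simp]: "M0_mat \<in> carrier_mat 2 2" "M0_adj \<in> carrier_mat 2 2"
  by (simp_all add: M0_mat_def M0_adj_def)

definition M_inv :: "('p :: prime_card) mod_ring \<Rightarrow> 'p laurent mat" where
  "M_inv k = const (1 / (2 * k)) \<cdot>\<^sub>m M0_adj"

lemma M_carrier [simp]: "M_mat k \<in> carrier_mat 2 2" "M_inv k \<in> carrier_mat 2 2"
  by (simp_all add: M_mat_eq M_inv_def)

lemma M_dims [simp]: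
  "dim_row (M_mat k) = 2" "dim_col (M_mat k) = 2" "dim_row (M_inv k) = 2" "dim_col (M_inv k) = 2"
  using M_carrier[of k] by blast+

lemma dagger_M: "dagger (M_mat k) = - M_mat k" "dagger (M_inv k) = - M_inv k"
  by (auto simp: M_mat_eq M_inv_def dagger_smult dagger_M0 intro!: eq_matI)

lemma smult_smult_mat: "a \<cdot>\<^sub>m (b \<cdot>\<^sub>m A) = (a * b) \<cdot>\<^sub>m (A :: 'a :: semigroup_mult mat)"
  by (intro eq_matI) (auto simp: mult.assoc)

lemma smult_one_mat: "1 \<cdot>\<^sub>m A = (A :: 'a :: monoid_mult mat)"
  by (intro eq_matI) auto

lemma square_smult:
  fixes A :: "'a :: comm_ring_1 mat"
  assumes "A \<in> carrier_mat n n" "B \<in> carrier_mat n n"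
  shows "A * (r \<cdot>\<^sub>m B) = r \<cdot>\<^sub>m (A * B)" "r \<cdot>\<^sub>m A * B = r \<cdot>\<^sub>m (A * B)"
  using assms by (simp_all add: mult_smult_distrib[of _ n n] mult_smult_assoc_mat[of _ n n])

lemma M_mat_inverse:
  fixes k :: "'p :: prime_card mod_ring"
  assumes two: "(2 :: 'p mod_ring) \<noteq> 0" and k: "k \<noteq> 0"
  shows "M_mat k * M_inv k = 1\<^sub>m 2" "M_inv k * M_mat k = 1\<^sub>m 2"
proof -
  have c: "const (k / 2) * const (1 / (2 * k)) * 4 = (1 :: 'p laurent)"
  proof -
    have "const (k / 2) * const (1 / (2 * k)) * const 4 = (const (k / 2 * (1 / (2 * k)) * 4) :: 'p laurent)"
      by (simp only: const_mult)
    also have "k / 2 * (1 / (2 * k)) * 4 = 1"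
    proof -
      have "(2 :: 'p mod_ring) * 2 \<noteq> 0" using two by (simp only: mult_eq_0_iff) simp
      then have "(4 :: 'p mod_ring) \<noteq> 0" by simp
      then show ?thesis using two k by (simp add: field_simps)
    qed
    finally show ?thesis by simp
  qed
  have c': "const (1 / (2 * k)) * const (k / 2) * 4 = (1 :: 'p laurent)"
    using c by (simp only: mult_ac)
  have "M_mat k * M_inv k = const (1 / (2 * k)) * const (k / 2) * 4 \<cdot>\<^sub>m 1\<^sub>m 2"
    unfolding M_mat_eq M_inv_def
    by (simp add: square_smult[of _ 2] smult_smult_mat M0_adj_mult mult.assoc)
  then show "M_mat k * M_inv k = 1\<^sub>m 2"
    using c' by (simp add: smult_one_mat)
  have "M_inv k * M_mat k = const (k / 2) * const (1 / (2 * k)) * 4 \<cdot>\<^sub>m 1\<^sub>m 2"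
    unfolding M_mat_eq M_inv_def
    by (simp add: square_smult[of _ 2] smult_smult_mat M0_adj_mult mult.assoc)
  then show "M_inv k * M_mat k = 1\<^sub>m 2"
    using c by (simp add: smult_one_mat)
qed

text \<open>A translation by \<open>u\<close> on the subalgebra and by \<open>1\<close> on its commutant is \<open>1 + (u - 1) \<Pi>\<close>. The
  projection \<open>\<Pi>\<close> has the blocks \<open>1\<close>, \<open>M\<^sup>-\<^sup>1\<close>, \<open>M\<close>, \<open>1\<close> divided by two, which makes
  \<open>(u - 1)/2\<close> the scalar that occurs.\<close>

definition step :: "'p :: prime_card laurent" where
  "step = half * (mon (-1) (-1) (-1) - 1)"

text \<open>Unitarity \<open>u \<cdot> antipode u = 1\<close> in terms of \<open>u = 1 + 2 step\<close>.\<close>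

lemma step_relation:
  assumes two: "(2 :: 'p :: prime_card mod_ring) \<noteq> 0"
  shows "step + antipode step + 2 * (step * antipode step) = (0 :: 'p laurent)"
proof -
  let ?u = "mon (-1) (-1) (-1) :: 'p laurent" and ?v = "mon 1 1 1 :: 'p laurent"
  have uv: "(?u - 1) * (?v - 1) = 2 - ?u - ?v"
    by (simp add: laurent_simps)
  have hh: "2 * half = (1 :: 'p laurent)"
    using half_add_half[OF two] by (simp only: mult_2)
  have "2 * (step * antipode step) = (2 * half) * (half * ((?u - 1) * (?v - 1)))"
    by (simp add: step_def algebra_simps)
  also have "\<dots> = half * (2 - ?u - ?v)"
    unfolding uv hh by simp
  finally show ?thesis
    by (simp add: step_def algebra_simps)
qed

lemma mat_inv_eq:
  assumes "A \<in> carrier_mat n n" "B \<in> carrier_mat n n" "A * B = 1\<^sub>m n" "B * A = 1\<^sub>m n"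
  shows "mat_inv A = B"
  unfolding mat_inv_def
proof (rule the_equality)
  show "inverts_mat A B \<and> inverts_mat B A"
    using assms by (auto simp: inverts_mat_def)
  fix C assume C: "inverts_mat A C \<and> inverts_mat C A"
  then have e: "A * C = 1\<^sub>m n" "C * A = 1\<^sub>m (dim_row C)"
    using assms by (auto simp: inverts_mat_def)
  have "dim_col C = n" using arg_cong[OF e(1), of dim_col] by simp
  moreover have "dim_row C = n" using arg_cong[OF e(2), of dim_col] assms(1) by simp
  ultimately have c: "C \<in> carrier_mat n n" by auto
  have "C = C * (A * B)" using assms c by simp
  also have "\<dots> = C * A * B" using assms c by (intro assoc_mult_mat[symmetric])
  also have "\<dots> = B" using e(2) c assms by simp
  finally show "C = B" .
qed

text \<open>The inverse of \<open>H\<close> has the blocks \<open>1\<close>, \<open>M\<^sup>-\<^sup>1\<close>, \<open>1\<close>, \<open>- M\<^sup>-\<^sup>1\<close>, divided by two.\<close>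

lemma alpha_ISA_blocks:
  fixes k :: "'p :: prime_card mod_ring"
  assumes two: "(2 :: 'p mod_ring) \<noteq> 0" and k: "k \<noteq> 0"
  shows "alpha_ISA k = four_block_mat (1\<^sub>m 2 + step \<cdot>\<^sub>m 1\<^sub>m 2) (step \<cdot>\<^sub>m M_inv k)
    (step \<cdot>\<^sub>m M_mat k) (1\<^sub>m 2 + step \<cdot>\<^sub>m 1\<^sub>m 2)"
proof -
  let ?M = "M_mat k" and ?N = "M_inv k" and ?I = "1\<^sub>m 2 :: 'p laurent mat"
  let ?u = "mon (-1) (-1) (-1) :: 'p laurent"
  let ?h = "half :: 'p laurent"
  define J where "J = four_block_mat (?h \<cdot>\<^sub>m ?I) (?h \<cdot>\<^sub>m ?N) (?h \<cdot>\<^sub>m ?I) (- (?h \<cdot>\<^sub>m ?N))"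
  have c: "?M \<in> carrier_mat 2 2" "?N \<in> carrier_mat 2 2" "?I \<in> carrier_mat 2 2" "- ?M \<in> carrier_mat 2 2"
    "?h \<cdot>\<^sub>m ?I \<in> carrier_mat 2 2" "?h \<cdot>\<^sub>m ?N \<in> carrier_mat 2 2" "- (?h \<cdot>\<^sub>m ?N) \<in> carrier_mat 2 2"
    "?u \<cdot>\<^sub>m ?I \<in> carrier_mat 2 2" "0\<^sub>m 2 2 \<in> carrier_mat 2 2"
    by auto
  have hh: "?h + ?h = 1" by (rule half_add_half[OF two])
  have hf: "?h * f + ?h * f = f" for f by (rule half_mult_two[OF two])
  note inv = M_mat_inverse[OF two k]
  have cH: "H_mat k \<in> carrier_mat (2 * 2) (2 * 2)" "J \<in> carrier_mat (2 * 2) (2 * 2)"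
    unfolding H_mat_def J_def by (intro four_block_square_carrier c)+
  note s = square_smult[of _ 2]
  have one: "four_block_mat ?I (0\<^sub>m 2 2) (0\<^sub>m 2 2) ?I = 1\<^sub>m (2 * 2)"
    by simp
  note ones = left_mult_one_mat[of _ 2 2] right_mult_one_mat[of _ 2 2]
  have HJ: "H_mat k * J = 1\<^sub>m (2 * 2)"
    unfolding H_mat_def J_def mult_four_block_square[OF c(3,3,1,4) c(5,6,5,7)] one[symmetric]
    using c by (intro cong_four_block_mat)
      (auto simp: s inv ones square_uminus[of _ 2] hf hh simp del: index_mult_mat(1) intro!: eq_matI)
  have JH: "J * H_mat k = 1\<^sub>m (2 * 2)"
    unfolding H_mat_def J_def mult_four_block_square[OF c(5,6,5,7) c(3,3,1,4)] one[symmetric]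
    using c by (intro cong_four_block_mat)
      (auto simp: s inv ones square_uminus[of _ 2] hf hh simp del: index_mult_mat(1) intro!: eq_matI)
  have inv_H: "mat_inv (H_mat k) = J"
    by (rule mat_inv_eq[OF cH HJ JH])
  have u: "xbar * ybar * zbar = ?u" by (simp add: mon_mult)
  have uM: "?u \<cdot>\<^sub>m ?M \<in> carrier_mat 2 2" by auto
  have HD: "H_mat k * four_block_mat (?u \<cdot>\<^sub>m ?I) (0\<^sub>m 2 2) (0\<^sub>m 2 2) ?I
      = four_block_mat (?u \<cdot>\<^sub>m ?I) ?I (?u \<cdot>\<^sub>m ?M) (- ?M)"
    unfolding H_mat_def mult_four_block_square[OF c(3,3,1,4) c(8,9,9,3)]
    using c by (intro cong_four_block_mat) (auto simp: s)
  have hstep: "1 + step = ?h * ?u + ?h"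
  proof -
    have "1 + step = (?h + ?h) + ?h * (?u - 1)" by (simp only: step_def hh)
    then show ?thesis by (simp add: algebra_simps)
  qed
  show ?thesis
    unfolding alpha_ISA_def inv_H u HD
    unfolding J_def mult_four_block_square[OF c(8,3) uM c(4) c(5,6,5,7)]
    using c hstep
    by (intro cong_four_block_mat)
      (auto simp: s inv ones square_uminus[of _ 2] step_def algebra_simps simp del: index_mult_mat(1) intro!: eq_matI)
qed

text \<open>The idempotent \<open>E\<close> is the support of the form \<open>M\<close>, with \<open>M'\<close> its partial inverse. Allowing
  \<open>E \<noteq> 1\<close> covers the automaton both on its own two qudits and extended by a third.\<close>

lemma translation_symplectic:
  fixes M M' E :: "'p :: prime_card laurent mat"
  assumes c: "M \<in> carrier_mat n n" "M' \<in> carrier_mat n n" "E \<in> carrier_mat n n"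
    and d: "dagger M = - M" "dagger M' = - M'" "dagger E = E"
    and e: "E * E = E" "M * M' = E" "M' * M = E" "E * M = M" "M * E = M" "E * M' = M'" "M' * E = M'"
    and t: "t + antipode t + 2 * (t * antipode t) = 0"
  shows "symplectic n (four_block_mat (1\<^sub>m n + t \<cdot>\<^sub>m E) (t \<cdot>\<^sub>m M') (t \<cdot>\<^sub>m M) (1\<^sub>m n + t \<cdot>\<^sub>m E))"
proof -
  let ?t = "antipode t"
  have t': "?t = - t - 2 * (t * ?t)" using t by (simp add: algebra_simps add_eq_0_iff)
  note s = square_smult[of _ n]
  have dE: "dagger (1\<^sub>m n + t \<cdot>\<^sub>m E) = 1\<^sub>m n + ?t \<cdot>\<^sub>m E"
    using c by (subst dagger_add[of _ n n]) (auto simp: dagger_smult d)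
  have dM: "dagger (t \<cdot>\<^sub>m M) = (- ?t) \<cdot>\<^sub>m M" "dagger (t \<cdot>\<^sub>m M') = (- ?t) \<cdot>\<^sub>m M'"
    using c by (auto simp: dagger_smult d intro!: eq_matI)
  have l: "(1\<^sub>m n + a \<cdot>\<^sub>m E) * (b \<cdot>\<^sub>m N) = (b + a * b) \<cdot>\<^sub>m N"
    if "N \<in> carrier_mat n n" "E * N = N" for N a b
  proof -
    have "(1\<^sub>m n + a \<cdot>\<^sub>m E) * (b \<cdot>\<^sub>m N) = b \<cdot>\<^sub>m N + a \<cdot>\<^sub>m (b \<cdot>\<^sub>m N)"
      using that c by (subst square_distrib_right[of _ n]) (auto simp: s left_mult_one_mat[of _ n n])
    then show ?thesis using that by (auto simp: algebra_simps intro!: eq_matI)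
  qed
  have r: "(b \<cdot>\<^sub>m N) * (1\<^sub>m n + a \<cdot>\<^sub>m E) = (b + a * b) \<cdot>\<^sub>m N"
    if "N \<in> carrier_mat n n" "N * E = N" for N a b
  proof -
    have "(b \<cdot>\<^sub>m N) * (1\<^sub>m n + a \<cdot>\<^sub>m E) = b \<cdot>\<^sub>m N + a \<cdot>\<^sub>m (b \<cdot>\<^sub>m N)"
      using that c by (subst square_distrib_left[of _ n]) (auto simp: s right_mult_one_mat[of _ n n])
    then show ?thesis using that by (auto simp: algebra_simps intro!: eq_matI)
  qed
  have m: "(a \<cdot>\<^sub>m M) * (b \<cdot>\<^sub>m M') = (a * b) \<cdot>\<^sub>m E" "(a \<cdot>\<^sub>m M') * (b \<cdot>\<^sub>m M) = (a * b) \<cdot>\<^sub>m E"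
    for a b
    using c by (simp_all add: s e smult_smult_mat mult.commute)
  have q: "(1\<^sub>m n + a \<cdot>\<^sub>m E) * (1\<^sub>m n + b \<cdot>\<^sub>m E) = 1\<^sub>m n + (a + b + a * b) \<cdot>\<^sub>m E" for a b
  proof -
    have "(1\<^sub>m n + a \<cdot>\<^sub>m E) * (1\<^sub>m n + b \<cdot>\<^sub>m E) = (1\<^sub>m n + a \<cdot>\<^sub>m E) + (b + a * b) \<cdot>\<^sub>m E"
      using c by (subst square_distrib_left[of _ n]) (auto simp: l e right_mult_one_mat[of _ n n])
    then show ?thesis using c by (auto simp: algebra_simps intro!: eq_matI)
  qed
  have diff: "1\<^sub>m n + a \<cdot>\<^sub>m E - b \<cdot>\<^sub>m E = 1\<^sub>m n" if "a = b" for a b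
    using c that by (auto intro!: eq_matI)
  have x: "t + ?t * t = - ?t + t * - ?t" "?t + t + ?t * t = - ?t * t" "t + ?t + t * ?t = t * - ?t"
    by (rule eq_iff_diff_eq_0[THEN iffD2], use t in \<open>simp add: algebra_simps\<close>)+
  have cc: "1\<^sub>m n + t \<cdot>\<^sub>m E \<in> carrier_mat n n" "t \<cdot>\<^sub>m M' \<in> carrier_mat n n" "t \<cdot>\<^sub>m M \<in> carrier_mat n n"
    using c by auto
  show ?thesis
    by (rule symplectic_four_block[OF cc cc(1)]; unfold dE dM;
        simp only: l[OF c(1)] l[OF c(2)] r[OF c(1)] r[OF c(2)] e q m x diff)
qed

section \<open>Bases that bring the two forms together\<close>

text \<open>A basis of \<open>R\<^sup>3\<close> adapted to \<open>A\<close>. The third column spans the kernel of \<open>A\<close>; the factor one half in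
  \<open>B0_mat\<close> gives determinant \<open>1\<close>.\<close>

definition B0_int :: "'p :: prime_card laurent mat" where
  "B0_int = mat3 1 0 (mon 0 0 (-1) + mon 0 1 0)
    (- mon 1 0 0) (mon 0 0 1) (- mon 1 0 (-1) - 1)
    0 1 (mon 0 0 (-1) + mon 1 1 (-1))"

definition B0_mat :: "'p :: prime_card laurent mat" where
  "B0_mat = B0_int * mat3 1 0 0 0 1 0 0 0 half"

text \<open>Subtracts multiples of the kernel vector from the first two basis vectors. This changes neither
  \<open>A B\<^sub>0\<close> nor \<open>P A B\<^sub>0\<close>, and the multiples are the ones for which \<open>G + P A G / 4\<close> has the first
  two columns \<open>(1 + u)/2\<close> times those of \<open>B\<^sub>0\<close>.\<close>

definition E_mat :: "'p :: prime_card laurent mat" where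
  "E_mat = elem_mat 3 2 0 (- (half * (1 - mon (-1) (-1) 0)))
     * elem_mat 3 2 1 (- (half * (2 * mon (-1) (-1) 1 - mon (-1) (-1) 0 - mon (-1) 0 1)))"

text \<open>The base change from the form \<open>\<theta>\<close> to the form \<open>M\<close>.\<close>

definition B1_mat :: "'p :: prime_card laurent mat" where
  "B1_mat = elem_mat 3 1 0 (mon 1 1 0) * elem_mat 3 0 1 (1 + mon (-1) 0 0)"

lemma B0_mat3: "B0_mat = mat3 1 0 (half * (mon 0 0 (-1) + mon 0 1 0))
    (- mon 1 0 0) (mon 0 0 1) (half * (- mon 1 0 (-1) - 1))
    0 1 (half * (mon 0 0 (-1) + mon 1 1 (-1)))"
  unfolding B0_mat_def B0_int_def mat3_simps by (rule mat3_cong) (simp_all add: mult.commute)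

lemma E_mat_mat3: "E_mat = mat3 1 0 0 0 1 0
    (- (half * (1 - mon (-1) (-1) 0)))
    (- (half * (2 * mon (-1) (-1) 1 - mon (-1) (-1) 0 - mon (-1) 0 1))) 1"
  unfolding E_mat_def elem_mat3 mat3_simps by (rule mat3_cong) simp_all

lemma B1_mat3: "B1_mat = mat3 1 (1 + mon (-1) 0 0) 0
    (mon 1 1 0) (mon 1 1 0 * (1 + mon (-1) 0 0) + 1) 0  0 0 1"
  unfolding B1_mat_def elem_mat3 mat3_simps by (rule mat3_cong) simp_all

lemma B0_elementary:
  assumes two: "(2 :: 'p :: prime_card mod_ring) \<noteq> 0"
  obtains B' :: "'p :: prime_card laurent mat" where "elementary_pair 3 B0_mat B'"
proof -
  define a1 :: "'p laurent" where "a1 = mon 0 0 (-1) + mon 0 1 0"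
  define a2 :: "'p laurent" where "a2 = - mon 1 0 (-1) - 1"
  define a3 :: "'p laurent" where "a3 = mon 0 0 (-1) + mon 1 1 (-1)"
  \<comment> \<open>The third column of \<open>B\<^sub>0\<close> is half of \<open>(a1, a2, a3)\<close>, which modulo the first two columns is
    \<open>(0, - 2, 0)\<close>; halved this is a unit, and the last three factors below permute.\<close>
  have a2: "a2 = - (mon 1 0 0 * a1) - 2 + mon 0 0 1 * a3"
    by (simp add: a1_def a2_def a3_def laurent_simps)
  have h: "half * 2 = (1 :: 'p laurent)"
    using half_add_half[OF two] by (simp only: mult_2_right)
  have e: "- (mon 1 0 0 * (half * a1)) - 1 + mon 0 0 1 * (half * a3) = half * a2"
  proof -
    have "half * a2 = - (mon 1 0 0 * (half * a1)) - half * 2 + mon 0 0 1 * (half * a3)"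
      unfolding a2 by (simp only: algebra_simps mult_minus_right)
    then show ?thesis by (simp only: h)
  qed
  have "B0_mat = elem_mat 3 1 0 (- mon 1 0 0) * elem_mat 3 1 2 (mon 0 0 1)
      * (elem_mat 3 0 1 (- (half * a1)) * elem_mat 3 2 1 (- (half * a3)))
      * (elem_mat 3 1 2 (- 1) * elem_mat 3 2 1 1 * elem_mat 3 1 2 (- 1))"
    unfolding B0_mat3 elem_mat3 mat3_simps a1_def[symmetric] a2_def[symmetric] a3_def[symmetric]
    by (rule mat3_cong) (simp_all add: e[symmetric])
  moreover have "\<exists>B'. elementary_pair 3 (elem_mat 3 1 0 (- mon 1 0 0) * elem_mat 3 1 2 (mon 0 0 1)
      * (elem_mat 3 0 1 (- (half * a1)) * elem_mat 3 2 1 (- (half * a3)))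
      * (elem_mat 3 1 2 (- 1) * elem_mat 3 2 1 1 * elem_mat 3 1 2 (- 1))) B'"
    by (rule exI, (rule elementary_pair.mult elementary_pair.elem | simp)+)
  ultimately show thesis using that by metis
qed

lemma B1_elementary:
  obtains B' :: "'p :: prime_card laurent mat" where "elementary_pair 3 B1_mat B'"
proof -
  have "\<exists>B'. elementary_pair 3 (B1_mat :: 'p laurent mat) B'"
    unfolding B1_mat_def by (rule exI, (rule elementary_pair.mult elementary_pair.elem | simp)+)
  then show thesis using that by blast
qed

lemma E_mat_elementary:
  obtains E' :: "'p :: prime_card laurent mat" where "elementary_pair 3 E_mat E'"
proof -
  have "\<exists>E'. elementary_pair 3 (E_mat :: 'p laurent mat) E'"
    unfolding E_mat_def by (rule exI, (rule elementary_pair.mult elementary_pair.elem | simp)+)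
  then show thesis using that by blast
qed

definition G_mat :: "'p :: prime_card laurent mat" where
  "G_mat = B0_mat * E_mat"

lemma A_B0: "A_mat * B0_mat = (AB0_mat :: 'p :: prime_card laurent mat)"
proof -
  have "A_mat * B0_int = (AB0_mat :: 'p laurent mat)"
    unfolding A_mat3 B0_int_def AB0_mat_def mat3_simps by (rule mat3_cong) (simp_all add: laurent_simps)
  moreover have "A_mat * B0_mat = A_mat * B0_int * (mat3 1 0 0 0 1 0 0 0 half :: 'p laurent mat)"
    unfolding B0_mat_def A_mat3 B0_int_def by (intro square_mult_assoc[symmetric, of _ 3]) auto
  moreover have "AB0_mat * mat3 1 0 0 0 1 0 0 0 half = (AB0_mat :: 'p laurent mat)"
    unfolding AB0_mat_def mat3_simps by (rule mat3_cong) simp_all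
  ultimately show ?thesis by simp
qed

lemma explicit_carrier [simp]: "AB0_mat \<in> carrier_mat 3 3" "A_mat \<in> carrier_mat 3 3" "P_mat \<in> carrier_mat 3 3"
  "N_mat \<in> carrier_mat 3 3" "B0_mat \<in> carrier_mat 3 3" "E_mat \<in> carrier_mat 3 3" "B1_mat \<in> carrier_mat 3 3"
  "PAB0_mat \<in> carrier_mat 3 3" "K_mat \<in> carrier_mat 3 3" "theta_mat \<in> carrier_mat 3 3"
  by (simp_all add: AB0_mat_def A_mat3 P_mat3 N_mat3 B0_mat3 E_mat_mat3 B1_mat3 PAB0_mat_def K_mat_def theta_mat_def)

lemma G_carrier [simp]: "G_mat \<in> carrier_mat 3 3"
  unfolding G_mat_def by (intro square_mult_closed) auto

lemma A_G: "A_mat * G_mat = (AB0_mat :: 'p :: prime_card laurent mat)"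
proof -
  have "A_mat * G_mat = A_mat * B0_mat * (E_mat :: 'p laurent mat)"
    unfolding G_mat_def by (intro square_mult_assoc[symmetric, of _ 3]) auto
  also have "\<dots> = AB0_mat"
    unfolding A_B0 unfolding AB0_mat_def E_mat_mat3 mat3_simps by (rule mat3_cong) simp_all
  finally show ?thesis .
qed

text \<open>The extended automaton acts through \<open>\<alpha>\<^sub>I\<^sub>S\<^sub>A\<close> on the image of this projection only.\<close>

definition proj12 :: "'p :: prime_card laurent mat" where "proj12 = mat3 1 0 0 0 1 0 0 0 0"

lemma proj12_carrier [simp]: "proj12 \<in> carrier_mat 3 3" by (simp add: proj12_def)

text \<open>The upper blocks: the left side is \<open>(1 + Q T) G\<close> and the last factor on the right is the upper
  left block \<open>diag((1 + u)/2, (1 + u)/2, 1)\<close> of the extended \<open>\<alpha>\<^sub>I\<^sub>S\<^sub>A\<close>.\<close>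

lemma G_top_block:
  assumes two: "(2 :: 'p :: prime_card mod_ring) \<noteq> 0"
  shows "G_mat + (half * half) \<cdot>\<^sub>m PAB0_mat = B0_mat * (1\<^sub>m 3 + step \<cdot>\<^sub>m (proj12 :: 'p laurent mat))"
proof -
  define u :: "'p laurent" where "u = mon (-1) (-1) (-1) - 1"
  define e1 :: "'p laurent" where "e1 = 1 - mon (-1) (-1) 0"
  define e2 :: "'p laurent" where "e2 = 2 * mon (-1) (-1) 1 - mon (-1) (-1) 0 - mon (-1) 0 1"
  define a1 :: "'p laurent" where "a1 = mon 0 0 (-1) + mon 0 1 0"
  define a2 :: "'p laurent" where "a2 = - mon 1 0 (-1) - 1"
  define a3 :: "'p laurent" where "a3 = mon 0 0 (-1) + mon 1 1 (-1)"
  \<comment> \<open>The first two columns of \<open>P A B\<^sub>0\<close> are \<open>2 u\<close> times those of \<open>B\<^sub>0\<close> plus multiples of the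
    kernel vector \<open>(a1, a2, a3) / 2\<close>, which \<open>E_mat\<close> cancels.\<close>
  have D: "PAB0_mat = mat3 (2 * u + e1 * a1) (e2 * a1) 0
      (2 * (u * (- mon 1 0 0)) + e1 * a2) (2 * (u * mon 0 0 1) + e2 * a2) 0
      (e1 * a3) (2 * u + e2 * a3) 0"
    unfolding PAB0_mat_def u_def e1_def e2_def a1_def a2_def a3_def
    by (rule mat3_cong) (simp_all add: laurent_simps)
  have h: "2 * (half * half) = (half :: 'p laurent)"
  proof -
    have "2 * (half * half) = (half + half) * (half :: 'p laurent)"
      by (simp only: mult_2 distrib_right)
    then show ?thesis by (simp only: half_add_half[OF two] mult_1_left)
  qed
  have h': "2 * (f * (half * half)) = f * (half :: 'p laurent)" for f
    using arg_cong[OF h, of "(*) f"] by (simp only: mult_ac)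
  show ?thesis
    unfolding G_mat_def B0_mat3 E_mat_mat3 D proj12_def step_def one_mat3
      u_def[symmetric] e1_def[symmetric] e2_def[symmetric] a1_def[symmetric] a2_def[symmetric]
      a3_def[symmetric] mat3_simps
    by (rule mat3_cong)
      (simp_all add: distrib_left distrib_right right_diff_distrib left_diff_distrib h h' mult_ac)
qed

text \<open>The lower blocks, seen in the basis \<open>B\<^sub>0\<close>.\<close>

lemma dagger_B0_A_PAB0: "dagger B0_mat * (A_mat * PAB0_mat) = (2 :: 'p :: prime_card laurent) \<cdot>\<^sub>m
    ((mon (-1) (-1) (-1) + 1) \<cdot>\<^sub>m K_mat + (mon (-1) (-1) (-1) - 1) \<cdot>\<^sub>m theta_mat)"
proof -
  have d: "dagger B0_mat \<in> carrier_mat 3 3" "dagger AB0_mat \<in> carrier_mat 3 3" by auto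
  have "dagger AB0_mat = dagger B0_mat * (dagger A_mat :: 'p laurent mat)"
    unfolding A_B0[symmetric] by (rule dagger_mult[of _ 3 3 _ 3]) auto
  also have "\<dots> = - (dagger B0_mat * A_mat)"
    unfolding dagger_A_mat using square_uminus(2)[OF d(1) explicit_carrier(2)] .
  finally have e: "dagger B0_mat * A_mat = - dagger (AB0_mat :: 'p laurent mat)"
    by simp
  have "dagger B0_mat * (A_mat * PAB0_mat) = dagger B0_mat * A_mat * (PAB0_mat :: 'p laurent mat)"
    by (intro square_mult_assoc[symmetric, of _ 3]) auto
  also have "\<dots> = - (dagger AB0_mat * PAB0_mat)"
    unfolding e using square_uminus(1)[OF d(2) explicit_carrier(8)] .
  finally show ?thesis by (simp only: dagger_AB0_PAB0)
qed

lemma B1_theta: "dagger B1_mat * theta_mat * B1_mat = mat3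
    (mon 0 1 0 - mon 0 (-1) 0) (mon (-1) 1 0 + mon (-1) 0 0 + mon 0 1 0 - 1) 0
    (- mon 1 (-1) 0 - mon 1 0 0 - mon 0 (-1) 0 + 1) (mon (-1) 0 0 - mon 1 0 0) 0  0 0 0"
  unfolding B1_mat3 theta_mat_def mat3_simps by (rule mat3_cong) (simp_all add: laurent_simps)

lemma B1_proj12: "B1_mat * proj12 = proj12 * B1_mat"
  unfolding B1_mat3 proj12_def mat3_simps by (rule mat3_cong) simp_all

lemma K_proj12: "K_mat * proj12 = K_mat"
  unfolding K_mat_def proj12_def mat3_simps by (rule mat3_cong) simp_all

section \<open>Both automata on three qudits\<close>

definition pad :: "'a :: zero mat \<Rightarrow> 'a mat" where
  "pad A = direct_sum A (0\<^sub>m 1 1)"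

lemma pad_carrier: "A \<in> carrier_mat 2 2 \<Longrightarrow> pad A \<in> carrier_mat 3 3"
  using direct_sum_carrier[of A 2 2 "0\<^sub>m 1 1" 1 1] by (simp add: pad_def)

lemma pad_mult:
  fixes A B :: "'a :: comm_ring_1 mat"
  assumes "A \<in> carrier_mat 2 2" "B \<in> carrier_mat 2 2"
  shows "pad A * pad B = pad (A * B)"
proof -
  have "pad A * pad B = four_block_mat (A * B) (0\<^sub>m 2 1) (0\<^sub>m 1 2) (0\<^sub>m 1 1)"
    unfolding pad_def direct_sum_def using assms
    by (subst mult_four_block_mat[of _ 2 2 _ 1 _ 1 _ _ 2 _ 1]) auto
  then show ?thesis using assms by (simp add: pad_def direct_sum_def)
qed

lemma pad_dagger: "dagger (pad A) = pad (dagger A)"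
  unfolding pad_def direct_sum_def by (intro eq_matI) auto

lemma pad_uminus: "pad (- A) = - pad (A :: 'a :: ring mat)"
  unfolding pad_def direct_sum_def by (intro eq_matI) auto

lemma pad_smult: "pad (r \<cdot>\<^sub>m A) = r \<cdot>\<^sub>m pad (A :: 'a :: ring mat)"
  unfolding pad_def direct_sum_def by (intro eq_matI) auto

lemma pad_one: "pad (1\<^sub>m 2) = proj12"
  unfolding proj12_def by (rule mat3_eqI) (auto simp: pad_def direct_sum_def)

lemma direct_sum_one_step:
  "direct_sum (1\<^sub>m 2 + r \<cdot>\<^sub>m 1\<^sub>m 2) (1\<^sub>m 1) = 1\<^sub>m 3 + r \<cdot>\<^sub>m proj12"
  unfolding proj12_def one_mat3 mat3_simps by (rule mat3_eqI) (auto simp: direct_sum_def)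

definition alpha3 :: "('p :: prime_card) mod_ring \<Rightarrow> 'p laurent mat" where
  "alpha3 k = stabilize 2 1 (alpha_ISA k)"

lemma alpha3_blocks:
  fixes k :: "'p :: prime_card mod_ring"
  assumes two: "(2 :: 'p mod_ring) \<noteq> 0" and k: "k \<noteq> 0"
  shows "alpha3 k = four_block_mat (1\<^sub>m 3 + step \<cdot>\<^sub>m proj12) (step \<cdot>\<^sub>m pad (M_inv k))
    (step \<cdot>\<^sub>m pad (M_mat k)) (1\<^sub>m 3 + step \<cdot>\<^sub>m proj12)"
proof -
  have c: "1\<^sub>m 2 + step \<cdot>\<^sub>m 1\<^sub>m 2 \<in> carrier_mat 2 2" "step \<cdot>\<^sub>m M_inv k \<in> carrier_mat 2 2"
    "step \<cdot>\<^sub>m M_mat k \<in> carrier_mat 2 2" by auto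
  show ?thesis
    unfolding alpha3_def alpha_ISA_blocks[OF two k] stabilize_four_block[OF c(1-3) c(1)]
      direct_sum_one_step pad_def[symmetric] pad_smult ..
qed

lemma alpha_ISA_symplectic:
  fixes k :: "'p :: prime_card mod_ring"
  assumes two: "(2 :: 'p mod_ring) \<noteq> 0" and k: "k \<noteq> 0"
  shows "symplectic 2 (alpha_ISA k)"
  unfolding alpha_ISA_blocks[OF two k]
  by (rule translation_symplectic)
    (auto simp: dagger_M M_mat_inverse[OF two k] step_relation[OF two]
      left_mult_one_mat[of _ 2 2] right_mult_one_mat[of _ 2 2])

lemma alpha3_symplectic:
  fixes k :: "'p :: prime_card mod_ring"
  assumes two: "(2 :: 'p mod_ring) \<noteq> 0" and k: "k \<noteq> 0"
  shows "symplectic 3 (alpha3 k)"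
  unfolding alpha3_blocks[OF two k]
  by (rule translation_symplectic)
    (simp_all add: pad_carrier pad_dagger dagger_M pad_uminus pad_mult
      M_mat_inverse[OF two k] step_relation[OF two] pad_one[symmetric]
      left_mult_one_mat[of _ 2 2] right_mult_one_mat[of _ 2 2])

lemma pad_M: "pad (M_mat k) = const (k / 2) \<cdot>\<^sub>m (dagger B1_mat * theta_mat * B1_mat)"
  unfolding M_mat_eq M0_mat_def B1_theta smult_mat2 smult_mat3
  by (rule mat3_eqI) (auto simp: pad_def direct_sum_def)

lemma PN_dims [simp]: "dim_row P_mat = 3" "dim_col P_mat = 3" "dim_row N_mat = 3" "dim_col N_mat = 3"
  by (simp_all add: P_mat3 N_mat3)

text \<open>In terms of these matrices \<open>k N\<^sup>\<dagger> = S + T\<close> with \<open>S\<close> hermitian and \<open>T\<close> antihermitian, and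
  \<open>Q = P / 2k\<close> is the upper right block of \<open>\<alpha>\<^sub>T\<^sub>Q\<^sub>F\<^sub>T\<close>.\<close>

definition Q_mat :: "('p :: prime_card) mod_ring \<Rightarrow> 'p laurent mat" where
  "Q_mat k = const (1 / (2 * k)) \<cdot>\<^sub>m P_mat"

definition T_mat :: "('p :: prime_card) mod_ring \<Rightarrow> 'p laurent mat" where
  "T_mat k = const (k / 2) \<cdot>\<^sub>m A_mat"

definition S_mat :: "('p :: prime_card) mod_ring \<Rightarrow> 'p laurent mat" where
  "S_mat k = const (k / 2) \<cdot>\<^sub>m (N_mat + dagger N_mat)"

lemma QTS_carrier [simp]: "Q_mat k \<in> carrier_mat 3 3" "T_mat k \<in> carrier_mat 3 3" "S_mat k \<in> carrier_mat 3 3"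
  by (simp_all add: Q_mat_def T_mat_def S_mat_def)

lemma QTS_dims [simp]:
  "dim_row (Q_mat k) = 3" "dim_col (Q_mat k) = 3" "dim_row (T_mat k) = 3" "dim_col (T_mat k) = 3"
  "dim_row (S_mat k) = 3" "dim_col (S_mat k) = 3"
  using QTS_carrier[of k] by (simp_all only: carrier_mat_def mem_Collect_eq)

lemma dagger_T: "dagger (T_mat k) = - T_mat k"
  unfolding T_mat_def by (simp add: dagger_smult dagger_A_mat) (auto intro!: eq_matI)

lemma dagger_S: "dagger (S_mat k) = S_mat k"
  unfolding S_mat_def
  by (simp add: dagger_smult dagger_add[of _ 3 3] comm_add_mat[of _ 3 3])

lemma Q_relation:
  fixes k :: "'p :: prime_card mod_ring"
  assumes two: "(2 :: 'p mod_ring) \<noteq> 0" and k: "k \<noteq> 0"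
  shows "Q_mat k = dagger (Q_mat k) + (dagger (Q_mat k) * T_mat k * Q_mat k
    + dagger (Q_mat k) * T_mat k * Q_mat k)"
proof -
  let ?q = "const (1 / (2 * k)) :: 'p laurent" and ?h = "const (k / 2) :: 'p laurent"
  have "dagger (Q_mat k) * T_mat k * Q_mat k = (?q * ?h * ?q) \<cdot>\<^sub>m (dagger P_mat * A_mat * P_mat)"
    unfolding Q_mat_def T_mat_def dagger_smult
    by (simp add: square_smult[of _ 3] square_mult_closed smult_smult_mat mult_ac)
  also have "\<dots> = (?q * ?h * ?q * 2) \<cdot>\<^sub>m (P_mat - dagger P_mat)"
    unfolding P_A_P by (simp only: smult_smult_mat)
  finally have F: "dagger (Q_mat k) * T_mat k * Q_mat k = (?q * ?h * ?q * 2) \<cdot>\<^sub>m (P_mat - dagger P_mat)" .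
  have "?q * ?h * ?q * 2 + ?q * ?h * ?q * 2 = const (1 / (2 * k) * (k / 2) * (1 / (2 * k)) * 2 + 1 / (2 * k) * (k / 2) * (1 / (2 * k)) * 2)"
    by (simp only: const_add const_mult const_numeral)
  also have "1 / (2 * k) * (k / 2) * (1 / (2 * k)) * 2 + 1 / (2 * k) * (k / 2) * (1 / (2 * k)) * 2 = 1 / (2 * k)"
  proof -
    have "(64 :: 'p mod_ring) = 2 ^ 6" "(8 :: 'p mod_ring) = 2 ^ 3" "(4 :: 'p mod_ring) = 2 ^ 2"
      by simp_all
    then have "(64 :: 'p mod_ring) \<noteq> 0" "(8 :: 'p mod_ring) \<noteq> 0" "(4 :: 'p mod_ring) \<noteq> 0"
      using two by (metis power_not_zero)+
    then show ?thesis using two k by (simp add: divide_simps)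
  qed
  finally have s: "?q * ?h * ?q * 2 * f + ?q * ?h * ?q * 2 * f = ?q * f" for f
    by (simp only: distrib_right[symmetric])
  show ?thesis
    unfolding F unfolding Q_mat_def
  proof (rule eq_matI)
    fix i j
    let ?P = "P_mat :: 'p laurent mat"
    assume "i < dim_row (dagger (?q \<cdot>\<^sub>m ?P) + ((?q * ?h * ?q * 2) \<cdot>\<^sub>m (?P - dagger ?P) + (?q * ?h * ?q * 2) \<cdot>\<^sub>m (?P - dagger ?P)))"
      "j < dim_col (dagger (?q \<cdot>\<^sub>m ?P) + ((?q * ?h * ?q * 2) \<cdot>\<^sub>m (?P - dagger ?P) + (?q * ?h * ?q * 2) \<cdot>\<^sub>m (?P - dagger ?P)))"
    moreover have c: "dim_row ?P = 3" "dim_col ?P = 3" using explicit_carrier(3) by blast+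
    ultimately have ij: "i < 3" "j < 3" by auto
    show "(?q \<cdot>\<^sub>m ?P) $$ (i, j) = (dagger (?q \<cdot>\<^sub>m ?P) + ((?q * ?h * ?q * 2) \<cdot>\<^sub>m (?P - dagger ?P)
        + (?q * ?h * ?q * 2) \<cdot>\<^sub>m (?P - dagger ?P))) $$ (i, j)"
      using ij c s by (simp add: right_diff_distrib)
  qed (use explicit_carrier(3) in \<open>auto simp: dagger_def\<close>)
qed

lemma alpha_TQFT_shear:
  fixes k :: "'p :: prime_card mod_ring"
  assumes two: "(2 :: 'p mod_ring) \<noteq> 0" and k: "k \<noteq> 0"
  shows "alpha_TQFT k = four_block_mat
    (1\<^sub>m 3 + - (Q_mat k * (S_mat k + - T_mat k))) (Q_mat k)
    (- ((S_mat k + T_mat k) * Q_mat k * (S_mat k + - T_mat k))) (1\<^sub>m 3 + (S_mat k + T_mat k) * Q_mat k)"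
proof -
  let ?q = "const (1 / (2 * k)) :: 'p laurent" and ?k = "const k :: 'p laurent"
  have kk: "const (k / 2) + const (k / 2) = ?k"
    unfolding const_add[symmetric] using two by simp
  have kk': "const (k / 2) * f + const (k / 2) * f = ?k * f" for f :: "'p laurent"
    using kk by (simp only: distrib_right[symmetric])
  have N: "(N_mat :: 'p laurent mat) \<in> carrier_mat 3 3" "dagger (N_mat :: 'p laurent mat) \<in> carrier_mat 3 3"
    by auto
  have 1: "S_mat k + - T_mat k = ?k \<cdot>\<^sub>m N_mat"
    unfolding S_mat_def T_mat_def A_mat_def using N
    by (intro eq_matI) (auto simp: algebra_simps kk'[symmetric])
  have 2: "S_mat k + T_mat k = ?k \<cdot>\<^sub>m dagger N_mat"
    unfolding S_mat_def T_mat_def A_mat_def using N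
    by (intro eq_matI) (auto simp: algebra_simps kk'[symmetric])
  have kq: "?k * ?q = half" "?q * ?k = half"
    unfolding const_mult[symmetric] using k by simp_all
  have kh: "?k * half = const (k / 2)"
    unfolding const_mult[symmetric] by simp
  have a: "Q_mat k * (?k \<cdot>\<^sub>m N_mat) = half \<cdot>\<^sub>m (P_mat * N_mat)"
    unfolding Q_mat_def by (simp add: square_smult[of _ 3] smult_smult_mat kq)
  have d: "(?k \<cdot>\<^sub>m dagger N_mat) * Q_mat k = half \<cdot>\<^sub>m (dagger N_mat * P_mat)"
    unfolding Q_mat_def by (simp add: square_smult[of _ 3] smult_smult_mat kq)
  have NP: "dagger N_mat * (P_mat :: 'p laurent mat) \<in> carrier_mat 3 3" by (intro square_mult_closed) auto
  have c: "(?k \<cdot>\<^sub>m dagger N_mat) * Q_mat k * (?k \<cdot>\<^sub>m N_mat) = const (k / 2) \<cdot>\<^sub>m (dagger N_mat * P_mat * N_mat)"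
  proof -
    have hNP: "half \<cdot>\<^sub>m (dagger N_mat * (P_mat :: 'p laurent mat)) \<in> carrier_mat 3 3" using NP by simp
    show ?thesis
      unfolding d square_smult(1)[OF hNP N(1)] square_smult(2)[OF NP N(1)] smult_smult_mat kh ..
  qed
  have m: "1\<^sub>m 3 - half \<cdot>\<^sub>m (P_mat * N_mat) = 1\<^sub>m 3 + - (half \<cdot>\<^sub>m (P_mat * N_mat) :: 'p laurent mat)"
    by (intro square_minus[of _ 3]) (auto intro!: square_mult_closed)
  show ?thesis
    unfolding 1 2 unfolding c unfolding a d alpha_TQFT_def m by (simp add: Q_mat_def)
qed

section \<open>The factorization and the equivalence\<close>

lemma levi_mat_mult_left:
  assumes "A \<in> carrier_mat n n" "A' \<in> carrier_mat n n" "a \<in> carrier_mat n n" "b \<in> carrier_mat n n"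
    "c \<in> carrier_mat n n" "d \<in> carrier_mat n n"
  shows "levi_mat n A A' * four_block_mat a b c d
    = four_block_mat (A * a) (A * b) (dagger A' * c) (dagger A' * d)"
proof -
  have d: "dagger A' \<in> carrier_mat n n" using assms by auto
  have "A * a \<in> carrier_mat n n" "A * b \<in> carrier_mat n n" "dagger A' * c \<in> carrier_mat n n"
    "dagger A' * d \<in> carrier_mat n n"
    using assms d by (auto intro!: square_mult_closed)
  then show ?thesis
    unfolding levi_mat_def using assms d
    by (subst mult_four_block_square[of _ n]) (auto simp: left_mult_zero_mat[of _ n n])
qed

lemma levi_mat_mult_right:
  assumes "A \<in> carrier_mat n n" "A' \<in> carrier_mat n n" "a \<in> carrier_mat n n" "b \<in> carrier_mat n n"
    "c \<in> carrier_mat n n" "d \<in> carrier_mat n n"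
  shows "four_block_mat a b c d * levi_mat n A A'
    = four_block_mat (a * A) (b * dagger A') (c * A) (d * dagger A')"
proof -
  have d: "dagger A' \<in> carrier_mat n n" using assms by auto
  have "a * A \<in> carrier_mat n n" "c * A \<in> carrier_mat n n" "b * dagger A' \<in> carrier_mat n n"
    "d * dagger A' \<in> carrier_mat n n"
    using assms d by (auto intro!: square_mult_closed)
  then show ?thesis
    unfolding levi_mat_def using assms d
    by (subst mult_four_block_square[of _ n]) (auto simp: right_mult_zero_mat[of _ n n])
qed

lemma lower_mat_mult_left:
  assumes "S \<in> carrier_mat n n" "a \<in> carrier_mat n n" "b \<in> carrier_mat n n"
    "c \<in> carrier_mat n n" "d \<in> carrier_mat n n"
  shows "lower_mat n S * four_block_mat a b c d = four_block_mat a b (S * a + c) (S * b + d)"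
  unfolding lower_mat_def using assms
  by (subst mult_four_block_square[of _ n]) (auto simp: left_mult_zero_mat[of _ n n])

lemma alpha_TQFT_conjugate:
  fixes k :: "'p :: prime_card mod_ring"
  assumes two: "(2 :: 'p mod_ring) \<noteq> 0" and k: "k \<noteq> 0"
  defines "\<beta> \<equiv> four_block_mat (1\<^sub>m 3 + Q_mat k * T_mat k) (Q_mat k)
      (T_mat k * Q_mat k * T_mat k) (1\<^sub>m 3 + T_mat k * Q_mat k)"
  shows "alpha_TQFT k = lower_mat 3 (S_mat k) * \<beta> * lower_mat 3 (- S_mat k)"
proof -
  let ?L = "lower_mat 3 (S_mat k)" and ?L' = "lower_mat 3 (- S_mat k)"
  have c: "?L \<in> carrier_mat 6 6" "?L' \<in> carrier_mat 6 6"
    using four_block_square_carrier[of _ 3] unfolding lower_mat_def by auto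
  have "?L * ?L' = lower_mat 3 (S_mat k + - S_mat k)"
    by (rule lower_mat_add) auto
  also have "S_mat k + - S_mat k = 0\<^sub>m 3 3"
    using QTS_carrier(3)[of k] by (intro eq_matI) auto
  also have "lower_mat 3 (0\<^sub>m 3 3) = (1\<^sub>m 6 :: 'p laurent mat)"
    by (simp add: lower_mat_def)
  finally have inv: "?L * ?L' = 1\<^sub>m 6" .
  have A: "alpha_TQFT k \<in> carrier_mat 6 6"
    unfolding alpha_TQFT_shear[OF two k] using four_block_square_carrier[of _ 3]
    by (auto intro!: square_mult_closed)
  have e: "alpha_TQFT k * ?L = ?L * \<beta>"
    unfolding alpha_TQFT_shear[OF two k] \<beta>_def
    by (rule shear_cayley_form) auto
  have "alpha_TQFT k = alpha_TQFT k * (?L * ?L')" using A by (simp add: inv)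
  also have "\<dots> = alpha_TQFT k * ?L * ?L'"
    using A c by (intro square_mult_assoc[symmetric])
  finally show ?thesis by (simp only: e)
qed

text \<open>With \<open>\<beta>\<close> the Cayley form of \<open>\<alpha>\<^sub>T\<^sub>Q\<^sub>F\<^sub>T\<close>, the matrix \<open>\<beta> levi G\<close> is compared with
  \<open>F = levi B\<^sub>0 \<cdot> lower K \<cdot> levi B\<^sub>1 \<cdot> \<alpha> \<cdot> levi B\<^sub>1\<^sup>-\<^sup>1\<close>. The conjugation by \<open>B\<^sub>1\<close> turns \<open>M\<close> into
  \<open>(k/2) \<theta>\<close>, the shear adds the part of the lower block that is divisible by \<open>1 + u\<close>, and \<open>B\<^sub>0\<close> brings the
  upper block into place. The first block columns then coincide, and the hermitian shear \<open>U\<close> that is left goes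
  into \<open>R\<close>.\<close>

lemma alpha_TQFT_factorization:
  fixes k :: "'p :: prime_card mod_ring"
  assumes two: "(2 :: 'p mod_ring) \<noteq> 0" and k: "k \<noteq> 0"
  obtains L R where "stably_realizable 3 L" "stably_realizable 3 R" "symplectic 3 L" "symplectic 3 R"
    "alpha_TQFT k = L * alpha3 k * R"
proof -
  let ?h = "const (k / 2) :: 'p laurent" and ?q = "const (1 / (2 * k)) :: 'p laurent"
  let ?N = "carrier_mat 6 6 :: 'p laurent mat set"
  obtain B' :: "'p laurent mat" where B': "elementary_pair 3 B0_mat B'"
    using B0_elementary[OF two] .
  obtain C' :: "'p laurent mat" where C': "elementary_pair 3 B1_mat C'"
    using B1_elementary .
  obtain E' :: "'p laurent mat" where E': "elementary_pair 3 E_mat E'"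
    using E_mat_elementary .
  define G' where "G' = E' * B'"
  have G': "elementary_pair 3 G_mat G'"
    unfolding G_mat_def G'_def by (rule elementary_pair.mult[OF B' E'])
  note pair_carrier = elementary_pair_carrier[OF B'] elementary_pair_carrier[OF C'] elementary_pair_carrier[OF G']
  have levi_sp: "symplectic 3 (levi_mat 3 A A')" "symplectic 3 (levi_mat 3 A' A)"
    if "elementary_pair 3 A A'" for A A' :: "'p laurent mat"
    using that elementary_pair_carrier[OF that] elementary_pair_inverse[OF that]
      elementary_pair_inverse[OF elementary_pair_swap[OF that]]
    by (auto intro!: symplectic_levi_mat)
  have levi_st: "stably_realizable 3 (levi_mat 3 A A')" "stably_realizable 3 (levi_mat 3 A' A)"
    if "elementary_pair 3 A A'" for A A' :: "'p laurent mat"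
    using stably_realizable_levi[OF two _ that] stably_realizable_levi[OF two _ elementary_pair_swap[OF that]]
    by auto
  define K where "K = ?h \<cdot>\<^sub>m (K_mat :: 'p laurent mat)"
  have K: "K \<in> carrier_mat 3 3" "dagger K = K"
    by (simp_all add: K_def dagger_smult dagger_K)
  have S: "S_mat k \<in> carrier_mat 3 3" "- S_mat k \<in> carrier_mat 3 3" "dagger (S_mat k) = S_mat k"
    "dagger (- S_mat k) = - S_mat k"
    by (simp_all add: dagger_S)
  define \<beta> where "\<beta> = four_block_mat (1\<^sub>m 3 + Q_mat k * T_mat k) (Q_mat k)
      (T_mat k * Q_mat k * T_mat k) (1\<^sub>m 3 + T_mat k * Q_mat k)"
  have qt: "1\<^sub>m 3 + Q_mat k * T_mat k \<in> carrier_mat 3 3" "T_mat k * Q_mat k * T_mat k \<in> carrier_mat 3 3"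
    "1\<^sub>m 3 + T_mat k * Q_mat k \<in> carrier_mat 3 3"
    by (auto intro!: add_carrier_mat square_mult_closed simp del: add_carrier_mat)
  have \<beta>c: "\<beta> \<in> ?N"
    unfolding \<beta>_def using four_block_square_carrier[OF qt(1,3)] by simp
  have \<beta>p: "dagger \<beta> * Lambda 3 * \<beta> = Lambda 3"
    unfolding \<beta>_def
    by (rule cayley_form_preserves_Lambda[OF QTS_carrier(1,2) dagger_T Q_relation[OF two k]])

  define X where "X = levi_mat 3 B1_mat C' * alpha3 k * levi_mat 3 C' B1_mat"
  define F where "F = levi_mat 3 B0_mat B' * lower_mat 3 K * X"
  have lowK: "symplectic 3 (lower_mat 3 K)" by (rule symplectic_lower_mat[OF K])
  have Xs: "symplectic 3 X"
    unfolding X_def by (intro symplectic_mult levi_sp[OF C'] alpha3_symplectic[OF two k])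
  have Fs: "symplectic 3 F"
    unfolding F_def by (intro symplectic_mult levi_sp(1)[OF B'] lowK Xs)

  define a where "a = 1\<^sub>m 3 + step \<cdot>\<^sub>m (proj12 :: 'p laurent mat)"
  define c where "c = (step * ?h) \<cdot>\<^sub>m (theta_mat :: 'p laurent mat)"
  have ac: "a \<in> carrier_mat 3 3" "c \<in> carrier_mat 3 3" by (simp_all add: a_def c_def)
  have as: "alpha3 k = four_block_mat a (step \<cdot>\<^sub>m pad (M_inv k)) (step \<cdot>\<^sub>m pad (M_mat k)) a"
    unfolding a_def by (rule alpha3_blocks[OF two k])
  have pc: "step \<cdot>\<^sub>m pad (M_inv k) \<in> carrier_mat 3 3" "step \<cdot>\<^sub>m pad (M_mat k) \<in> carrier_mat 3 3"
    "pad (M_mat k) \<in> carrier_mat 3 3"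
    by (simp_all add: pad_carrier)
  have dc: "dagger C' \<in> carrier_mat 3 3" "dagger B1_mat \<in> carrier_mat 3 3" "dagger B' \<in> carrier_mat 3 3"
    "dagger B0_mat \<in> carrier_mat 3 3"
    using pair_carrier by auto
  \<comment> \<open>\<open>B\<^sub>1\<close> is the identity on the third coordinate, so it commutes with the upper left block.\<close>
  have B1a: "B1_mat * a * C' = a"
  proof -
    have "B1_mat * a = B1_mat + step \<cdot>\<^sub>m (B1_mat * proj12)"
      unfolding a_def by (subst square_distrib_left[of _ 3]) (auto simp: square_smult[of _ 3] left_mult_one_mat[of _ 3 3] right_mult_one_mat[of _ 3 3])
    also have "\<dots> = a * B1_mat"
      unfolding a_def B1_proj12 by (subst square_distrib_right[of _ 3]) (auto simp: square_smult[of _ 3] left_mult_one_mat[of _ 3 3] right_mult_one_mat[of _ 3 3])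
    finally have "B1_mat * a * C' = a * (B1_mat * C')"
      using ac pair_carrier by (simp add: square_mult_assoc[of _ 3] del: assoc_mult_mat)
    then show ?thesis using ac by (simp add: elementary_pair_inverse[OF C'])
  qed
  have B1c: "dagger C' * (step \<cdot>\<^sub>m pad (M_mat k)) * C' = c"
  proof -
    have 1: "dagger C' * dagger B1_mat = 1\<^sub>m 3"
      unfolding dagger_mult[OF pair_carrier(3,4), symmetric] elementary_pair_inverse[OF C'] by (rule dagger_one)
    have "dagger C' * (dagger B1_mat * theta_mat * B1_mat) * C'
        = (dagger C' * dagger B1_mat) * theta_mat * (B1_mat * C')"
      using dc pair_carrier by (simp add: square_mult_assoc[of _ 3] square_mult_closed del: assoc_mult_mat)
    then have 2: "dagger C' * (dagger B1_mat * theta_mat * B1_mat) * C' = theta_mat"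
      by (simp add: 1 elementary_pair_inverse[OF C'] left_mult_one_mat[of _ 3 3] right_mult_one_mat[of _ 3 3])
    have tc: "dagger B1_mat * theta_mat * (B1_mat :: 'p laurent mat) \<in> carrier_mat 3 3"
      "dagger C' * (dagger B1_mat * theta_mat * B1_mat) \<in> carrier_mat 3 3"
      using dc by (auto intro!: square_mult_closed)
    show ?thesis
      unfolding pad_M smult_smult_mat square_smult(1)[OF dc(1) tc(1)] square_smult(2)[OF tc(2) pair_carrier(4)] 2 c_def ..
  qed
  obtain x2 x4 where x: "x2 \<in> carrier_mat 3 3" "x4 \<in> carrier_mat 3 3" "X = four_block_mat a x2 c x4"
  proof (rule that)
    show "X = four_block_mat a (B1_mat * (step \<cdot>\<^sub>m pad (M_inv k)) * dagger B1_mat) c (dagger C' * a * dagger B1_mat)"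
      unfolding X_def as levi_mat_mult_left[OF pair_carrier(3,4) ac(1) pc(1,2) ac(1)]
      by (subst levi_mat_mult_right[of _ 3])
        (auto simp: B1a B1c intro!: square_mult_closed pair_carrier ac pc dc)
  qed (auto intro!: square_mult_closed pair_carrier ac pc dc)
  have Ba: "B0_mat * a \<in> carrier_mat 3 3" "dagger B' * (K * a + c) \<in> carrier_mat 3 3"
    using pair_carrier ac K by (auto intro!: square_mult_closed)
  obtain f2 f4 where f: "f2 \<in> carrier_mat 3 3" "f4 \<in> carrier_mat 3 3"
    "F = four_block_mat (B0_mat * a) f2 (dagger B' * (K * a + c)) f4"
  proof (rule that)
    have k: "K * a + c \<in> carrier_mat 3 3" "K * x2 + x4 \<in> carrier_mat 3 3"
      using K ac x by (auto intro!: square_mult_closed)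
    have "F = levi_mat 3 B0_mat B' * (lower_mat 3 K * X)"
      unfolding F_def using Xs lowK levi_sp(1)[OF B']
      by (intro square_mult_assoc[of _ "2 * 3"]) (auto simp: symplectic_def)
    then show "F = four_block_mat (B0_mat * a) (B0_mat * x2) (dagger B' * (K * a + c)) (dagger B' * (K * x2 + x4))"
      unfolding x(3) lower_mat_mult_left[OF K(1) ac(1) x(1) ac(2) x(2)]
        levi_mat_mult_left[OF pair_carrier(1,2) ac(1) x(1) k] .
    show "B0_mat * x2 \<in> carrier_mat 3 3" "dagger B' * (K * x2 + x4) \<in> carrier_mat 3 3"
      using k x dc by (auto intro!: square_mult_closed)
  qed
  have TG: "T_mat k * G_mat = ?h \<cdot>\<^sub>m AB0_mat"
    unfolding T_mat_def by (simp add: square_smult[of _ 3] A_G)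
  have QTG: "Q_mat k * (T_mat k * G_mat) = (half * half) \<cdot>\<^sub>m PAB0_mat"
  proof -
    have "Q_mat k * (T_mat k * G_mat) = (?h * ?q) \<cdot>\<^sub>m PAB0_mat"
      unfolding TG Q_mat_def by (simp add: square_smult[of _ 3] smult_smult_mat P_AB0)
    also have "?h * ?q = half * half"
      unfolding const_mult[symmetric] using k by simp
    finally show ?thesis .
  qed
  have top: "(1\<^sub>m 3 + Q_mat k * T_mat k) * G_mat = B0_mat * a"
  proof -
    have "(1\<^sub>m 3 + Q_mat k * T_mat k) * G_mat = G_mat + Q_mat k * (T_mat k * G_mat)"
      using square_mult_closed[of "Q_mat k" 3 "T_mat k"]
      by (subst square_distrib_right[of _ 3]) (auto simp: square_mult_assoc[of _ 3] left_mult_one_mat[of _ 3 3])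
    then show ?thesis unfolding QTG a_def by (simp only: G_top_block[OF two])
  qed
  have bottom: "T_mat k * Q_mat k * T_mat k * G_mat = dagger B' * (K * a + c)"
  proof -
    let ?u = "mon (-1) (-1) (-1) :: 'p laurent"
    define V where "V = (?u + 1) \<cdot>\<^sub>m K_mat + (?u - 1) \<cdot>\<^sub>m (theta_mat :: 'p laurent mat)"
    have V: "V \<in> carrier_mat 3 3" by (simp add: V_def)
    have AD: "A_mat * PAB0_mat \<in> carrier_mat 3 3" by (auto intro!: square_mult_closed)
    have 1: "T_mat k * Q_mat k * T_mat k * G_mat = (?h * (half * half)) \<cdot>\<^sub>m (A_mat * PAB0_mat)"
    proof -
      have "T_mat k * Q_mat k * T_mat k * G_mat = T_mat k * (Q_mat k * (T_mat k * G_mat))"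
        by (simp add: square_mult_assoc[of _ 3] square_mult_closed del: assoc_mult_mat)
      also have "\<dots> = (half * half * ?h) \<cdot>\<^sub>m (A_mat * PAB0_mat)"
        unfolding QTG by (simp add: T_mat_def square_smult[of _ 3] smult_smult_mat)
      finally show ?thesis by (simp only: mult_ac)
    qed
    have hh: "?h * (half * half) * 2 = ?h * half"
    proof -
      have "?h * (half * half) * 2 = ?h * half * (half + half)"
        by (simp only: mult_2_right mult.assoc distrib_left)
      then show ?thesis by (simp only: half_add_half[OF two] mult_1_right)
    qed
    have 2: "dagger B0_mat * (T_mat k * Q_mat k * T_mat k * G_mat) = (?h * half) \<cdot>\<^sub>m V"
      unfolding 1 square_smult(1)[OF dc(4) AD] dagger_B0_A_PAB0 smult_smult_mat hh V_def ..
    have Ka: "K * a = (?h * (1 + step)) \<cdot>\<^sub>m K_mat"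
    proof -
      have "K_mat * a = K_mat + step \<cdot>\<^sub>m (K_mat * proj12)"
        unfolding a_def by (subst square_distrib_left[of _ 3]) (auto simp: square_smult[of _ 3] left_mult_one_mat[of _ 3 3] right_mult_one_mat[of _ 3 3])
      then have "K_mat * a = (1 + step) \<cdot>\<^sub>m K_mat"
        unfolding K_proj12 by (auto simp: algebra_simps intro!: eq_matI)
      then show ?thesis
        unfolding K_def using ac by (simp add: square_smult[of _ 3] smult_smult_mat)
    qed
    have s: "1 + step = half * (?u + 1)" "step = half * (?u - 1)"
    proof -
      have "1 + step = half + half + half * (?u - 1)"
        by (simp only: half_add_half[OF two] step_def)
      then show "1 + step = half * (?u + 1)" by (simp add: algebra_simps)
    qed (rule step_def)
    have kt: "dim_row (K_mat :: 'p laurent mat) = 3" "dim_col (K_mat :: 'p laurent mat) = 3"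
      "dim_row (theta_mat :: 'p laurent mat) = 3" "dim_col (theta_mat :: 'p laurent mat) = 3"
      by (simp_all add: K_mat_def theta_mat_def)
    have 3: "K * a + c = (?h * half) \<cdot>\<^sub>m V"
      unfolding Ka c_def V_def unfolding s(1) unfolding s(2)
      using kt by (intro eq_matI) (auto simp: algebra_simps)
    have B'B: "dagger B' * dagger B0_mat = 1\<^sub>m 3"
      unfolding dagger_mult[OF pair_carrier(1,2), symmetric] elementary_pair_inverse[OF B'] by (rule dagger_one)
    have Y: "T_mat k * Q_mat k * T_mat k * G_mat \<in> carrier_mat 3 3"
      by (auto intro!: square_mult_closed)
    have "T_mat k * Q_mat k * T_mat k * G_mat
        = (dagger B' * dagger B0_mat) * (T_mat k * Q_mat k * T_mat k * G_mat)"
      using Y by (simp only: B'B left_mult_one_mat[OF Y])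
    also have "\<dots> = dagger B' * (dagger B0_mat * (T_mat k * Q_mat k * T_mat k * G_mat))"
      by (rule square_mult_assoc[OF dc(3,4) Y])
    finally show ?thesis by (simp only: 2 3)
  qed
  obtain b2 b4 where b: "b2 \<in> carrier_mat 3 3" "b4 \<in> carrier_mat 3 3"
    "\<beta> * levi_mat 3 G_mat G' = four_block_mat (B0_mat * a) b2 (dagger B' * (K * a + c)) b4"
  proof (rule that)
    show "\<beta> * levi_mat 3 G_mat G' = four_block_mat (B0_mat * a) (Q_mat k * dagger G')
        (dagger B' * (K * a + c)) ((1\<^sub>m 3 + T_mat k * Q_mat k) * dagger G')"
      unfolding \<beta>_def levi_mat_mult_right[OF pair_carrier(5,6) qt(1) QTS_carrier(1) qt(2,3)] top bottom ..
    show "Q_mat k * dagger G' \<in> carrier_mat 3 3" "(1\<^sub>m 3 + T_mat k * Q_mat k) * dagger G' \<in> carrier_mat 3 3"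
      using pair_carrier qt by (auto intro!: square_mult_closed)
  qed
  have "dagger (\<beta> * levi_mat 3 G_mat G') * Lambda 3 * (\<beta> * levi_mat 3 G_mat G') = Lambda 3"
    using \<beta>c \<beta>p levi_sp(1)[OF G'] by (intro preserves_Lambda_mult) (auto simp: symplectic_def)
  then obtain U where U: "U \<in> carrier_mat 3 3" "dagger U = U" "\<beta> * levi_mat 3 G_mat G' = F * upper_mat 3 U"
    using same_first_block_column[OF Ba(1) b(1) Ba(2) b(2) f(1,2)] Fs unfolding b(3) f(3) by metis
  let ?L = "lower_mat 3 (S_mat k) * (levi_mat 3 B0_mat B' * (lower_mat 3 K * levi_mat 3 B1_mat C'))"
  let ?R = "levi_mat 3 C' B1_mat * (upper_mat 3 U * (levi_mat 3 G' G_mat * lower_mat 3 (- S_mat k)))"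
  show thesis
  proof (rule that)
    show "stably_realizable 3 ?L"
      by (intro stably_realizable_mult stably_realizable_lower[OF two] levi_st(1)[OF B'] levi_st(1)[OF C'])
        (simp_all add: S K)
    show "stably_realizable 3 ?R"
      by (intro stably_realizable_mult stably_realizable_lower[OF two] stably_realizable_upper[OF two]
          levi_st(2)[OF C'] levi_st(2)[OF G']) (simp_all add: S U)
    show "symplectic 3 ?L"
      by (intro symplectic_mult symplectic_lower_mat levi_sp(1)[OF B'] levi_sp(1)[OF C'])
        (simp_all add: S K)
    show "symplectic 3 ?R"
      by (intro symplectic_mult symplectic_lower_mat symplectic_upper_mat levi_sp(2)[OF C'] levi_sp(2)[OF G'])
        (simp_all add: S U)
    have cc: "lower_mat 3 (S_mat k) \<in> ?N" "lower_mat 3 (- S_mat k) \<in> ?N" "upper_mat 3 U \<in> ?N"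
      "levi_mat 3 G_mat G' \<in> ?N" "levi_mat 3 G' G_mat \<in> ?N" "levi_mat 3 B0_mat B' \<in> ?N"
      "levi_mat 3 B1_mat C' \<in> ?N" "levi_mat 3 C' B1_mat \<in> ?N" "lower_mat 3 K \<in> ?N" "alpha3 k \<in> ?N"
      using levi_sp[OF B'] levi_sp[OF C'] levi_sp[OF G'] lowK alpha3_symplectic[OF two k]
        symplectic_lower_mat[OF S(1,3)] symplectic_lower_mat[OF S(2,4)] symplectic_upper_mat[OF U(1,2)]
      by (simp_all add: symplectic_def)
    have GG: "levi_mat 3 G_mat G' * levi_mat 3 G' G_mat = 1\<^sub>m 6"
      using pair_carrier elementary_pair_inverse[OF G']
      by (simp add: levi_mat_mult) (simp add: levi_mat_def)
    have "\<beta> = \<beta> * (levi_mat 3 G_mat G' * levi_mat 3 G' G_mat)"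
      using \<beta>c by (simp add: GG)
    also have "\<dots> = \<beta> * levi_mat 3 G_mat G' * levi_mat 3 G' G_mat"
      using \<beta>c cc by (intro square_mult_assoc[symmetric])
    also have "\<dots> = F * upper_mat 3 U * levi_mat 3 G' G_mat" by (simp only: U)
    finally have \<beta>F: "\<beta> = F * upper_mat 3 U * levi_mat 3 G' G_mat" .
    have "alpha_TQFT k = lower_mat 3 (S_mat k) * \<beta> * lower_mat 3 (- S_mat k)"
      unfolding \<beta>_def by (rule alpha_TQFT_conjugate[OF two k])
    then show "alpha_TQFT k = ?L * alpha3 k * ?R"
      unfolding \<beta>F F_def X_def using cc
      by (simp add: square_mult_assoc[of _ 6] square_mult_closed del: assoc_mult_mat)
  qed
qed

lemma symplectic_ti_clifford_qca:
  assumes "symplectic q A"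
  shows "ti_clifford_qca q A"
proof -
  have c: "A \<in> carrier_mat (2 * q) (2 * q)" "symp_inv q A \<in> carrier_mat (2 * q) (2 * q)"
    using assms by (auto simp: symplectic_def)
  have "inverts_mat A (symp_inv q A)" "inverts_mat (symp_inv q A) A"
    using symp_inv_left[OF assms] symp_inv_right[OF assms] carrier_matD[OF c(1)] carrier_matD[OF c(2)]
    by (simp_all only: inverts_mat_def)
  then show ?thesis
    using assms c unfolding ti_clifford_qca_def invertible_mat_def symplectic_def by auto
qed

text \<open>The case of the trivial conjugation.\<close>

lemma stably_realizable_stabilize:
  assumes "stably_realizable q A"
  shows "realizable (q + 1) (\<lambda>v. stabilize q (Suc 0) A *\<^sub>v v)"
proof -
  let ?I = "1\<^sub>m (2 * q) :: 'a laurent mat"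
  have A: "A \<in> carrier_mat (2 * q) (2 * q)" using assms by (simp add: stably_realizable_def)
  have "symp_inv q ?I = symp_inv q ?I * ?I"
    by (rule right_mult_one_mat[symmetric, of _ "2 * q" "2 * q"]) simp
  also have "\<dots> = ?I" by (rule symp_inv_left[OF symplectic_one])
  finally have "?I * A * symp_inv q ?I = A"
    using A by simp
  then show ?thesis
    using assms symplectic_one[of q] unfolding stably_realizable_def by metis
qed

theorem mainTheorem8:
  fixes k :: "('p :: prime_card) mod_ring"
  assumes "odd CARD('p)" and "k \<noteq> 0"
  shows "ti_clifford_qca 3 (alpha_TQFT k) \<and> ti_clifford_qca 2 (alpha_ISA k) \<and>
         qca_equivalent 3 (alpha_TQFT k) 2 (alpha_ISA k)"
proof (intro conjI)
  have two: "(2 :: 'p mod_ring) \<noteq> 0" by (rule two_nonzero[OF assms(1)])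
  note k = assms(2)
  let ?\<alpha> = "alpha3 k"
  obtain L R where L: "stably_realizable 3 L" "symplectic 3 L" and R: "stably_realizable 3 R" "symplectic 3 R"
    and LR: "alpha_TQFT k = L * ?\<alpha> * R"
    using alpha_TQFT_factorization[OF two k] by metis
  have \<alpha>: "symplectic 3 ?\<alpha>" by (rule alpha3_symplectic[OF two k])
  show "ti_clifford_qca 3 (alpha_TQFT k)"
    unfolding LR by (intro symplectic_ti_clifford_qca symplectic_mult L R \<alpha>)
  have I: "symplectic 2 (alpha_ISA k)" by (rule alpha_ISA_symplectic[OF two k])
  show "ti_clifford_qca 2 (alpha_ISA k)"
    by (rule symplectic_ti_clifford_qca[OF I])
  \<comment> \<open>\<open>\<alpha>\<^sub>T\<^sub>Q\<^sub>F\<^sub>T = L (\<alpha> R \<alpha>\<^sup>-\<^sup>1) \<alpha>\<close>, and one ancilla makes the two factors in front realizable.\<close>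
  let ?R = "?\<alpha> * R * symp_inv 3 ?\<alpha>"
  let ?S = "stabilize 3 (Suc 0) :: 'p laurent mat \<Rightarrow> 'p laurent mat"
  define f where "f = (\<lambda>v. ?S L *\<^sub>v (?S ?R *\<^sub>v v))"
  have c: "L \<in> carrier_mat (2 * 3) (2 * 3)" "R \<in> carrier_mat (2 * 3) (2 * 3)"
      "?\<alpha> \<in> carrier_mat (2 * 3) (2 * 3)"
    using L R \<alpha> by (simp_all only: symplectic_def)
  note c = c symp_inv_carrier[OF c(3)]
  have cR: "?R \<in> carrier_mat (2 * 3) (2 * 3)" "?R * ?\<alpha> \<in> carrier_mat (2 * 3) (2 * 3)"
    using c by (auto intro!: square_mult_closed)
  have "realizable (3 + 1) (\<lambda>v. ?S L *\<^sub>v v)" by (rule stably_realizable_stabilize[OF L(1)])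
  moreover have "realizable (3 + 1) (\<lambda>v. ?S ?R *\<^sub>v v)"
    using R(1) \<alpha> unfolding stably_realizable_def by blast
  ultimately have f: "realizable (3 + 1) f"
    unfolding f_def by (rule realizable_comp)
  have "?R * ?\<alpha> = ?\<alpha> * R * (symp_inv 3 ?\<alpha> * ?\<alpha>)"
    using c by (intro square_mult_assoc[of _ "2 * 3"] square_mult_closed)
  also have "\<dots> = ?\<alpha> * R"
    unfolding symp_inv_left[OF \<alpha>] using c by (intro right_mult_one_mat[of _ "2 * 3" "2 * 3"] square_mult_closed)
  finally have T: "alpha_TQFT k = L * (?R * ?\<alpha>)"
    unfolding LR using c by (simp add: square_mult_assoc[of _ 6] del: assoc_mult_mat)
  have "alpha_ISA k \<in> carrier_mat (2 * 2) (2 * 2)" using I by (simp only: symplectic_def)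
  then have S2: "?S ?\<alpha> = stabilize 2 2 (alpha_ISA k)"
    using stabilize_stabilize[of "alpha_ISA k" 2 1 1] by (simp add: alpha3_def numeral_2_eq_2[symmetric])
  have "stabilize 3 1 (alpha_TQFT k) *\<^sub>v v = f (stabilize 2 2 (alpha_ISA k) *\<^sub>v v)"
    if v: "v \<in> carrier_vec (2 * (3 + 1))" for v
  proof -
    have "?S (alpha_TQFT k) *\<^sub>v v = ?S L *\<^sub>v (?S (?R * ?\<alpha>) *\<^sub>v v)"
      unfolding T by (rule stabilize_mult[OF c(1) cR(2) v])
    also have "?S (?R * ?\<alpha>) *\<^sub>v v = ?S ?R *\<^sub>v (?S ?\<alpha> *\<^sub>v v)"
      by (rule stabilize_mult[OF cR(1) c(3) v])
    finally show ?thesis by (simp add: f_def S2)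
  qed
  then show "qca_equivalent 3 (alpha_TQFT k) 2 (alpha_ISA k)"
    using f unfolding qca_equivalent_def realizable_def
    by (intro exI[of _ 1] exI[of _ 2] exI[of _ f]) auto
qed

end
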